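(* Let $M$ be a finite-dimensional Riemannian manifold, let $f:M\to(-\infty,+\infty]$ be a lower semicontinuous function, and let $x\in M$, $\zeta\in TM_x^*$, $A\in\mathcal{L}^2_s(TM_x,\mathbb{R})$. Then $$(\zeta,A)\in\overline{J}^{2,-}f(x)\iff(\zeta,A)\in\overline{J}^{2,-}(f\circ\exp_x)(0_x).$$
   Context: $\mathcal{L}^2_s(TM_x,\mathbb{R})$ is the space of symmetric bilinear forms on $TM_x$. For a lower semicontinuous function $f$ on a Riemannian manifold, $$J^{2,-}f(x)=\{(d\varphi(x),d^2\varphi(x)):\varphi\text{ is }C^2,\ f-\varphi\text{ attains a local minimum at }x\}$$ (the same set results if $\varphi$ is only required to be $C^2$ near $x$), where $d^2\varphi$ is the Riemannian Hessian. $\overline{J}^{2,-}f(x)$ is the set of $(\zeta,A)\in TM_x^*\times\mathcal{L}^2_s(TM_x)$ for which there exist $x_n\in M$ and $(\zeta_n,A_n)\in J^{2,-}f(x_n)$ with $(x_n,f(x_n),\zeta_n,A_n)\to(x,f(x),\zeta,A)$. Here $\zeta_n\to\zeta$ (resp. $A_n\to A$) means $x_n\to x$ and $\langle\zeta_n,V(x_n)\rangle\to\langle\zeta,V(x)\rangle$ (resp. $\langle A_nV(x_n),V(x_n)\rangle\to\langle AV(x),V(x)\rangle$) for every vector field $V$ defined on an open neighborhood of $x$. The function $f\circ\exp_x$ is considered on a neighborhood of the origin $0_x$ in the Euclidean space $TM_x$, on which $\exp_x$ is a diffeomorphism onto its image, and the tangent space of $TM_x$ at $0_x$ is identified with $TM_x$.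 *)

theory Defs
  imports "HOL-Analysis.Analysis"
begin

section \<open>Functions of class \<open>C\<^sup>k\<close> on open subsets of a Euclidean space\<close>

text \<open>The domain \<open>S\<close> is always an open set, so that unrestricted derivatives are the right ones.\<close>

fun Ck_on :: "nat \<Rightarrow> 'a::euclidean_space set \<Rightarrow> ('a \<Rightarrow> 'b::real_normed_vector) \<Rightarrow> bool" where
  "Ck_on 0 S f \<longleftrightarrow> continuous_on S f"
| "Ck_on (Suc k) S f \<longleftrightarrow>
     (\<forall>p\<in>S. f differentiable (at p)) \<and> (\<forall>v. Ck_on k S (\<lambda>p. frechet_derivative f (at p) v))"

definition smooth_on :: "'a::euclidean_space set \<Rightarrow> ('a \<Rightarrow> 'b::real_normed_vector) \<Rightarrow> bool" where
  "smooth_on S f \<longleftrightarrow> (\<forall>k. Ck_on k S f)"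

section \<open>Riemannian manifolds\<close>

text \<open>
  A chart is a pair of its domain and its coordinate map; the values of the coordinate map outside
  the domain are irrelevant. The points of a manifold are those of the union of its chart domains,
  an open subset of the ambient Hausdorff type, with the subspace topology.
\<close>

type_synonym ('m, 'e) chart = "'m set \<times> ('m \<Rightarrow> 'e)"

abbreviation chart_dom :: "('m, 'e) chart \<Rightarrow> 'm set" where
  "chart_dom c \<equiv> fst c"

abbreviation chart_map :: "('m, 'e) chart \<Rightarrow> 'm \<Rightarrow> 'e" where
  "chart_map c \<equiv> snd c"

definition chart_inv :: "('m, 'e) chart \<Rightarrow> 'e \<Rightarrow> 'm" where
  "chart_inv c = inv_into (chart_dom c) (chart_map c)"

text \<open>
  The structure singles out a chart \<open>pref_chart M x\<close> around every point \<open>x\<close>, which identifies the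
  tangent space at \<open>x\<close> with the model space \<open>'e\<close>. Vectors, covectors, bilinear forms and the metric
  at \<open>x\<close> are expressed in these coordinates. In general \<open>metric M x\<close> is not the inner product of the
  type \<open>'e\<close>. The preferred charts are arbitrary and need not depend continuously on \<open>x\<close>.
\<close>

record ('m, 'e) riem_structure =
  atlas :: "('m, 'e) chart set"
  pref_chart :: "'m \<Rightarrow> ('m, 'e) chart"
  metric :: "'m \<Rightarrow> 'e \<Rightarrow> 'e \<Rightarrow> real"

definition points :: "('m, 'e) riem_structure \<Rightarrow> 'm set" where
  "points M = (\<Union>c\<in>atlas M. chart_dom c)"

definition transition_deriv ::
    "('m, 'e) chart \<Rightarrow> ('m, 'e::euclidean_space) chart \<Rightarrow> 'm \<Rightarrow> 'e \<Rightarrow> 'e" where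
  "transition_deriv c d x =
     frechet_derivative (\<lambda>p. chart_map d (chart_inv c p)) (at (chart_map c x))"

definition coord_metric ::
    "('m, 'e::euclidean_space) riem_structure \<Rightarrow> ('m, 'e) chart \<Rightarrow> 'e \<Rightarrow> 'e \<Rightarrow> 'e \<Rightarrow> real" where
  "coord_metric M c p u w =
     (let x = chart_inv c p; T = transition_deriv c (pref_chart M x) x in metric M x (T u) (T w))"

definition inner_product_form :: "('e::real_vector \<Rightarrow> 'e \<Rightarrow> real) \<Rightarrow> bool" where
  "inner_product_form g \<longleftrightarrow>
     bilinear g \<and> (\<forall>u w. g u w = g w u) \<and> (\<forall>u. u \<noteq> 0 \<longrightarrow> g u u > 0)"

definition riemannian_manifold ::
    "('m::t2_space, 'e::euclidean_space) riem_structure \<Rightarrow> bool" where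
  "riemannian_manifold M \<longleftrightarrow>
     (\<forall>c\<in>atlas M. open (chart_dom c) \<and> open (chart_map c ` chart_dom c) \<and>
        homeomorphism (chart_dom c) (chart_map c ` chart_dom c) (chart_map c) (chart_inv c)) \<and>
     (\<forall>c\<in>atlas M. \<forall>d\<in>atlas M.
        smooth_on (chart_map c ` (chart_dom c \<inter> chart_dom d)) (\<lambda>p. chart_map d (chart_inv c p))) \<and>
     (\<forall>x\<in>points M. pref_chart M x \<in> atlas M \<and> x \<in> chart_dom (pref_chart M x)) \<and>
     (\<forall>x\<in>points M. inner_product_form (metric M x)) \<and>
     (\<forall>c\<in>atlas M. \<forall>u w. smooth_on (chart_map c ` chart_dom c) (\<lambda>p. coord_metric M c p u w))"

section \<open>Smooth maps, \<open>C\<^sup>2\<close> functions and vector fields\<close>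

definition smooth_map ::
    "('m::t2_space, 'e::euclidean_space) riem_structure \<Rightarrow>
     ('n::t2_space, 'd::euclidean_space) riem_structure \<Rightarrow> 'm set \<Rightarrow> ('m \<Rightarrow> 'n) \<Rightarrow> bool" where
  "smooth_map M N S F \<longleftrightarrow>
     S \<subseteq> points M \<and> F ` S \<subseteq> points N \<and> continuous_on S F \<and>
     (\<forall>c\<in>atlas M. \<forall>d\<in>atlas N.
        smooth_on (chart_map c ` (S \<inter> chart_dom c \<inter> F -` chart_dom d))
          (\<lambda>p. chart_map d (F (chart_inv c p))))"

definition diffeo_onto_image ::
    "('m::t2_space, 'e::euclidean_space) riem_structure \<Rightarrow>
     ('n::t2_space, 'd::euclidean_space) riem_structure \<Rightarrow> 'm set \<Rightarrow> ('m \<Rightarrow> 'n) \<Rightarrow> bool" where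
  "diffeo_onto_image M N S F \<longleftrightarrow>
     open S \<and> open (F ` S) \<and> inj_on F S \<and>
     smooth_map M N S F \<and> smooth_map N M (F ` S) (inv_into S F)"

definition C2_near ::
    "('m::t2_space, 'e::euclidean_space) riem_structure \<Rightarrow> 'm \<Rightarrow> ('m \<Rightarrow> real) \<Rightarrow> bool" where
  "C2_near M x \<phi> \<longleftrightarrow>
     (\<exists>W. open W \<and> x \<in> W \<and> W \<subseteq> points M \<and>
        (\<forall>c\<in>atlas M. Ck_on 2 (chart_map c ` (W \<inter> chart_dom c)) (\<lambda>p. \<phi> (chart_inv c p))))"

text \<open>The value \<open>V y\<close> is a tangent vector at \<open>y\<close>, hence given in the preferred chart at \<open>y\<close>.\<close>

definition smooth_vector_field ::
    "('m::t2_space, 'e::euclidean_space) riem_structure \<Rightarrow> 'm set \<Rightarrow> ('m \<Rightarrow> 'e) \<Rightarrow> bool" where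
  "smooth_vector_field M W V \<longleftrightarrow>
     open W \<and> W \<subseteq> points M \<and>
     (\<forall>c\<in>atlas M. smooth_on (chart_map c ` (W \<inter> chart_dom c))
        (\<lambda>p. let y = chart_inv c p in transition_deriv (pref_chart M y) c y (V y)))"

section \<open>Levi-Civita connection, Hessian and exponential map\<close>

text \<open>
  Koszul's formula for the vector fields with constant coordinates \<open>u\<close>, \<open>w\<close>, \<open>z\<close> in the chart \<open>c\<close>:
  \<open>christoffel M c p u w\<close> is \<open>\<nabla>\<^sub>u w\<close> at the point with coordinates \<open>p\<close>,
  that is, \<open>\<Gamma>\<^sup>k\<^sub>i\<^sub>j u\<^sup>i w\<^sup>j\<close>.
\<close>

definition christoffel ::
    "('m, 'e::euclidean_space) riem_structure \<Rightarrow> ('m, 'e) chart \<Rightarrow> 'e \<Rightarrow> 'e \<Rightarrow> 'e \<Rightarrow> 'e" where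
  "christoffel M c p u w =
     (THE y. \<forall>z. 2 * coord_metric M c p y z =
          frechet_derivative (\<lambda>q. coord_metric M c q w z) (at p) u
        + frechet_derivative (\<lambda>q. coord_metric M c q u z) (at p) w
        - frechet_derivative (\<lambda>q. coord_metric M c q u w) (at p) z)"

definition differential ::
    "('m, 'e::euclidean_space) riem_structure \<Rightarrow> ('m \<Rightarrow> real) \<Rightarrow> 'm \<Rightarrow> 'e \<Rightarrow> real" where
  "differential M \<phi> x =
     (let c = pref_chart M x
      in frechet_derivative (\<lambda>p. \<phi> (chart_inv c p)) (at (chart_map c x)))"

text \<open>\<open>d\<^sup>2\<phi>(u, w) = u(w\<phi>) - (\<nabla>\<^sub>u w)\<phi>\<close>, with \<open>u\<close> and \<open>w\<close> extended by constant coordinates in the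
  preferred chart at \<open>x\<close>.\<close>

definition hessian ::
    "('m, 'e::euclidean_space) riem_structure \<Rightarrow> ('m \<Rightarrow> real) \<Rightarrow> 'm \<Rightarrow> 'e \<Rightarrow> 'e \<Rightarrow> real" where
  "hessian M \<phi> x u w =
     (let c = pref_chart M x; p = chart_map c x; \<psi> = (\<lambda>q. \<phi> (chart_inv c q))
      in frechet_derivative (\<lambda>q. frechet_derivative \<psi> (at q) w) (at p) u
         - frechet_derivative \<psi> (at p) (christoffel M c p u w))"

text \<open>In each chart, \<open>d\<close> is the coordinate velocity of \<open>\<gamma>\<close>, constrained only at those times where
  \<open>\<gamma>\<close> is in the domain of the chart; as these domains are open, the derivatives are local.\<close>

definition geodesic ::
    "('m::t2_space, 'e::euclidean_space) riem_structure \<Rightarrow> real set \<Rightarrow> (real \<Rightarrow> 'm) \<Rightarrow> bool" where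
  "geodesic M I \<gamma> \<longleftrightarrow>
     continuous_on I \<gamma> \<and> \<gamma> ` I \<subseteq> points M \<and>
     (\<forall>c\<in>atlas M. \<exists>d. \<forall>t\<in>I. \<gamma> t \<in> chart_dom c \<longrightarrow>
        ((\<lambda>s. chart_map c (\<gamma> s)) has_vector_derivative d t) (at t within I) \<and>
        (d has_vector_derivative - christoffel M c (chart_map c (\<gamma> t)) (d t) (d t)) (at t within I))"

definition geodesic_from ::
    "('m::t2_space, 'e::euclidean_space) riem_structure \<Rightarrow> 'm \<Rightarrow> 'e \<Rightarrow> (real \<Rightarrow> 'm) \<Rightarrow> bool" where
  "geodesic_from M x v \<gamma> \<longleftrightarrow>
     geodesic M {0..1} \<gamma> \<and> \<gamma> 0 = x \<and>
     ((\<lambda>t. chart_map (pref_chart M x) (\<gamma> t)) has_vector_derivative v) (at 0 within {0..1})"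

definition exp_dom ::
    "('m::t2_space, 'e::euclidean_space) riem_structure \<Rightarrow> 'm \<Rightarrow> 'e set" where
  "exp_dom M x = {v. \<exists>\<gamma>. geodesic_from M x v \<gamma>}"

text \<open>Geodesics with given initial velocity are unique, so \<open>riem_exp M x\<close> is meaningful on \<open>exp_dom M x\<close>;
  elsewhere its value is unspecified.\<close>

definition riem_exp ::
    "('m::t2_space, 'e::euclidean_space) riem_structure \<Rightarrow> 'm \<Rightarrow> 'e \<Rightarrow> 'm" where
  "riem_exp M x v = (THE y. \<exists>\<gamma>. geodesic_from M x v \<gamma> \<and> \<gamma> 1 = y)"

text \<open>The open subset \<open>U\<close> of the Euclidean space \<open>TM\<^sub>x\<close>, as a Riemannian manifold: one global chart
  and constant metric \<open>metric M x\<close>. Its tangent spaces are thereby identified with \<open>TM\<^sub>x\<close>.\<close>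

definition tangent_manifold ::
    "('m, 'e) riem_structure \<Rightarrow> 'm \<Rightarrow> 'e set \<Rightarrow> ('e, 'e) riem_structure" where
  "tangent_manifold M x U =
     \<lparr>atlas = {(U, \<lambda>v. v)}, pref_chart = (\<lambda>_. (U, \<lambda>v. v)), metric = (\<lambda>_. metric M x)\<rparr>"

definition normal_domain ::
    "('m::t2_space, 'e::euclidean_space) riem_structure \<Rightarrow> 'm \<Rightarrow> 'e set \<Rightarrow> bool" where
  "normal_domain M x U \<longleftrightarrow>
     open U \<and> 0 \<in> U \<and> U \<subseteq> exp_dom M x \<and>
     diffeo_onto_image (tangent_manifold M x U) M U (riem_exp M x)"

section \<open>Second order subjets\<close>

definition lower_semicontinuous_on :: "'m::topological_space set \<Rightarrow> ('m \<Rightarrow> ereal) \<Rightarrow> bool" where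
  "lower_semicontinuous_on S f \<longleftrightarrow> (\<forall>x\<in>S. \<forall>a<f x. \<forall>\<^sub>F y in at x within S. a < f y)"

definition symmetric_bilinear :: "('e::real_vector \<Rightarrow> 'e \<Rightarrow> real) \<Rightarrow> bool" where
  "symmetric_bilinear A \<longleftrightarrow> bilinear A \<and> (\<forall>u w. A u w = A w u)"

definition subjet ::
    "('m::t2_space, 'e::euclidean_space) riem_structure \<Rightarrow> ('m \<Rightarrow> ereal) \<Rightarrow> 'm \<Rightarrow>
     (('e \<Rightarrow> real) \<times> ('e \<Rightarrow> 'e \<Rightarrow> real)) set" where
  "subjet M f x =
     {(differential M \<phi> x, hessian M \<phi> x) | \<phi>. C2_near M x \<phi> \<and>
        (\<forall>\<^sub>F y in at x within points M. f x - ereal (\<phi> x) \<le> f y - ereal (\<phi> y))}"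

definition jet_tendsto ::
    "('m::t2_space, 'e::euclidean_space) riem_structure \<Rightarrow>
     (nat \<Rightarrow> 'm) \<Rightarrow> (nat \<Rightarrow> 'e \<Rightarrow> real) \<Rightarrow> (nat \<Rightarrow> 'e \<Rightarrow> 'e \<Rightarrow> real) \<Rightarrow>
     'm \<Rightarrow> ('e \<Rightarrow> real) \<Rightarrow> ('e \<Rightarrow> 'e \<Rightarrow> real) \<Rightarrow> bool" where
  "jet_tendsto M X Z B x \<zeta> A \<longleftrightarrow>
     X \<longlonglongrightarrow> x \<and>
     (\<forall>W V. x \<in> W \<and> smooth_vector_field M W V \<longrightarrow>
        (\<lambda>n. Z n (V (X n))) \<longlonglongrightarrow> \<zeta> (V x) \<and>
        (\<lambda>n. B n (V (X n)) (V (X n))) \<longlonglongrightarrow> A (V x) (V x))"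

definition limiting_subjet ::
    "('m::t2_space, 'e::euclidean_space) riem_structure \<Rightarrow> ('m \<Rightarrow> ereal) \<Rightarrow> 'm \<Rightarrow>
     (('e \<Rightarrow> real) \<times> ('e \<Rightarrow> 'e \<Rightarrow> real)) set" where
  "limiting_subjet M f x =
     {(\<zeta>, A). linear \<zeta> \<and> symmetric_bilinear A \<and>
        (\<exists>X Z B. (\<forall>n. X n \<in> points M \<and> (Z n, B n) \<in> subjet M f (X n)) \<and>
           (\<lambda>n. f (X n)) \<longlonglongrightarrow> f x \<and> jet_tendsto M X Z B x \<zeta> A)}"

end

theory Submission
  imports Defs
begin

text \<open>
  Both limiting subjets are compared with one and the same object: the limiting second order
  jet of a function on a Euclidean space, which knows only ordinary first and second derivatives
  of the test functions (\<open>coordinate_limiting_jet\<close>).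

  In a fixed chart around \<open>x\<close>, with \<open>p\<close> the coordinates of \<open>x\<close> and \<open>h\<close> the function \<open>f\<close> read in
  the chart, the Riemannian Hessian of a test function is its ordinary second derivative minus its
  first derivative applied to the Christoffel symbol \<open>\<Gamma>\<close>. Along a sequence of jets at points
  \<open>p\<^sub>n \<rightarrow> p\<close> the first derivatives converge to \<open>\<zeta>\<close> and \<open>\<Gamma>(p\<^sub>n) \<rightarrow> \<Gamma>(p)\<close>, so that the correction
  term converges to \<open>\<zeta>(\<Gamma>(p)(u, u))\<close>. Hence \<open>(\<zeta>, A)\<close> is a limiting subjet of \<open>f\<close> at \<open>x\<close> iff
  \<open>(\<zeta>, A(u, u) + \<zeta>(\<Gamma>(p)(u, u)))\<close> is a limiting jet of \<open>h\<close> at \<open>p\<close>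
  (\<open>limiting_subjet_chart\<close>). The points \<open>x\<^sub>n\<close> come with their own preferred charts,
  which need not vary continuously; this does no harm because the Hessian does not depend on the
  chart (\<open>levi_civita_transform\<close>, \<open>differential_chart\<close>). The same result
  applies to the flat manifold \<open>TM\<^sub>x\<close>, where \<open>\<Gamma> = 0\<close>.

  Euclidean limiting jets are transported by a \<open>C\<^sup>2\<close> change of variables \<open>F\<close> by the second order
  chain rule: \<open>(\<zeta>, Q)\<close> becomes \<open>(\<zeta> \<circ> DF, Q(DF u) + \<zeta>(D\<^sup>2F(u, u)))\<close>
  (\<open>coordinate_limiting_jet_compose\<close>). For the exponential map read in the chart, \<open>DF(0)\<close>
  is the identity and \<open>D\<^sup>2F(0)(u, u) = -\<Gamma>(p)(u, u)\<close>, by the geodesic equation along the rays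
  \<open>t \<mapsto> t u\<close> (\<open>exp_second_order\<close>). The two correction terms \<open>\<zeta>(\<Gamma>(p)(u, u))\<close> therefore cancel,
  and the inverse map gives the other implication.

  That \<open>exp\<^sub>x(t v)\<close> is the geodesic with initial velocity \<open>v\<close> at time \<open>t\<close> rests on the uniqueness of
  geodesics (\<open>geodesic_unique\<close>), which follows from a Gronwall estimate since \<open>\<Gamma>\<close> is locally
  Lipschitz.
\<close>

section \<open>Calculus of \<open>C\<^sup>k\<close> maps\<close>

abbreviation D :: "('a::euclidean_space \<Rightarrow> 'b::real_normed_vector) \<Rightarrow> 'a \<Rightarrow> 'a \<Rightarrow> 'b" where
  "D f p \<equiv> frechet_derivative f (at p)"

abbreviation D2 :: "('a::euclidean_space \<Rightarrow> 'b::real_normed_vector) \<Rightarrow> 'a \<Rightarrow> 'a \<Rightarrow> 'a \<Rightarrow> 'b" where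
  "D2 f p u w \<equiv> D (\<lambda>q. D f q w) p u"

lemma D_eqI: "(f has_derivative f') (at p) \<Longrightarrow> D f p = f'"
  using frechet_derivative_at by metis

lemma D_works: "f differentiable (at p) \<Longrightarrow> (f has_derivative D f p) (at p)"
  using frechet_derivative_works by blast

lemma D_cong_open:
  assumes "open S" "p \<in> S" "\<And>q. q \<in> S \<Longrightarrow> f q = g q"
  shows "D f p = D g p"
proof -
  have "(f has_derivative f') (at p) = (g has_derivative f') (at p)" for f'
    using assms has_derivative_transform_within_open[of f f' p UNIV S g]
      has_derivative_transform_within_open[of g f' p UNIV S f] by auto
  then show ?thesis by (simp add: frechet_derivative_def)
qed

lemma D2_cong_open:
  assumes "open S" "p \<in> S" "\<And>q. q \<in> S \<Longrightarrow> f q = g q"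
  shows "D2 f p u w = D2 g p u w"
  by (rule fun_cong[OF D_cong_open[OF assms(1,2)]])
    (rule fun_cong[OF D_cong_open[OF assms(1) _ assms(3)]])

lemma differentiable_cong_open:
  assumes "open S" "p \<in> S" "\<And>q. q \<in> S \<Longrightarrow> f q = g q" "f differentiable (at p)"
  shows "g differentiable (at p)"
  using assms has_derivative_transform_within_open[of f _ p UNIV S g]
  unfolding differentiable_def by blast

lemma Ck_on_subset: "Ck_on k S f \<Longrightarrow> T \<subseteq> S \<Longrightarrow> Ck_on k T f"
  by (induction k arbitrary: f) (auto intro: continuous_on_subset)

lemma Ck_on_cong:
  assumes "open S" "\<And>q. q \<in> S \<Longrightarrow> f q = g q" "Ck_on k S f"
  shows "Ck_on k S g"
  using assms(2,3)
proof (induction k arbitrary: f g)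
  case 0
  then show ?case using continuous_on_cong[of S S f g] by simp
next
  case (Suc k)
  have "g differentiable (at p)" if "p \<in> S" for p
    using differentiable_cong_open[OF assms(1) that Suc.prems(1)] Suc.prems(2) that by simp
  moreover have "Ck_on k S (\<lambda>p. D g p v)" for v
    by (rule Suc.IH[of "\<lambda>p. D f p v"])
      (use Suc.prems D_cong_open[OF assms(1) _ Suc.prems(1)] in auto)
  ultimately show ?case by simp
qed

lemma Ck_on_Suc_weaken: "Ck_on (Suc k) S f \<Longrightarrow> Ck_on k S f"
proof (induction k arbitrary: f)
  case 0
  then show ?case
    using differentiable_imp_continuous_on[of f S] differentiable_at_imp_differentiable_on[of S f]
    by simp
next
  case (Suc k)
  then show ?case by (metis Ck_on.simps(2))
qed

lemma Ck_on_le: "k \<le> l \<Longrightarrow> Ck_on l S f \<Longrightarrow> Ck_on k S f"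
  by (induction l rule: dec_induct) (use Ck_on_Suc_weaken in blast)+

lemma Ck_on_continuous: "Ck_on k S f \<Longrightarrow> continuous_on S f"
  using Ck_on_le[of 0 k S f] by simp

lemma Ck_on_differentiable: "Ck_on k S f \<Longrightarrow> 0 < k \<Longrightarrow> p \<in> S \<Longrightarrow> f differentiable (at p)"
  by (cases k) auto

lemma Ck_on_D: "Ck_on (Suc k) S f \<Longrightarrow> Ck_on k S (\<lambda>p. D f p v)"
  by simp

lemma Ck_on_const: "Ck_on k S (\<lambda>_. a)"
  by (induction k arbitrary: a) auto

lemma Ck_on_bounded_linear_compose:
  assumes "open S" "bounded_linear h" "Ck_on k S f"
  shows "Ck_on k S (\<lambda>p. h (f p))"
  using assms(3)
proof (induction k arbitrary: f)
  case 0
  then show ?case using bounded_linear.continuous_on[OF assms(2)] by auto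
next
  case (Suc k)
  have der: "((\<lambda>p. h (f p)) has_derivative (\<lambda>v. h (D f p v))) (at p)" if "p \<in> S" for p
    using bounded_linear.has_derivative[OF assms(2)] Suc.prems that D_works by fastforce
  have "Ck_on k S (\<lambda>p. D (\<lambda>p. h (f p)) p v)" for v
    by (rule Ck_on_cong[OF assms(1) _ Suc.IH[of "\<lambda>p. D f p v"]])
      (use Suc.prems D_eqI[OF der] in auto)
  then show ?case using der by (auto simp: differentiable_def)
qed

lemma Ck_on_bounded_linear: 
  assumes "open S" "bounded_linear h" shows "Ck_on k S h"
proof -
  have "Ck_on k S (\<lambda>p. p)"
    by (cases k) (auto simp: Ck_on_const)
  then show ?thesis using Ck_on_bounded_linear_compose[OF assms] by blast
qed

lemma Ck_on_add:
  assumes "open S" "Ck_on k S f" "Ck_on k S g"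
  shows "Ck_on k S (\<lambda>p. f p + g p)"
  using assms(2,3)
proof (induction k arbitrary: f g)
  case 0
  then show ?case by (auto intro: continuous_on_add)
next
  case (Suc k)
  have der: "((\<lambda>p. f p + g p) has_derivative (\<lambda>v. D f p v + D g p v)) (at p)" if "p \<in> S" for p
    using Suc.prems that by (intro has_derivative_add D_works) auto
  have "Ck_on k S (\<lambda>p. D (\<lambda>p. f p + g p) p v)" for v
    by (rule Ck_on_cong[OF assms(1) _ Suc.IH[of "\<lambda>p. D f p v" "\<lambda>p. D g p v"]])
      (use Suc.prems D_eqI[OF der] in auto)
  then show ?case using der by (auto simp: differentiable_def)
qed

lemma Ck_on_sum:
  assumes "open S" "\<And>i. i \<in> I \<Longrightarrow> Ck_on k S (f i)"
  shows "Ck_on k S (\<lambda>p. \<Sum>i\<in>I. f i p)"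
proof (cases "finite I")
  case True
  then show ?thesis using assms(2)
    by (induction I rule: finite_induct) (auto intro: Ck_on_add Ck_on_const assms(1))
qed (auto intro: Ck_on_const)

lemma Ck_on_scaleR:
  fixes f :: "'a::euclidean_space \<Rightarrow> real"
  assumes "open S" "Ck_on k S f" "Ck_on k S g"
  shows "Ck_on k S (\<lambda>p. f p *\<^sub>R g p)"
  using assms(2,3)
proof (induction k arbitrary: f g)
  case 0
  then show ?case by (auto intro: continuous_on_scaleR)
next
  case (Suc k)
  have der: "((\<lambda>p. f p *\<^sub>R g p) has_derivative (\<lambda>v. f p *\<^sub>R D g p v + D f p v *\<^sub>R g p)) (at p)"
    if "p \<in> S" for p
    using Suc.prems that by (intro has_derivative_scaleR D_works) auto
  have "Ck_on k S (\<lambda>p. f p *\<^sub>R D g p v + D f p v *\<^sub>R g p)" for v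
    by (intro Ck_on_add[OF assms(1)] Suc.IH Ck_on_D Suc.prems
        Ck_on_Suc_weaken[OF Suc.prems(1)] Ck_on_Suc_weaken[OF Suc.prems(2)])
  then have "Ck_on k S (\<lambda>p. D (\<lambda>p. f p *\<^sub>R g p) p v)" for v
    by (rule Ck_on_cong[OF assms(1), rotated]) (use D_eqI[OF der] in auto)
  then show ?case using der by (auto simp: differentiable_def)
qed

lemma linear_D: "f differentiable (at p) \<Longrightarrow> linear (D f p)"
  by (rule linear_frechet_derivative)

lemma linear_expand:
  fixes L :: "'a::euclidean_space \<Rightarrow> 'b::real_vector"
  assumes "linear L"
  shows "L v = (\<Sum>b\<in>Basis. (v \<bullet> b) *\<^sub>R L b)"
proof -
  have "L v = L (\<Sum>b\<in>Basis. (v \<bullet> b) *\<^sub>R b)" by (simp add: euclidean_representation)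
  then show ?thesis using assms by (simp add: linear_sum linear_scale)
qed

lemma D_compose:
  assumes "f differentiable (at (g p))" "g differentiable (at p)"
  shows "(\<lambda>q. f (g q)) differentiable (at p)"
    and "D (\<lambda>q. f (g q)) p u = D f (g p) (D g p u)"
proof -
  have "((\<lambda>q. f (g q)) has_derivative (\<lambda>u. D f (g p) (D g p u))) (at p)"
    using has_derivative_compose[OF D_works[OF assms(2)] D_works[OF assms(1)]] .
  then show "(\<lambda>q. f (g q)) differentiable (at p)"
    and "D (\<lambda>q. f (g q)) p u = D f (g p) (D g p u)"
    unfolding differentiable_def by (blast, simp only: D_eqI)
qed

text \<open>
  Induction on \<open>k\<close>: the derivative of \<open>f \<circ> g\<close> in a direction is a finite sum of products of
  coordinates of a derivative of \<open>g\<close> with partial derivatives of \<open>f\<close> along \<open>g\<close>, all of class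
  \<open>C\<^sup>k\<close>.
\<close>

lemma Ck_on_compose:
  fixes f :: "'b::euclidean_space \<Rightarrow> 'c::real_normed_vector"
    and g :: "'a::euclidean_space \<Rightarrow> 'b"
  assumes "open S" "g ` S \<subseteq> T" "Ck_on k S g" "Ck_on k T f"
  shows "Ck_on k S (\<lambda>p. f (g p))"
  using assms(3,4)
proof (induction k arbitrary: f)
  case 0
  then show ?case using assms(2) by (auto intro: continuous_on_compose2)
next
  case (Suc k)
  have dif: "f differentiable (at (g p))" "g differentiable (at p)" if "p \<in> S" for p
    using Suc.prems that assms(2) by auto
  have exp: "D (\<lambda>q. f (g q)) p u = (\<Sum>b\<in>Basis. (D g p u \<bullet> b) *\<^sub>R D f (g p) b)" if "p \<in> S" for p u
    using D_compose(2)[OF dif[OF that]] linear_expand[OF linear_D[OF dif(1)[OF that]], of "D g p u"] by simp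
  have "Ck_on k S (\<lambda>p. \<Sum>b\<in>Basis. (D g p u \<bullet> b) *\<^sub>R D f (g p) b)" for u
  proof (intro Ck_on_sum Ck_on_scaleR assms(1))
    show "Ck_on k S (\<lambda>p. D g p u \<bullet> b)" for b
      by (rule Ck_on_bounded_linear_compose[OF assms(1) bounded_linear_inner_left]) (use Suc.prems in auto)
    show "Ck_on k S (\<lambda>p. D f (g p) b)" for b
      by (intro Suc.IH Ck_on_D Suc.prems Ck_on_Suc_weaken[OF Suc.prems(1)])
  qed
  then have "Ck_on k S (\<lambda>p. D (\<lambda>q. f (g q)) p u)" for u
    by (rule Ck_on_cong[OF assms(1), rotated]) (use exp in auto)
  then show ?case using D_compose(1)[OF dif] by auto
qed

text \<open>
  The product rule for the pairing of a family \<open>L\<close> of linear maps with a vector, when \<open>L\<close> is only known to be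
  differentiable at each fixed vector. Expanding the vector in the standard basis reduces it to a
  finite sum of products.
\<close>

lemma has_derivative_linear_family:
  fixes L :: "'b::euclidean_space \<Rightarrow> 'c::euclidean_space \<Rightarrow> 'd::real_normed_vector"
    and \<sigma> :: "'a::euclidean_space \<Rightarrow> 'b"
  assumes "open T" "\<sigma> p \<in> T" "\<And>q. q \<in> T \<Longrightarrow> linear (L q)"
    and L: "\<And>v. (\<lambda>q. L q v) differentiable (at (\<sigma> p))"
    and \<sigma>: "(\<sigma> has_derivative \<sigma>') (at p)" and a: "(a has_derivative a') (at p)"
  shows "((\<lambda>q. L (\<sigma> q) (a q)) has_derivative
      (\<lambda>h. D (\<lambda>q. L q (a p)) (\<sigma> p) (\<sigma>' h) + L (\<sigma> p) (a' h))) (at p)"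
proof -
  have DL: "((\<lambda>q. L q v) has_derivative D (\<lambda>q. L q v) (\<sigma> p)) (at (\<sigma> p))" for v
    by (rule D_works[OF L])
  have "((\<lambda>q. L q (a p)) has_derivative
      (\<lambda>h. \<Sum>b\<in>Basis. (a p \<bullet> b) *\<^sub>R D (\<lambda>q. L q b) (\<sigma> p) h)) (at (\<sigma> p))"
  proof (rule has_derivative_transform_within_open[OF _ assms(1,2)])
    show "((\<lambda>q. \<Sum>b\<in>Basis. (a p \<bullet> b) *\<^sub>R L q b) has_derivative
      (\<lambda>h. \<Sum>b\<in>Basis. (a p \<bullet> b) *\<^sub>R D (\<lambda>q. L q b) (\<sigma> p) h)) (at (\<sigma> p))"
      by (intro has_derivative_sum has_derivative_scaleR_right DL)
    show "(\<Sum>b\<in>Basis. (a p \<bullet> b) *\<^sub>R L q b) = L q (a p)" if "q \<in> T" for q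
      by (rule linear_expand[OF assms(3)[OF that], symmetric])
  qed
  then have e: "D (\<lambda>q. L q (a p)) (\<sigma> p) h = (\<Sum>b\<in>Basis. (a p \<bullet> b) *\<^sub>R D (\<lambda>q. L q b) (\<sigma> p) h)" for h
    by (simp only: D_eqI)
  have "\<exists>S. open S \<and> p \<in> S \<and> (\<forall>q\<in>S. \<sigma> q \<in> T)"
    using \<sigma>[THEN has_derivative_continuous] assms(1,2)
    by (metis continuous_at_open)
  then obtain S where S: "open S" "p \<in> S" "\<And>q. q \<in> S \<Longrightarrow> \<sigma> q \<in> T" by blast
  have "((\<lambda>q. \<Sum>b\<in>Basis. (a q \<bullet> b) *\<^sub>R L (\<sigma> q) b) has_derivative
    (\<lambda>h. \<Sum>b\<in>Basis. (a p \<bullet> b) *\<^sub>R D (\<lambda>q. L q b) (\<sigma> p) (\<sigma>' h) + (a' h \<bullet> b) *\<^sub>R L (\<sigma> p) b)) (at p)"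
    by (intro has_derivative_sum has_derivative_scaleR has_derivative_inner_left a
        has_derivative_compose[OF \<sigma> DL])
  then have "((\<lambda>q. L (\<sigma> q) (a q)) has_derivative
    (\<lambda>h. \<Sum>b\<in>Basis. (a p \<bullet> b) *\<^sub>R D (\<lambda>q. L q b) (\<sigma> p) (\<sigma>' h) + (a' h \<bullet> b) *\<^sub>R L (\<sigma> p) b)) (at p)"
    by (rule has_derivative_transform_within_open[OF _ S(1,2)])
      (rule linear_expand[OF assms(3)[OF S(3)], symmetric])
  then show ?thesis
    by (simp only: sum.distrib e linear_expand[OF assms(3)[OF assms(2)], of "a' _", symmetric])
qed

lemma D2_compose:
  fixes f :: "'b::euclidean_space \<Rightarrow> 'c::real_normed_vector"
    and g :: "'a::euclidean_space \<Rightarrow> 'b"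
  assumes "open S" "open T" "g ` S \<subseteq> T" "Ck_on 2 S g" "Ck_on 2 T f" "p \<in> S"
  shows "D2 (\<lambda>q. f (g q)) p u w = D2 f (g p) (D g p u) (D g p w) + D f (g p) (D2 g p u w)"
proof -
  have g: "g differentiable (at q)" "(\<lambda>q. D g q w) differentiable (at q)" if "q \<in> S" for q w
    using assms(4) that by (auto simp: numeral_2_eq_2)
  have f: "f differentiable (at q)" "(\<lambda>q. D f q w) differentiable (at q)" if "q \<in> T" for q w
    using assms(5) that by (auto simp: numeral_2_eq_2)
  have gp: "g p \<in> T" using assms by auto
  have "((\<lambda>q. D f (g q) (D g q w)) has_derivative
      (\<lambda>h. D (\<lambda>q. D f q (D g p w)) (g p) (D g p h) + D f (g p) (D2 g p h w))) (at p)"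
  proof (rule has_derivative_linear_family[where T = T and L = "\<lambda>q. D f q" and \<sigma> = g])
    show "linear (D f q)" if "q \<in> T" for q by (rule linear_D[OF f(1)[OF that]])
    show "(\<lambda>q. D f q v) differentiable at (g p)" for v by (rule f(2)[OF gp])
    show "(g has_derivative D g p) (at p)" by (rule D_works[OF g(1)[OF assms(6)]])
    show "((\<lambda>q. D g q w) has_derivative (\<lambda>h. D2 g p h w)) (at p)"
      by (rule D_works[OF g(2)[OF assms(6)]])
  qed (fact assms(2) gp)+
  then have "((\<lambda>q. D (\<lambda>q. f (g q)) q w) has_derivative
      (\<lambda>h. D (\<lambda>q. D f q (D g p w)) (g p) (D g p h) + D f (g p) (D2 g p h w))) (at p)"
    by (rule has_derivative_transform_within_open[OF _ assms(1,6)])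
      (use D_compose(2)[OF f(1) g(1)] assms(3) in auto)
  from D_eqI[OF this] show ?thesis by simp
qed

text \<open>
  The mean value theorem, first in the direction \<open>u\<close> and then in the direction \<open>w\<close>. The left-hand side is
  symmetric in \<open>u\<close> and \<open>w\<close>, while the order of differentiation on the right-hand side is not.
\<close>

lemma second_difference_mvt:
  fixes f :: "'a::euclidean_space \<Rightarrow> real"
  assumes "Ck_on 2 S f" "0 < e"
    and "\<And>s t. 0 \<le> s \<Longrightarrow> s \<le> e \<Longrightarrow> 0 \<le> t \<Longrightarrow> t \<le> e \<Longrightarrow> p + s *\<^sub>R u + t *\<^sub>R w \<in> S"
  shows "\<exists>s t. 0 \<le> s \<and> s \<le> e \<and> 0 \<le> t \<and> t \<le> e \<and>
     f (p + e *\<^sub>R u + e *\<^sub>R w) - f (p + e *\<^sub>R u) - f (p + e *\<^sub>R w) + f p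
       = e * e * D2 f (p + s *\<^sub>R u + t *\<^sub>R w) w u"
proof -
  have f: "f differentiable (at q)" "(\<lambda>q. D f q w) differentiable (at q)" if "q \<in> S" for q w
    using assms(1) that by (auto simp: numeral_2_eq_2)
  have S0: "p + s *\<^sub>R u \<in> S" "p + t *\<^sub>R w \<in> S" if "0 \<le> s" "s \<le> e" "0 \<le> t" "t \<le> e" for s t
    using assms(3)[of s 0] assms(3)[of 0 t] that assms(2) by auto
  let ?\<phi> = "\<lambda>s. f (p + s *\<^sub>R u + e *\<^sub>R w) - f (p + s *\<^sub>R u)"
  let ?\<phi>' = "\<lambda>s h. D f (p + s *\<^sub>R u + e *\<^sub>R w) (h *\<^sub>R u) - D f (p + s *\<^sub>R u) (h *\<^sub>R u)"
  have \<phi>: "(?\<phi> has_derivative ?\<phi>' s) (at s within {0..e})" if "0 \<le> s" "s \<le> e" for s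
    apply (rule has_derivative_at_withinI)
    apply (intro has_derivative_diff)
    by (rule has_derivative_compose[OF _ D_works[OF f(1)], of _ "\<lambda>h. h *\<^sub>R u"],
      use assms(2) assms(3)[of s e] S0[of s 0] that in \<open>auto intro!: derivative_eq_intros\<close>)+
  obtain s where s: "0 < s" "s < e" "?\<phi> e - ?\<phi> 0 = ?\<phi>' s (e - 0)"
    using mvt_simple[OF assms(2), of ?\<phi> ?\<phi>'] \<phi> by fastforce
  have lin: "D f q (h *\<^sub>R u) = h * D f q u" if "q \<in> S" for q h
    using linear_D[OF f(1)[OF that]] by (simp add: linear_scale)
  let ?\<psi> = "\<lambda>t. D f (p + s *\<^sub>R u + t *\<^sub>R w) u"
  let ?\<psi>' = "\<lambda>t h. D (\<lambda>q. D f q u) (p + s *\<^sub>R u + t *\<^sub>R w) (h *\<^sub>R w)"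
  have \<psi>: "(?\<psi> has_derivative ?\<psi>' t) (at t within {0..e})" if "0 \<le> t" "t \<le> e" for t
    apply (rule has_derivative_at_withinI)
    by (rule has_derivative_compose[OF _ D_works[OF f(2)], of _ "\<lambda>h. h *\<^sub>R w"])
      (use assms(2) assms(3)[of s t] s that in \<open>auto intro!: derivative_eq_intros\<close>)
  obtain t where t: "0 < t" "t < e" "?\<psi> e - ?\<psi> 0 = ?\<psi>' t (e - 0)"
    using mvt_simple[OF assms(2), of ?\<psi> ?\<psi>'] \<psi> by fastforce
  have inS: "p + s *\<^sub>R u + e *\<^sub>R w \<in> S" "p + s *\<^sub>R u \<in> S" "p + s *\<^sub>R u + t *\<^sub>R w \<in> S"
    using s t assms(3)[of s e] S0[of s 0] assms(3)[of s t] by auto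
  have "?\<phi> e - ?\<phi> 0 = e * (?\<psi> e - ?\<psi> 0)"
    using s(3) lin[OF inS(1)] lin[OF inS(2)] by (simp add: algebra_simps)
  also have "?\<psi> e - ?\<psi> 0 = e * D2 f (p + s *\<^sub>R u + t *\<^sub>R w) w u"
    using t(3) linear_D[OF f(2)[OF inS(3), of u]] by (simp add: linear_scale)
  finally show ?thesis using s t
    by (intro exI[of _ s] exI[of _ t]) (auto simp: algebra_simps)
qed

text \<open>
  The second difference over a small parallelogram is \<open>e\<^sup>2\<close> times either mixed derivative at some
  nearby point; by continuity the two mixed derivatives agree at \<open>p\<close>.
\<close>

lemma D2_symmetric_real:
  fixes f :: "'a::euclidean_space \<Rightarrow> real"
  assumes "open S" "Ck_on 2 S f" "p \<in> S"
  shows "D2 f p u w = D2 f p w u"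
proof (rule ccontr)
  assume ne: "D2 f p u w \<noteq> D2 f p w u"
  define \<delta> where "\<delta> = \<bar>D2 f p u w - D2 f p w u\<bar> / 2"
  have \<delta>: "\<delta> > 0" using ne by (simp add: \<delta>_def)
  have C: "continuous_on S (\<lambda>q. D2 f q u w)" for u w
    using assms(2) by (auto simp: numeral_2_eq_2)
  have near: "\<exists>r>0. \<forall>q. dist q p < r \<longrightarrow> q \<in> S \<and> dist (D2 f q u w) (D2 f p u w) < \<delta>" for u w
  proof -
    have "\<exists>r>0. \<forall>q\<in>S. dist q p < r \<longrightarrow> dist (D2 f q u w) (D2 f p u w) < \<delta>"
      using bspec[OF C[where u = u and w = w, unfolded continuous_on_iff] assms(3)] \<delta> by (elim allE impE)
    then obtain r where r: "r > 0"
      "\<forall>q\<in>S. dist q p < r \<longrightarrow> dist (D2 f q u w) (D2 f p u w) < \<delta>" by (elim exE conjE)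
    have "\<exists>r>0. \<forall>q. dist q p < r \<longrightarrow> q \<in> S"
      using assms(1)[unfolded open_dist] assms(3) by (rule bspec)
    then obtain r' where r': "r' > 0" "\<forall>q. dist q p < r' \<longrightarrow> q \<in> S" by (elim exE conjE)
    show ?thesis
    proof (intro exI[of _ "min r r'"] conjI allI impI)
      show "0 < min r r'" using r r' by simp
      fix q assume "dist q p < min r r'"
      then show "q \<in> S" "dist (D2 f q u w) (D2 f p u w) < \<delta>" using r(2) r'(2) by simp_all
    qed
  qed
  obtain r1 where r1: "r1 > 0" "\<And>q. dist q p < r1 \<Longrightarrow> q \<in> S \<and> dist (D2 f q u w) (D2 f p u w) < \<delta>"
    using near by blast
  obtain r2 where r2: "r2 > 0" "\<And>q. dist q p < r2 \<Longrightarrow> q \<in> S \<and> dist (D2 f q w u) (D2 f p w u) < \<delta>"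
    using near by blast
  define N where "N = norm u + norm w + 1"
  \<comment> \<open>small enough for the parallelogram with corner \<open>p\<close> and sides \<open>e u\<close>, \<open>e w\<close> to stay in both balls\<close>
  define e where "e = min r1 r2 / (2 * N)"
  have N: "N > 0" by (simp add: N_def add_nonneg_pos)
  have e: "e > 0" using r1 r2 N by (simp add: e_def)
  have eN: "e * N < r1" "e * N < r2" using r1 r2 N by (auto simp: e_def)
  have close: "dist (p + s *\<^sub>R a + t *\<^sub>R b) p < r1 \<and> dist (p + s *\<^sub>R a + t *\<^sub>R b) p < r2"
    if "0 \<le> s" "s \<le> e" "0 \<le> t" "t \<le> e" "(a, b) = (u, w) \<or> (a, b) = (w, u)" for s t a b
  proof -
    have "norm (s *\<^sub>R a + t *\<^sub>R b) \<le> s * norm a + t * norm b"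
      using that by (metis abs_of_nonneg norm_scaleR norm_triangle_ineq)
    also have "\<dots> \<le> e * norm a + e * norm b"
      using that by (intro add_mono mult_right_mono) auto
    also have "\<dots> \<le> e * N" using that e by (auto simp: N_def algebra_simps)
    finally have "norm (s *\<^sub>R a + t *\<^sub>R b) \<le> e * N" .
    moreover have "dist (p + s *\<^sub>R a + t *\<^sub>R b) p = norm (s *\<^sub>R a + t *\<^sub>R b)"
      by (simp add: dist_norm add.assoc)
    ultimately show ?thesis using eN by simp
  qed
  obtain s t where st: "0 \<le> s" "s \<le> e" "0 \<le> t" "t \<le> e"
    "f (p + e *\<^sub>R u + e *\<^sub>R w) - f (p + e *\<^sub>R u) - f (p + e *\<^sub>R w) + f p
       = e * e * D2 f (p + s *\<^sub>R u + t *\<^sub>R w) w u"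
    using second_difference_mvt[OF assms(2) e, of p u w] close[of _ _ u w] r1 by blast
  obtain s' t' where st': "0 \<le> s'" "s' \<le> e" "0 \<le> t'" "t' \<le> e"
    "f (p + e *\<^sub>R w + e *\<^sub>R u) - f (p + e *\<^sub>R w) - f (p + e *\<^sub>R u) + f p
       = e * e * D2 f (p + s' *\<^sub>R w + t' *\<^sub>R u) u w"
    using second_difference_mvt[OF assms(2) e, of p w u] close[of _ _ w u] r1 by blast
  have "e * e * D2 f (p + s *\<^sub>R u + t *\<^sub>R w) w u = e * e * D2 f (p + s' *\<^sub>R w + t' *\<^sub>R u) u w"
    using st(5) st'(5) by (simp add: algebra_simps)
  then have eq: "D2 f (p + s *\<^sub>R u + t *\<^sub>R w) w u = D2 f (p + s' *\<^sub>R w + t' *\<^sub>R u) u w"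
    using e by simp
  have "dist (D2 f (p + s *\<^sub>R u + t *\<^sub>R w) w u) (D2 f p w u) < \<delta>"
    "dist (D2 f (p + s' *\<^sub>R w + t' *\<^sub>R u) u w) (D2 f p u w) < \<delta>"
    using close[of s t u w] close[of s' t' w u] st st' r1(2) r2(2) by blast+
  then show False using eq
    by (simp add: dist_real_def \<delta>_def abs_if split: if_splits)
qed

lemma D_inner:
  assumes "f differentiable (at p)"
  shows "D (\<lambda>q. f q \<bullet> b) p u = D f p u \<bullet> b"
  using D_eqI[OF has_derivative_inner_left[OF D_works[OF assms]], of b] by simp

lemma D2_symmetric:
  fixes f :: "'a::euclidean_space \<Rightarrow> 'b::euclidean_space"
  assumes "open S" "Ck_on 2 S f" "p \<in> S"
  shows "D2 f p u w = D2 f p w u"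
proof (rule euclidean_eqI)
  fix b :: 'b
  have f: "f differentiable (at q)" "(\<lambda>q. D f q w) differentiable (at q)" if "q \<in> S" for q w
    using assms(2) that by (auto simp: numeral_2_eq_2)
  have c: "Ck_on 2 S (\<lambda>q. f q \<bullet> b)"
    by (rule Ck_on_bounded_linear_compose[OF assms(1) bounded_linear_inner_left assms(2)])
  have "D2 (\<lambda>q. f q \<bullet> b) p u w = D2 f p u w \<bullet> b" for u w
  proof -
    have "D2 (\<lambda>q. f q \<bullet> b) p u w = D (\<lambda>q. D f q w \<bullet> b) p u"
      by (rule fun_cong[OF D_cong_open[OF assms(1,3)]]) (simp add: D_inner f(1))
    then show ?thesis using D_inner[OF f(2)[OF assms(3)]] by simp
  qed
  then show "D2 f p u w \<bullet> b = D2 f p w u \<bullet> b"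
    using D2_symmetric_real[OF assms(1) c assms(3), of u w] by simp
qed

text \<open>
  On a compact ball inside \<open>S\<close> the derivative is bounded, being dominated by its values on the
  finitely many basis vectors, which are continuous.
\<close>

lemma C1_locally_Lipschitz:
  fixes f :: "'a::euclidean_space \<Rightarrow> 'b::real_normed_vector"
  assumes "open S" "Ck_on 1 S f" "p \<in> S"
  shows "\<exists>r>0. \<exists>L\<ge>0. cball p r \<subseteq> S \<and>
    (\<forall>q\<in>cball p r. \<forall>q'\<in>cball p r. norm (f q - f q') \<le> L * norm (q - q'))"
proof -
  obtain r where r: "r > 0" "cball p r \<subseteq> S"
    using assms(1,3) open_contains_cball by blast
  have f: "f differentiable (at q)" "continuous_on S (\<lambda>q. D f q w)" if "q \<in> S" for q w
    using assms(2) that by auto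
  have "continuous_on (cball p r) (\<lambda>q. \<Sum>b\<in>Basis. norm (D f q b))"
    using f(2)[OF assms(3)] continuous_on_subset[OF _ r(2)]
    by (intro continuous_intros) auto
  then obtain L where L: "\<And>q. q \<in> cball p r \<Longrightarrow> (\<Sum>b\<in>Basis. norm (D f q b)) \<le> L"
    using continuous_attains_sup[of "cball p r" "\<lambda>q. \<Sum>b\<in>Basis. norm (D f q b)"] r(1)
    by (metis compact_cball cball_eq_empty less_le_not_le)
  have "(\<Sum>b\<in>Basis. norm (D f p b)) \<ge> 0" by (simp add: sum_nonneg)
  then have L0: "L \<ge> 0" using L[of p] r(1) by simp
  have "norm (f q - f q') \<le> L * norm (q - q')" if "q \<in> cball p r" "q' \<in> cball p r" for q q'
  proof (rule differentiable_bound[OF convex_cball _ _ that, of f "\<lambda>q. D f q"])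
    fix z assume z: "z \<in> cball p r"
    then have zS: "z \<in> S" using r by blast
    show "(f has_derivative D f z) (at z within cball p r)"
      using D_works[OF f(1)[OF zS]] has_derivative_at_withinI by blast
    show "onorm (D f z) \<le> L"
    proof (rule onorm_le)
      fix h
      have "norm (D f z h) \<le> (\<Sum>b\<in>Basis. norm ((h \<bullet> b) *\<^sub>R D f z b))"
        unfolding linear_expand[OF linear_D[OF f(1)[OF zS]], of h] by (rule norm_sum)
      also have "\<dots> \<le> (\<Sum>b\<in>Basis. norm h * norm (D f z b))"
        by (intro sum_mono) (simp add: mult_right_mono Basis_le_norm)
      also have "\<dots> = (\<Sum>b\<in>Basis. norm (D f z b)) * norm h"
        by (simp add: sum_distrib_left mult.commute)
      also have "\<dots> \<le> L * norm h" using L[OF z] by (simp add: mult_right_mono)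
      finally show "norm (D f z h) \<le> L * norm h" .
    qed
  qed
  then show ?thesis using r L0 by blast
qed

section \<open>Christoffel symbols of a metric in coordinates\<close>

text \<open>
  Koszul's formula for an arbitrary field of forms \<open>g\<close>, so that the Christoffel symbols of
  all charts of all manifolds are instances: see \<open>christoffel_eq\<close>.
\<close>

definition levi_civita :: "('e::euclidean_space \<Rightarrow> 'e \<Rightarrow> 'e \<Rightarrow> real) \<Rightarrow> 'e \<Rightarrow> 'e \<Rightarrow> 'e \<Rightarrow> 'e" where
  "levi_civita g p u w = (THE y. \<forall>z. 2 * g p y z =
     D (\<lambda>q. g q w z) p u + D (\<lambda>q. g q u z) p w - D (\<lambda>q. g q u w) p z)"

lemma linear_norm_bound:
  fixes h :: "'a::euclidean_space \<Rightarrow> 'b::real_normed_vector"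
  assumes "linear h"
  shows "norm (h x) \<le> norm x * (\<Sum>b\<in>Basis. norm (h b))"
proof -
  have "norm (h x) \<le> (\<Sum>b\<in>Basis. norm ((x \<bullet> b) *\<^sub>R h b))"
    unfolding linear_expand[OF assms, of x] by (rule norm_sum)
  also have "\<dots> \<le> (\<Sum>b\<in>Basis. norm x * norm (h b))"
    by (intro sum_mono) (simp add: mult_right_mono Basis_le_norm)
  finally show ?thesis by (simp add: sum_distrib_left)
qed

lemma bilinear_norm_bound:
  fixes h :: "'a::euclidean_space \<Rightarrow> 'b::euclidean_space \<Rightarrow> 'c::real_normed_vector"
  assumes "bilinear h"
  shows "norm (h x y) \<le> norm x * norm y * (\<Sum>b\<in>Basis. \<Sum>b'\<in>Basis. norm (h b b'))"
proof -
  have 1: "linear (\<lambda>x. h x y)" "linear (h x)" for x y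
    using assms by (auto simp: bilinear_def)
  have "norm (h x y) \<le> norm x * (\<Sum>b\<in>Basis. norm (h b y))"
    by (rule linear_norm_bound[OF 1(1)])
  also have "\<dots> \<le> norm x * (\<Sum>b\<in>Basis. norm y * (\<Sum>b'\<in>Basis. norm (h b b')))"
    by (intro mult_left_mono sum_mono linear_norm_bound[OF 1(2)]) simp
  finally show ?thesis by (simp add: sum_distrib_left mult.assoc)
qed

text \<open>
  Needed for the finitely many coefficients of a metric and of Koszul's formula, with a common ball
  and constant.
\<close>

lemma finite_family_locally_Lipschitz:
  fixes f :: "'i \<Rightarrow> 'a::euclidean_space \<Rightarrow> 'b::real_normed_vector"
  assumes "open S" "p \<in> S" "finite I" "\<And>i. i \<in> I \<Longrightarrow> Ck_on 1 S (f i)"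
  shows "\<exists>r>0. \<exists>L\<ge>0. cball p r \<subseteq> S \<and>
    (\<forall>i\<in>I. \<forall>q\<in>cball p r. \<forall>q'\<in>cball p r. norm (f i q - f i q') \<le> L * norm (q - q'))"
  using assms(3,4)
proof (induction I rule: finite_induct)
  case empty
  then show ?case using C1_locally_Lipschitz[OF assms(1) Ck_on_const[of 1 S "0::'b"] assms(2)] by auto
next
  case (insert i I)
  from insert obtain r L where r: "r > 0" "L \<ge> 0" "cball p r \<subseteq> S"
    "\<And>i q q'. i \<in> I \<Longrightarrow> q \<in> cball p r \<Longrightarrow> q' \<in> cball p r \<Longrightarrow> norm (f i q - f i q') \<le> L * norm (q - q')"
    by (metis insertCI)
  obtain r' L' where r': "r' > 0" "L' \<ge> 0" "cball p r' \<subseteq> S"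
    "\<And>q q'. q \<in> cball p r' \<Longrightarrow> q' \<in> cball p r' \<Longrightarrow> norm (f i q - f i q') \<le> L' * norm (q - q')"
    using C1_locally_Lipschitz[OF assms(1) insert.prems[of i] assms(2)] by blast
  have "norm (f j q - f j q') \<le> max L L' * norm (q - q')"
    if "j \<in> insert i I" "q \<in> cball p (min r r')" "q' \<in> cball p (min r r')" for j q q'
  proof (cases "j = i")
    case True
    have "norm (f i q - f i q') \<le> L' * norm (q - q')" using that r'(4) by auto
    also have "\<dots> \<le> max L L' * norm (q - q')" by (intro mult_right_mono) auto
    finally show ?thesis using True by simp
  next
    case False
    have "norm (f j q - f j q') \<le> L * norm (q - q')" using False that r(4) by auto
    also have "\<dots> \<le> max L L' * norm (q - q')" by (intro mult_right_mono) auto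
    finally show ?thesis .
  qed
  moreover have "cball p (min r r') \<subseteq> S" using r(3) by auto
  ultimately show ?case using r(1,2) r'(1,2)
    by (intro exI[of _ "min r r'"] exI[of _ "max L L'"] conjI ballI) (auto simp: le_max_iff_disj)
qed

locale coordinate_metric =
  fixes S :: "'e::euclidean_space set" and g :: "'e \<Rightarrow> 'e \<Rightarrow> 'e \<Rightarrow> real"
  assumes open_dom: "open S"
    and inner_product: "q \<in> S \<Longrightarrow> inner_product_form (g q)"
    and C2: "Ck_on 2 S (\<lambda>q. g q u w)"
begin

abbreviation \<Gamma> :: "'e \<Rightarrow> 'e \<Rightarrow> 'e \<Rightarrow> 'e" where
  "\<Gamma> \<equiv> levi_civita g"

definition koszul :: "'e \<Rightarrow> 'e \<Rightarrow> 'e \<Rightarrow> 'e \<Rightarrow> real" where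
  "koszul p u w z = D (\<lambda>q. g q w z) p u + D (\<lambda>q. g q u z) p w - D (\<lambda>q. g q u w) p z"

lemma metric_bilinear: "q \<in> S \<Longrightarrow> bilinear (g q)"
  and metric_sym: "q \<in> S \<Longrightarrow> g q u w = g q w u"
  and metric_pos: "q \<in> S \<Longrightarrow> u \<noteq> 0 \<Longrightarrow> 0 < g q u u"
  using inner_product[of q] by (auto simp: inner_product_form_def)

lemma metric_linear:
  assumes "q \<in> S" shows "linear (\<lambda>a. g q a b)" "linear (\<lambda>b. g q a b)"
  using metric_bilinear[OF assms] by (auto simp: bilinear_def)

lemma metric_nondegenerate: "q \<in> S \<Longrightarrow> (\<And>z. g q y z = 0) \<Longrightarrow> y = 0"
  using metric_pos[of q y] by force

lemma metric_differentiable: "q \<in> S \<Longrightarrow> (\<lambda>q. g q u w) differentiable (at q)"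
  using Ck_on_differentiable[OF C2] by simp

text \<open>
  Representation of linear forms by the inner product \<open>g p\<close>, which is not the one of the type:
  the linear map sending \<open>y\<close> to the vector with coordinates \<open>g p y b\<close> is injective by positivity,
  hence surjective.
\<close>

lemma metric_riesz:
  assumes p: "p \<in> S" and K: "linear K"
  shows "\<exists>y. \<forall>z. g p y z = K z"
proof -
  define G where "G y = (\<Sum>b\<in>Basis. g p y b *\<^sub>R b)" for y
  note lin = metric_linear[OF p]
  have Gb: "G y \<bullet> b = g p y b" if "b \<in> Basis" for y b
    using that unfolding G_def by (simp add: inner_sum_left inner_Basis if_distrib sum.delta cong: if_cong)
  have lG: "linear G"
    unfolding G_def
    by (intro linearI)
      (auto simp: linear_add[OF lin(1)] linear_scale[OF lin(1)] scaleR_add_left sum.distrib scaleR_sum_right)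
  have "inj G"
    unfolding linear_injective_0[OF lG]
  proof (intro allI impI)
    fix y assume "G y = 0"
    then have "g p y b = 0" if "b \<in> Basis" for b using Gb[OF that, of y] by simp
    then have "g p y z = 0" for z using linear_expand[OF lin(2), of y z] by simp
    then show "y = 0" by (rule metric_nondegenerate[OF p])
  qed
  then have "surj G" by (simp add: linear_injective_imp_surjective[OF lG])
  then obtain y where y: "G y = (\<Sum>b\<in>Basis. K b *\<^sub>R b)" by (metis surjD)
  have "g p y b = K b" if "b \<in> Basis" for b
    using Gb[OF that, of y] that unfolding y
    by (simp add: inner_sum_left inner_Basis if_distrib sum.delta cong: if_cong)
  then have "g p y z = K z" for z
    using linear_expand[OF lin(2), of y z] linear_expand[OF K, of z] by simp
  then show ?thesis by blast
qed

lemma D_metric_linear: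
  assumes p: "p \<in> S"
  shows "linear (\<lambda>u. D (\<lambda>q. g q a b) p u)"
    and "linear (\<lambda>a. D (\<lambda>q. g q a b) p u)"
    and "linear (\<lambda>b. D (\<lambda>q. g q a b) p u)"
proof -
  note d = D_works[OF metric_differentiable[OF p]]
  note dD = D_cong_open[OF open_dom p, THEN fun_cong]
  show "linear (\<lambda>u. D (\<lambda>q. g q a b) p u)"
    by (rule linear_D[OF metric_differentiable[OF p]])
  show "linear (\<lambda>a. D (\<lambda>q. g q a b) p u)"
  proof (rule linearI)
    fix x y c
    have "D (\<lambda>q. g q (x + y) b) p u = D (\<lambda>q. g q x b + g q y b) p u"
      by (rule dD) (rule linear_add[OF metric_linear(1)])
    then show "D (\<lambda>q. g q (x + y) b) p u = D (\<lambda>q. g q x b) p u + D (\<lambda>q. g q y b) p u"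
      using D_eqI[OF has_derivative_add[OF d d]] by simp
    have "D (\<lambda>q. g q (c *\<^sub>R x) b) p u = D (\<lambda>q. c *\<^sub>R g q x b) p u"
      by (rule dD) (rule linear_scale[OF metric_linear(1)])
    then show "D (\<lambda>q. g q (c *\<^sub>R x) b) p u = c *\<^sub>R D (\<lambda>q. g q x b) p u"
      using D_eqI[OF has_derivative_scaleR_right[OF d]] by simp
  qed
  show "linear (\<lambda>b. D (\<lambda>q. g q a b) p u)"
  proof (rule linearI)
    fix x y c
    have "D (\<lambda>q. g q a (x + y)) p u = D (\<lambda>q. g q a x + g q a y) p u"
      by (rule dD) (rule linear_add[OF metric_linear(2)])
    then show "D (\<lambda>q. g q a (x + y)) p u = D (\<lambda>q. g q a x) p u + D (\<lambda>q. g q a y) p u"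
      using D_eqI[OF has_derivative_add[OF d d]] by simp
    have "D (\<lambda>q. g q a (c *\<^sub>R x)) p u = D (\<lambda>q. c *\<^sub>R g q a x) p u"
      by (rule dD) (rule linear_scale[OF metric_linear(2)])
    then show "D (\<lambda>q. g q a (c *\<^sub>R x)) p u = c *\<^sub>R D (\<lambda>q. g q a x) p u"
      using D_eqI[OF has_derivative_scaleR_right[OF d]] by simp
  qed
qed

lemma koszul_linear:
  assumes p: "p \<in> S"
  shows "linear (\<lambda>u. koszul p u w z)" "linear (\<lambda>w. koszul p u w z)" "linear (\<lambda>z. koszul p u w z)"
  unfolding koszul_def
  by (intro linear_compose_add linear_compose_sub D_metric_linear[OF p])+

lemma \<Gamma>_unique: "p \<in> S \<Longrightarrow> (\<And>z. 2 * g p y z = koszul p u w z) \<Longrightarrow> \<Gamma> p u w = y"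
  unfolding levi_civita_def koszul_def
proof (rule the_equality)
  fix y' assume *: "p \<in> S" "\<And>z. 2 * g p y z = D (\<lambda>q. g q w z) p u + D (\<lambda>q. g q u z) p w - D (\<lambda>q. g q u w) p z"
    "\<forall>z. 2 * g p y' z = D (\<lambda>q. g q w z) p u + D (\<lambda>q. g q u z) p w - D (\<lambda>q. g q u w) p z"
  have "g p (y' - y) z = 0" for z
    using linear_diff[OF metric_linear(1)[OF *(1)], of y' y z] *(2)[of z] spec[OF *(3), of z] by simp
  then show "y' = y" using metric_nondegenerate[OF *(1), of "y' - y"] by simp
qed blast

text \<open>
  Koszul's formula is linear in \<open>z\<close>, so it is represented by a vector, and the description in the
  definition of \<open>\<Gamma>\<close> is not void.
\<close>

lemma \<Gamma>_koszul:
  assumes p: "p \<in> S" shows "2 * g p (\<Gamma> p u w) z = koszul p u w z"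
proof -
  have "linear (\<lambda>z. (1/2) *\<^sub>R koszul p u w z)"
    by (rule linear_compose_scale_right[OF koszul_linear(3)[OF p]])
  then obtain y where y: "\<forall>z. g p y z = (1/2) *\<^sub>R koszul p u w z"
    using metric_riesz[OF p] by blast
  have y: "2 * g p y z = koszul p u w z" for z using spec[OF y, of z] by simp
  then show ?thesis using \<Gamma>_unique[OF p, of y u w] by simp
qed

lemma \<Gamma>_diagonal:
  assumes p: "p \<in> S"
  shows "2 * g p (\<Gamma> p u u) z = 2 * D (\<lambda>q. g q u z) p u - D (\<lambda>q. g q u u) p z"
  using \<Gamma>_koszul[OF p, of u u z] by (simp add: koszul_def)

lemma \<Gamma>_unique_diagonal:
  assumes p: "p \<in> S"
    and "\<And>z. 2 * g p y z = 2 * D (\<lambda>q. g q u z) p u - D (\<lambda>q. g q u u) p z"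
  shows "\<Gamma> p u u = y"
  by (rule \<Gamma>_unique[OF p]) (simp add: koszul_def assms(2))

lemma \<Gamma>_bilinear:
  assumes p: "p \<in> S" shows "bilinear (\<Gamma> p)"
proof -
  note g1 = metric_linear(1)[OF p] and k = koszul_linear[OF p]
  have "\<Gamma> p (u + u') w = \<Gamma> p u w + \<Gamma> p u' w" "\<Gamma> p (c *\<^sub>R u) w = c *\<^sub>R \<Gamma> p u w"
    "\<Gamma> p w (u + u') = \<Gamma> p w u + \<Gamma> p w u'" "\<Gamma> p w (c *\<^sub>R u) = c *\<^sub>R \<Gamma> p w u" for u u' w c
    by (rule \<Gamma>_unique[OF p],
      simp add: linear_add[OF g1] linear_scale[OF g1] distrib_left \<Gamma>_koszul[OF p]
        linear_add[OF k(1)] linear_scale[OF k(1)] linear_add[OF k(2)] linear_scale[OF k(2)]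
        mult.left_commute[of 2])+
  then show ?thesis unfolding bilinear_def by (auto intro!: linearI)
qed

text \<open>
  Let \<open>\<delta>\<close> be the difference of \<open>\<Gamma> q i j\<close> and \<open>\<Gamma> q' i j\<close>. Koszul's formula at both points gives
  \<open>2 g q \<delta> \<delta> = (K q - K q') \<delta> + 2 (g q' - g q) (\<Gamma> q' i j) \<delta>\<close>, where the coefficients of \<open>K\<close> and \<open>g\<close> are
  locally Lipschitz; and \<open>g q\<close> is uniformly positive definite for \<open>q\<close> near \<open>p\<close>. This bounds \<open>\<delta>\<close>
  without inverting the matrix of the metric. Bilinearity extends the bound from basis vectors to
  all arguments.
\<close>

lemma \<Gamma>_locally_Lipschitz:
  assumes p: "p \<in> S"
  shows "\<exists>r>0. \<exists>L\<ge>0. cball p r \<subseteq> S \<and> (\<forall>q\<in>cball p r. \<forall>q'\<in>cball p r. \<forall>u w.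
     norm (\<Gamma> q u w - \<Gamma> q' u w) \<le> L * norm (q - q') * norm u * norm w)"
proof -
  let ?B = "Basis :: 'e set"
  let ?n = "real DIM('e)"
  have Dg: "Ck_on 1 S (\<lambda>q. D (\<lambda>q. g q a b) q u)" "Ck_on 1 S (\<lambda>q. g q a b)" for a b u
    using C2[of a b] Ck_on_le[of 1 2 S "\<lambda>q. g q a b"] by (auto simp: numeral_2_eq_2)
  have "Ck_on 1 S (\<lambda>q. (-1) *\<^sub>R D (\<lambda>q. g q a b) q u)" for a b u
    by (rule Ck_on_bounded_linear_compose[OF open_dom bounded_linear_scaleR_right Dg(1)])
  then have "Ck_on 1 S (\<lambda>q. (D (\<lambda>q. g q w z) q u + D (\<lambda>q. g q u z) q w) + (-1) *\<^sub>R D (\<lambda>q. g q u w) q z)"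
    for u w z
    by (intro Ck_on_add open_dom Dg(1))
  then have K: "Ck_on 1 S (\<lambda>q. koszul q u w z)" for u w z
    by (simp add: koszul_def del: Ck_on.simps)
  obtain r1 L1 where 1: "r1 > 0" "L1 \<ge> 0" "cball p r1 \<subseteq> S"
    "\<And>b b' q q'. b \<in> ?B \<Longrightarrow> b' \<in> ?B \<Longrightarrow> q \<in> cball p r1 \<Longrightarrow> q' \<in> cball p r1 \<Longrightarrow>
       \<bar>g q b b' - g q' b b'\<bar> \<le> L1 * norm (q - q')"
    using finite_family_locally_Lipschitz[OF open_dom p, of "?B \<times> ?B" "\<lambda>(b, b') q. g q b b'"] Dg(2)
    by (fastforce simp del: Ck_on.simps One_nat_def)
  obtain r2 L2 where 2: "r2 > 0" "L2 \<ge> 0" "cball p r2 \<subseteq> S"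
    "\<And>b b' b'' q q'. b \<in> ?B \<Longrightarrow> b' \<in> ?B \<Longrightarrow> b'' \<in> ?B \<Longrightarrow> q \<in> cball p r2 \<Longrightarrow> q' \<in> cball p r2 \<Longrightarrow>
       \<bar>koszul q b b' b'' - koszul q' b b' b''\<bar> \<le> L2 * norm (q - q')"
    using finite_family_locally_Lipschitz[OF open_dom p, of "?B \<times> ?B \<times> ?B"
        "\<lambda>(b, b', b'') q. koszul q b b' b''"] K
    by (fastforce simp del: Ck_on.simps One_nat_def)
  have g_lip: "\<bar>g q x y - g q' x y\<bar> \<le> norm x * norm y * (?n * ?n * (L1 * norm (q - q')))"
    if "q \<in> cball p r1" "q' \<in> cball p r1" for q q' x y
  proof -
    have qS: "q \<in> S" "q' \<in> S" using that 1(3) by auto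
    have "bilinear (\<lambda>x y. g q x y - g q' x y)"
      unfolding bilinear_def
      by (intro conjI allI linear_compose_sub metric_linear qS)
    from bilinear_norm_bound[OF this, of x y]
    have "\<bar>g q x y - g q' x y\<bar> \<le> norm x * norm y * (\<Sum>b\<in>?B. \<Sum>b'\<in>?B. \<bar>g q b b' - g q' b b'\<bar>)"
      by simp
    also have "\<dots> \<le> norm x * norm y * (\<Sum>b\<in>?B. \<Sum>b'\<in>?B. L1 * norm (q - q'))"
      by (intro mult_left_mono sum_mono 1(4) that) auto
    finally show ?thesis by (simp add: mult.assoc)
  qed
  have "\<exists>l>0. \<forall>y. 2 * l * (norm y * norm y) \<le> g p y y"
  proof -
    have "continuous_on (sphere 0 1) (\<lambda>y. g p y y)"
      using bilinear_continuous_on_compose[OF continuous_on_id continuous_on_id metric_bilinear[OF p], of "sphere 0 1"]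
      by (simp add: id_def)
    then obtain m where m: "norm m = 1" "\<And>y. norm y = 1 \<Longrightarrow> g p m m \<le> g p y y"
      using continuous_attains_inf[of "sphere (0::'e) 1" "\<lambda>y. g p y y"] by auto
    have "g p m m * (norm y * norm y) \<le> g p y y" for y
    proof (cases "y = 0")
      case True
      then show ?thesis using linear_0[OF metric_linear(1)[OF p, of 0]] by simp
    next
      case False
      have "g p y y = g p (norm y *\<^sub>R sgn y) (norm y *\<^sub>R sgn y)"
        using False by (simp add: sgn_div_norm)
      also have "\<dots> = norm y * norm y * g p (sgn y) (sgn y)"
        by (simp add: linear_scale[OF metric_linear(1)[OF p]] linear_scale[OF metric_linear(2)[OF p]])
      also have "\<dots> \<ge> norm y * norm y * g p m m"
        using False by (intro mult_left_mono m(2)) (auto simp: norm_sgn)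
      finally show ?thesis by (simp add: mult.commute)
    qed
    moreover have "g p m m > 0" using metric_pos[OF p, of m] m(1) by force
    ultimately show ?thesis by (intro exI[of _ "g p m m / 2"]) auto
  qed
  then obtain l where l: "l > 0" "\<And>y. 2 * l * (norm y * norm y) \<le> g p y y" by blast
  \<comment> \<open>on unit vectors and within distance \<open>r\<close> of \<open>p\<close> the form \<open>g\<close> changes by at most \<open>l\<close>, half of its
    lower bound \<open>2 l\<close> at \<open>p\<close>\<close>
  define r where "r = min (min r1 r2) (l / (?n * ?n * L1 + 1))"
  have den: "?n * ?n * L1 + 1 > 0" using 1(2) by (simp add: add_nonneg_pos)
  have r: "r > 0" "r \<le> r1" "r \<le> r2" "?n * ?n * L1 * r \<le> l"
  proof -
    show "r > 0" "r \<le> r1" "r \<le> r2" using 1 2 l den by (auto simp: r_def)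
    have "r * (?n * ?n * L1 + 1) \<le> l / (?n * ?n * L1 + 1) * (?n * ?n * L1 + 1)"
      using den by (intro mult_right_mono) (auto simp: r_def)
    also have "\<dots> = l" using den by simp
    finally show "?n * ?n * L1 * r \<le> l" using \<open>r > 0\<close> by (simp add: algebra_simps)
  qed
  have in12: "q \<in> cball p r1" "q \<in> cball p r2" "q \<in> S" if "q \<in> cball p r" for q
    using that r 1(3) by auto
  have coercive: "l * (norm y * norm y) \<le> g q y y" if q: "q \<in> cball p r" for q y
  proof -
    have "\<bar>g q y y - g p y y\<bar> \<le> norm y * norm y * (?n * ?n * (L1 * norm (q - p)))"
      by (rule g_lip) (use in12[OF q] 1(1) in auto)
    also have "\<dots> \<le> norm y * norm y * (?n * ?n * (L1 * r))"
      using q 1(2) by (intro mult_left_mono) (auto simp: dist_norm norm_minus_commute)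
    also have "\<dots> \<le> norm y * norm y * l"
      using r(4) by (intro mult_left_mono) (auto simp: mult.assoc)
    finally show ?thesis using l(2)[of y] by (simp add: algebra_simps)
  qed
  have solve: "l * norm y \<le> c" if q: "q \<in> cball p r" and c: "g q y y \<le> c * norm y" and "c \<ge> 0" for q y c
  proof (cases "y = 0")
    case False
    have "l * norm y * norm y \<le> c * norm y"
      using coercive[OF q, of y] c by (simp add: mult.assoc)
    then show ?thesis using False by simp
  qed (use that in simp)
  define Kp where "Kp i j = (\<Sum>b\<in>?B. \<bar>koszul p i j b\<bar>)" for i j
  define B where "B i j = (Kp i j + ?n * (L2 * r)) / l" for i j
  have \<Gamma>_bound: "norm (\<Gamma> q i j) \<le> B i j" if q: "q \<in> cball p r" and ij: "i \<in> ?B" "j \<in> ?B" for q i j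
  proof -
    have "2 * g q (\<Gamma> q i j) (\<Gamma> q i j) = koszul q i j (\<Gamma> q i j)"
      by (rule \<Gamma>_koszul) (rule in12(3)[OF q])
    also have "\<dots> \<le> norm (\<Gamma> q i j) * (\<Sum>b\<in>?B. \<bar>koszul q i j b\<bar>)"
      using linear_norm_bound[OF koszul_linear(3)[OF in12(3)[OF q]], of i j "\<Gamma> q i j"] by simp
    also have "\<dots> \<le> norm (\<Gamma> q i j) * (\<Sum>b\<in>?B. \<bar>koszul p i j b\<bar> + L2 * r)"
    proof (intro mult_left_mono sum_mono)
      fix b assume b: "b \<in> ?B"
      have "\<bar>koszul q i j b - koszul p i j b\<bar> \<le> L2 * norm (q - p)"
        by (rule 2(4)) (use ij b in12[OF q] 2(1) in auto)
      also have "\<dots> \<le> L2 * r" using q 2(2) by (intro mult_left_mono) (auto simp: dist_norm norm_minus_commute)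
      finally show "\<bar>koszul q i j b\<bar> \<le> \<bar>koszul p i j b\<bar> + L2 * r" by linarith
    qed simp
    also have "\<dots> = (Kp i j + ?n * (L2 * r)) * norm (\<Gamma> q i j)" by (simp add: sum.distrib Kp_def mult.commute)
    finally have "2 * g q (\<Gamma> q i j) (\<Gamma> q i j) \<le> (Kp i j + ?n * (L2 * r)) * norm (\<Gamma> q i j)" .
    moreover have "0 \<le> g q (\<Gamma> q i j) (\<Gamma> q i j)"
      using coercive[OF q, of "\<Gamma> q i j"] l(1) by (meson less_imp_le mult_nonneg_nonneg norm_ge_zero order_trans)
    ultimately have "g q (\<Gamma> q i j) (\<Gamma> q i j) \<le> (Kp i j + ?n * (L2 * r)) * norm (\<Gamma> q i j)" by linarith
    then have "l * norm (\<Gamma> q i j) \<le> Kp i j + ?n * (L2 * r)"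
      by (rule solve[OF q]) (use 2(2) r(1) in \<open>simp add: Kp_def sum_nonneg\<close>)
    then show ?thesis using l(1) by (simp add: B_def field_simps)
  qed
  define L0 where "L0 i j = (?n * L2 + B i j * (?n * ?n * L1)) / l" for i j
  have B0: "B i j \<ge> 0" for i j using 2(2) r(1) l(1) by (simp add: B_def Kp_def sum_nonneg)
  have lip0: "norm (\<Gamma> q i j - \<Gamma> q' i j) \<le> L0 i j * norm (q - q')"
    if q: "q \<in> cball p r" "q' \<in> cball p r" and ij: "i \<in> ?B" "j \<in> ?B" for q q' i j
  proof -
    define \<delta> where "\<delta> = \<Gamma> q i j - \<Gamma> q' i j"
    have qS: "q \<in> S" "q' \<in> S" using q in12 by auto
    have "2 * g q \<delta> \<delta> = koszul q i j \<delta> - koszul q' i j \<delta> + 2 * (g q' (\<Gamma> q' i j) \<delta> - g q (\<Gamma> q' i j) \<delta>)"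
      using linear_diff[OF metric_linear(1)[OF qS(1)], of "\<Gamma> q i j" "\<Gamma> q' i j" \<delta>]
        \<Gamma>_koszul[OF qS(1), of i j \<delta>] \<Gamma>_koszul[OF qS(2), of i j \<delta>]
      by (simp add: \<delta>_def[symmetric])
    also have "\<dots> \<le> \<bar>koszul q i j \<delta> - koszul q' i j \<delta>\<bar> + 2 * \<bar>g q' (\<Gamma> q' i j) \<delta> - g q (\<Gamma> q' i j) \<delta>\<bar>"
      by (intro add_mono mult_left_mono abs_ge_self) simp_all
    also have "\<dots> \<le> norm \<delta> * (?n * (L2 * norm (q - q')))
        + 2 * (B i j * norm \<delta> * (?n * ?n * (L1 * norm (q - q'))))"
    proof (intro add_mono mult_left_mono)
      have "linear (\<lambda>z. koszul q i j z - koszul q' i j z)"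
        by (intro linear_compose_sub koszul_linear qS)
      from linear_norm_bound[OF this, of \<delta>]
      have "\<bar>koszul q i j \<delta> - koszul q' i j \<delta>\<bar> \<le> norm \<delta> * (\<Sum>b\<in>?B. \<bar>koszul q i j b - koszul q' i j b\<bar>)"
        by simp
      also have "\<dots> \<le> norm \<delta> * (\<Sum>b\<in>?B. L2 * norm (q - q'))"
        by (intro mult_left_mono sum_mono 2(4) ij in12 q) auto
      finally show "\<bar>koszul q i j \<delta> - koszul q' i j \<delta>\<bar> \<le> norm \<delta> * (?n * (L2 * norm (q - q')))" by simp
      have "\<bar>g q' (\<Gamma> q' i j) \<delta> - g q (\<Gamma> q' i j) \<delta>\<bar>
          \<le> norm (\<Gamma> q' i j) * norm \<delta> * (?n * ?n * (L1 * norm (q' - q)))"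
        by (intro g_lip in12 q)
      also have "\<dots> \<le> B i j * norm \<delta> * (?n * ?n * (L1 * norm (q' - q)))"
        using 1(2) by (intro mult_right_mono \<Gamma>_bound q ij) auto
      finally show "\<bar>g q' (\<Gamma> q' i j) \<delta> - g q (\<Gamma> q' i j) \<delta>\<bar>
          \<le> B i j * norm \<delta> * (?n * ?n * (L1 * norm (q - q')))" by (simp add: norm_minus_commute)
    qed simp
    also have "\<dots> \<le> 2 * ((?n * L2 + B i j * (?n * ?n * L1)) * norm (q - q') * norm \<delta>)"
      using 2(2) by (simp add: algebra_simps)
    finally have "g q \<delta> \<delta> \<le> (?n * L2 + B i j * (?n * ?n * L1)) * norm (q - q') * norm \<delta>" by simp
    then have "l * norm \<delta> \<le> (?n * L2 + B i j * (?n * ?n * L1)) * norm (q - q')"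
      by (rule solve[OF q(1)]) (use 1(2) 2(2) B0 in simp)
    then show ?thesis using l(1) by (simp add: L0_def \<delta>_def field_simps)
  qed
  define L where "L = (\<Sum>i\<in>?B. \<Sum>j\<in>?B. L0 i j)"
  have "L0 i j \<ge> 0" for i j using 1(2) 2(2) B0 l(1) by (simp add: L0_def)
  then have L0: "L \<ge> 0" unfolding L_def by (intro sum_nonneg)
  have "norm (\<Gamma> q u w - \<Gamma> q' u w) \<le> L * norm (q - q') * norm u * norm w"
    if q: "q \<in> cball p r" "q' \<in> cball p r" for q q' u w
  proof -
    have qS: "q \<in> S" "q' \<in> S" using q in12 by auto
    have "bilinear (\<lambda>u w. \<Gamma> q u w - \<Gamma> q' u w)"
      using \<Gamma>_bilinear[OF qS(1)] \<Gamma>_bilinear[OF qS(2)]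
      unfolding bilinear_def by (auto intro: linear_compose_sub)
    from bilinear_norm_bound[OF this, of u w]
    have "norm (\<Gamma> q u w - \<Gamma> q' u w)
        \<le> norm u * norm w * (\<Sum>i\<in>?B. \<Sum>j\<in>?B. norm (\<Gamma> q i j - \<Gamma> q' i j))" .
    also have "\<dots> \<le> norm u * norm w * (\<Sum>i\<in>?B. \<Sum>j\<in>?B. L0 i j * norm (q - q'))"
      by (intro mult_left_mono sum_mono lip0 q) auto
    also have "\<dots> = L * norm (q - q') * norm u * norm w"
      unfolding L_def sum_distrib_right[symmetric] by (simp only: mult_ac)
    finally show ?thesis .
  qed
  then show ?thesis using r(1) L0 in12(3) by blast
qed

lemma \<Gamma>_tendsto:
  assumes p: "p \<in> S" and P: "P \<longlonglongrightarrow> p"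
  shows "(\<lambda>n. \<Gamma> (P n) u w) \<longlonglongrightarrow> \<Gamma> p u w"
proof -
  obtain r L where r: "r > 0" "L \<ge> 0"
    "\<And>q. q \<in> cball p r \<Longrightarrow> norm (\<Gamma> q u w - \<Gamma> p u w) \<le> L * norm (q - p) * norm u * norm w"
    using \<Gamma>_locally_Lipschitz[OF p] centre_in_cball less_imp_le by metis
  have "eventually (\<lambda>n. P n \<in> cball p r) sequentially"
    using P r(1) by (auto simp: tendsto_iff dist_commute elim!: allE[of _ r] eventually_mono)
  then have ev: "eventually (\<lambda>n. norm (\<Gamma> (P n) u w - \<Gamma> p u w) \<le> L * norm (P n - p) * norm u * norm w) sequentially"
    by (rule eventually_mono) (rule r(3))
  have "(\<lambda>n. L * norm (P n - p) * norm u * norm w) \<longlonglongrightarrow> L * norm (p - p) * norm u * norm w"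
    by (intro tendsto_intros P)
  then have "(\<lambda>n. L * norm (P n - p) * norm u * norm w) \<longlonglongrightarrow> 0" by simp
  from Lim_null_comparison[OF ev this]
  show ?thesis by (rule LIM_zero_cancel)
qed

end

text \<open>
  Apply the rule for families of linear maps twice: the partially evaluated form \<open>h q a\<close> is a
  family of linear maps with parameter \<open>(q, a)\<close>.
\<close>

lemma has_derivative_bilinear_family:
  fixes h :: "'b::euclidean_space \<Rightarrow> 'c::euclidean_space \<Rightarrow> 'd::euclidean_space \<Rightarrow> real"
    and \<tau> :: "'a::euclidean_space \<Rightarrow> 'b"
  assumes T: "open T" "\<tau> p \<in> T" and h: "\<And>q. q \<in> T \<Longrightarrow> bilinear (h q)"
    and dh: "\<And>u w. (\<lambda>q. h q u w) differentiable (at (\<tau> p))"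
    and \<tau>: "(\<tau> has_derivative \<tau>') (at p)"
    and a: "(a has_derivative a') (at p)" and b: "(b has_derivative b') (at p)"
  shows "((\<lambda>q. h (\<tau> q) (a q) (b q)) has_derivative
      (\<lambda>v. D (\<lambda>q. h q (a p) (b p)) (\<tau> p) (\<tau>' v) + h (\<tau> p) (a' v) (b p) + h (\<tau> p) (a p) (b' v))) (at p)"
proof -
  have lin: "linear (\<lambda>a. h q a b)" "linear (h q a)" if "q \<in> T" for q a b
    using h[OF that] by (auto simp: bilinear_def)
  have 1: "((\<lambda>x. h (fst x) (snd x) w) has_derivative
      (\<lambda>v. D (\<lambda>q. h q (a p) w) (\<tau> p) (fst v) + h (\<tau> p) (snd v) w)) (at (\<tau> p, a p))" for w
  proof -
    have "((\<lambda>x. h (fst x) (snd x) w) has_derivative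
      (\<lambda>v. D (\<lambda>q. h q (snd (\<tau> p, a p)) w) (fst (\<tau> p, a p)) (fst v) + h (fst (\<tau> p, a p)) (snd v) w)) (at (\<tau> p, a p))"
      by (rule has_derivative_linear_family[where T = T and L = "\<lambda>q a. h q a w" and \<sigma> = fst and a = snd])
        (use T dh lin(1) in \<open>auto intro: derivative_eq_intros\<close>)
    then show ?thesis by simp
  qed
  have "((\<lambda>q. h (fst (\<tau> q, a q)) (snd (\<tau> q, a q)) (b q)) has_derivative
      (\<lambda>v. D (\<lambda>x. h (fst x) (snd x) (b p)) (\<tau> p, a p) (\<tau>' v, a' v) + h (fst (\<tau> p, a p)) (snd (\<tau> p, a p)) (b' v))) (at p)"
  proof (rule has_derivative_linear_family[where T = "T \<times> UNIV" and \<sigma> = "\<lambda>q. (\<tau> q, a q)"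
        and L = "\<lambda>x. h (fst x) (snd x)"])
    show "open (T \<times> (UNIV :: 'c set))" using T(1) by (intro open_Times) auto
    show "(\<lambda>x. h (fst x) (snd x) v) differentiable at (\<tau> p, a p)" for v
      using 1 unfolding differentiable_def by blast
    show "((\<lambda>q. (\<tau> q, a q)) has_derivative (\<lambda>v. (\<tau>' v, a' v))) (at p)"
      by (rule has_derivative_Pair[OF \<tau> a])
  qed (use T lin(2) b in auto)
  then show ?thesis by (simp add: D_eqI[OF 1])
qed

text \<open>
  The transformation law of Christoffel symbols under an isometry \<open>\<tau>\<close>. Differentiating the
  isometry identity and inserting it into Koszul's formula gives terms with second derivatives of
  \<open>\<tau>\<close>; by their symmetry, all but \<open>h(D\<^sup>2\<tau>(u, u), D\<tau> z)\<close> cancel. Equal arguments suffice,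
  since the convergence of jets is only tested on the diagonal.
\<close>

lemma levi_civita_transform:
  fixes \<tau> :: "'e::euclidean_space \<Rightarrow> 'e"
  assumes "coordinate_metric S g" "coordinate_metric T h"
    and N: "open N" "p \<in> N" "N \<subseteq> S" "\<tau> ` N \<subseteq> T" and \<tau>: "Ck_on 2 N \<tau>"
    and isometry: "\<And>q u w. q \<in> N \<Longrightarrow> g q u w = h (\<tau> q) (D \<tau> q u) (D \<tau> q w)"
    and surj: "surj (D \<tau> p)"
  shows "D \<tau> p (levi_civita g p u u) =
     D2 \<tau> p u u + levi_civita h (\<tau> p) (D \<tau> p u) (D \<tau> p u)"
proof -
  interpret g: coordinate_metric S g by fact
  interpret h: coordinate_metric T h by fact
  have p: "p \<in> S" "\<tau> p \<in> T" using N by auto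
  have d: "\<tau> differentiable (at p)" "(\<lambda>q. D \<tau> q w) differentiable (at p)" for w
    using \<tau> N(2) by (auto simp: numeral_2_eq_2)
  have "((\<lambda>q. h (\<tau> q) (D \<tau> q u) (D \<tau> q w)) has_derivative
      (\<lambda>v. D (\<lambda>q. h q (D \<tau> p u) (D \<tau> p w)) (\<tau> p) (D \<tau> p v)
        + h (\<tau> p) (D2 \<tau> p v u) (D \<tau> p w) + h (\<tau> p) (D \<tau> p u) (D2 \<tau> p v w))) (at p)" for u w
    by (rule has_derivative_bilinear_family[OF h.open_dom p(2) h.metric_bilinear
          h.metric_differentiable[OF p(2)] D_works[OF d(1)] D_works[OF d(2)] D_works[OF d(2)]])
  then have "((\<lambda>q. g q u w) has_derivative
      (\<lambda>v. D (\<lambda>q. h q (D \<tau> p u) (D \<tau> p w)) (\<tau> p) (D \<tau> p v)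
        + h (\<tau> p) (D2 \<tau> p v u) (D \<tau> p w) + h (\<tau> p) (D \<tau> p u) (D2 \<tau> p v w))) (at p)" for u w
    by (rule has_derivative_transform_within_open[OF _ N(1,2)]) (simp add: isometry)
  note Dg = fun_cong[OF D_eqI[OF this]]
  define y where "y = D \<tau> p (g.\<Gamma> p u u) - D2 \<tau> p u u"
  have "h.\<Gamma> (\<tau> p) (D \<tau> p u) (D \<tau> p u) = y"
  proof (rule h.\<Gamma>_unique_diagonal[OF p(2)])
    fix z'
    obtain z where z: "z' = D \<tau> p z" using surj by (metis surjD)
    have "2 * h (\<tau> p) (D \<tau> p (g.\<Gamma> p u u)) z' = 2 * g p (g.\<Gamma> p u u) z"
      using isometry[OF N(2)] z by simp
    also have "\<dots> = 2 * D (\<lambda>q. g q u z) p u - D (\<lambda>q. g q u u) p z"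
      by (rule g.\<Gamma>_diagonal[OF p(1)])
    also have "\<dots> = 2 * D (\<lambda>q. h q (D \<tau> p u) z') (\<tau> p) (D \<tau> p u) + 2 * h (\<tau> p) (D2 \<tau> p u u) z'
        - D (\<lambda>q. h q (D \<tau> p u) (D \<tau> p u)) (\<tau> p) z'"
      unfolding Dg z D2_symmetric[OF N(1) \<tau> N(2), of z u] h.metric_sym[OF p(2), of "D \<tau> p u" "D2 \<tau> p _ _"]
      by (simp add: D2_symmetric[OF N(1) \<tau> N(2)])
    finally show "2 * h (\<tau> p) y z' = 2 * D (\<lambda>q. h q (D \<tau> p u) z') (\<tau> p) (D \<tau> p u)
        - D (\<lambda>q. h q (D \<tau> p u) (D \<tau> p u)) (\<tau> p) z'"
      unfolding y_def linear_diff[OF h.metric_linear(1)[OF p(2)]] by (simp add: algebra_simps)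
  qed
  then show ?thesis by (simp add: y_def)
qed

section \<open>Limiting second order jets in a Euclidean space\<close>

text \<open>
  Pointwise convergence of linear maps on a finite-dimensional space is uniform on bounded sets,
  hence allows for moving arguments.
\<close>

lemma linear_tendsto:
  fixes L :: "nat \<Rightarrow> 'a::euclidean_space \<Rightarrow> 'b::real_normed_vector"
  assumes "\<And>n. linear (L n)" "\<And>u. (\<lambda>n. L n u) \<longlonglongrightarrow> l u" "v \<longlonglongrightarrow> w"
  shows "(\<lambda>n. L n (v n)) \<longlonglongrightarrow> l w"
proof -
  have e: "L n u = (\<Sum>b\<in>Basis. (u \<bullet> b) *\<^sub>R L n b)" for n u by (rule linear_expand[OF assms(1)])
  have t: "(\<lambda>n. \<Sum>b\<in>Basis. (u n \<bullet> b) *\<^sub>R L n b) \<longlonglongrightarrow> (\<Sum>b\<in>Basis. (w \<bullet> b) *\<^sub>R l b)"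
    if "u \<longlonglongrightarrow> w" for u by (intro tendsto_intros that assms(2))
  have "(\<lambda>n. L n w) \<longlonglongrightarrow> (\<Sum>b\<in>Basis. (w \<bullet> b) *\<^sub>R l b)"
    using t[of "\<lambda>_. w"] by (simp add: e[of _ w])
  then have "l w = (\<Sum>b\<in>Basis. (w \<bullet> b) *\<^sub>R l b)" using assms(2) LIMSEQ_unique by blast
  then show ?thesis using t[OF assms(3)] by (simp only: e[symmetric])
qed

text \<open>
  Only the diagonal of the forms is assumed to converge. By polarization the symmetrized forms
  converge for all pairs of arguments, and they have the same diagonal.
\<close>

lemma quadratic_tendsto:
  fixes B :: "nat \<Rightarrow> 'a::euclidean_space \<Rightarrow> 'a \<Rightarrow> 'b::real_normed_vector"
  assumes B: "\<And>n. bilinear (B n)" and q: "\<And>u. (\<lambda>n. B n u u) \<longlonglongrightarrow> q u" and v: "v \<longlonglongrightarrow> w"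
  shows "(\<lambda>n. B n (v n) (v n)) \<longlonglongrightarrow> q w"
proof -
  define S where "S n u u' = (1/2) *\<^sub>R (B n u u' + B n u' u)" for n u u'
  have lin: "linear (\<lambda>a. B n a b)" "linear (B n b)" for n b using B by (auto simp: bilinear_def)
  have S: "S n u u' = (1/2) *\<^sub>R (B n (u + u') (u + u') - B n u u - B n u' u')" for n u u'
    by (simp add: S_def linear_add[OF lin(1)] linear_add[OF lin(2)])
  have diag: "S n u u = B n u u" for n u by (simp add: S_def scaleR_2[symmetric])
  have linS: "linear (\<lambda>a. S n a b)" "linear (S n b)" for n b
    unfolding S_def by (intro linear_compose_scale_right linear_compose_add lin)+
  have Sq: "(\<lambda>n. S n u u') \<longlonglongrightarrow> (1/2) *\<^sub>R (q (u + u') - q u - q u')" for u u'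
    unfolding S by (intro tendsto_intros q)
  have "(\<lambda>n. S n (v n) u) \<longlonglongrightarrow> (1/2) *\<^sub>R (q (w + u) - q w - q u)" for u
    by (rule linear_tendsto[OF linS(1) Sq v])
  then have "(\<lambda>n. S n (v n) (v n)) \<longlonglongrightarrow> (1/2) *\<^sub>R (q (w + w) - q w - q w)"
    by (rule linear_tendsto[OF linS(2) _ v])
  moreover have "(1/2) *\<^sub>R (q (w + w) - q w - q w) = q w"
    using Sq[of w w] q[of w] LIMSEQ_unique unfolding diag by blast
  ultimately show ?thesis by (simp add: diag)
qed

definition C2_at :: "'a::euclidean_space \<Rightarrow> ('a \<Rightarrow> 'b::real_normed_vector) \<Rightarrow> bool" where
  "C2_at p \<psi> \<longleftrightarrow> (\<exists>N. open N \<and> p \<in> N \<and> Ck_on 2 N \<psi>)"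

text \<open>
  Where \<open>h p = \<infinity>\<close> this says that \<open>h\<close> is infinite near \<open>p\<close>.
\<close>

definition touches_at :: "('x::topological_space \<Rightarrow> ereal) \<Rightarrow> ('x \<Rightarrow> real) \<Rightarrow> 'x \<Rightarrow> bool" where
  "touches_at h \<psi> p \<longleftrightarrow>
     (\<exists>N. open N \<and> p \<in> N \<and> (\<forall>q\<in>N. h p - ereal (\<psi> p) \<le> h q - ereal (\<psi> q)))"

text \<open>
  The quadratic part is recorded as a function \<open>Q\<close> of one vector because convergence of bilinear forms is only tested on
  the diagonal.
\<close>

definition coordinate_limiting_jet ::
    "('a::euclidean_space \<Rightarrow> ereal) \<Rightarrow> 'a \<Rightarrow> ('a \<Rightarrow> real) \<Rightarrow> ('a \<Rightarrow> real) \<Rightarrow> bool" where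
  "coordinate_limiting_jet h p \<zeta> Q \<longleftrightarrow> (\<exists>P \<Psi>. P \<longlonglongrightarrow> p \<and> (\<lambda>n. h (P n)) \<longlonglongrightarrow> h p \<and>
     (\<forall>n. C2_at (P n) (\<Psi> n) \<and> touches_at h (\<Psi> n) (P n)) \<and>
     (\<forall>u. (\<lambda>n. D (\<Psi> n) (P n) u) \<longlonglongrightarrow> \<zeta> u) \<and>
     (\<forall>u. (\<lambda>n. D2 (\<Psi> n) (P n) u u) \<longlonglongrightarrow> Q u))"

text \<open>
  Finitely many terms at which no jet is given are dropped by shifting the sequence.
\<close>

lemma coordinate_limiting_jetI_eventually:
  assumes "P \<longlonglongrightarrow> p" "(\<lambda>n. h (P n)) \<longlonglongrightarrow> h p"
    and ev: "\<forall>\<^sub>F n in sequentially. C2_at (P n) (\<Psi> n) \<and> touches_at h (\<Psi> n) (P n)"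
    and "\<And>u. (\<lambda>n. D (\<Psi> n) (P n) u) \<longlonglongrightarrow> \<zeta> u"
    and "\<And>u. (\<lambda>n. D2 (\<Psi> n) (P n) u u) \<longlonglongrightarrow> Q u"
  shows "coordinate_limiting_jet h p \<zeta> Q"
proof -
  obtain k where k: "\<And>n. n \<ge> k \<Longrightarrow> C2_at (P n) (\<Psi> n) \<and> touches_at h (\<Psi> n) (P n)"
    using ev unfolding eventually_sequentially by blast
  note sh = LIMSEQ_ignore_initial_segment[where k = k]
  show ?thesis
    unfolding coordinate_limiting_jet_def
    by (intro exI[of _ "\<lambda>n. P (n + k)"] exI[of _ "\<lambda>n. \<Psi> (n + k)"] conjI allI
        assms(1,2,4,5)[THEN sh] k[THEN conjunct1] k[THEN conjunct2]) simp_all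
qed

lemma touches_at_cong:
  assumes "open N" "p \<in> N" "\<And>q. q \<in> N \<Longrightarrow> h q = h' q" "touches_at h \<psi> p"
  shows "touches_at h' \<psi> p"
proof -
  obtain N' where "open N'" "p \<in> N'" "\<forall>q\<in>N'. h p - ereal (\<psi> p) \<le> h q - ereal (\<psi> q)"
    using assms(4) unfolding touches_at_def by blast
  then show ?thesis
    unfolding touches_at_def using assms(1-3) by (intro exI[of _ "N \<inter> N'"]) auto
qed

lemma touches_at_compose:
  assumes "open N" "v \<in> N" "continuous_on N F" "touches_at h \<psi> (F v)"
  shows "touches_at (\<lambda>v. h (F v)) (\<lambda>v. \<psi> (F v)) v"
proof -
  obtain N' where N': "open N'" "F v \<in> N'" "\<forall>q\<in>N'. h (F v) - ereal (\<psi> (F v)) \<le> h q - ereal (\<psi> q)"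
    using assms(4) unfolding touches_at_def by blast
  have "open (N \<inter> F -` N')" using continuous_open_preimage[OF assms(3,1) N'(1)] .
  then show ?thesis
    unfolding touches_at_def using assms(2) N' by (intro exI[of _ "N \<inter> F -` N'"]) auto
qed

lemma C2_at_differentiable:
  assumes "C2_at p \<psi>" shows "\<psi> differentiable (at p)" "(\<lambda>q. D \<psi> q w) differentiable (at p)"
  using assms by (auto simp: C2_at_def numeral_2_eq_2)

lemma C2_at_bilinear:
  assumes "C2_at p \<psi>" shows "bilinear (\<lambda>u w. D2 \<psi> p u w)"
proof -
  obtain N where N: "open N" "p \<in> N" "Ck_on 2 N \<psi>" using assms by (auto simp: C2_at_def)
  have d: "\<psi> differentiable (at q)" "(\<lambda>q. D \<psi> q w) differentiable (at q)" if "q \<in> N" for q w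
    using N(3) that by (auto simp: numeral_2_eq_2)
  note dD = D_cong_open[OF N(1,2), THEN fun_cong] and W = D_works[OF d(2)[OF N(2)]]
  have "linear (\<lambda>w. D2 \<psi> p u w)" for u
  proof (rule linearI)
    fix x y c
    have "D2 \<psi> p u (x + y) = D (\<lambda>q. D \<psi> q x + D \<psi> q y) p u"
      by (rule dD) (rule linear_add[OF linear_D[OF d(1)]])
    then show "D2 \<psi> p u (x + y) = D2 \<psi> p u x + D2 \<psi> p u y"
      using D_eqI[OF has_derivative_add[OF W W]] by simp
    have "D2 \<psi> p u (c *\<^sub>R x) = D (\<lambda>q. c *\<^sub>R D \<psi> q x) p u"
      by (rule dD) (rule linear_scale[OF linear_D[OF d(1)]])
    then show "D2 \<psi> p u (c *\<^sub>R x) = c *\<^sub>R D2 \<psi> p u x"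
      using D_eqI[OF has_derivative_scaleR_right[OF W]] by simp
  qed
  moreover have "linear (\<lambda>u. D2 \<psi> p u w)" for w by (rule linear_D[OF d(2)[OF N(2)]])
  ultimately show ?thesis by (simp add: bilinear_def)
qed

lemma C2_at_compose:
  assumes "open N" "v \<in> N" "Ck_on 2 N F" "C2_at (F v) \<psi>"
  shows "C2_at v (\<lambda>v. \<psi> (F v))"
    and "D (\<lambda>v. \<psi> (F v)) v u = D \<psi> (F v) (D F v u)"
    and "D2 (\<lambda>v. \<psi> (F v)) v u w = D2 \<psi> (F v) (D F v u) (D F v w) + D \<psi> (F v) (D2 F v u w)"
proof -
  obtain N' where N': "open N'" "F v \<in> N'" "Ck_on 2 N' \<psi>" using assms(4) by (auto simp: C2_at_def)
  have o: "open (N \<inter> F -` N')"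
    using continuous_open_preimage[OF Ck_on_continuous[OF assms(3)] assms(1) N'(1)] .
  have i: "F ` (N \<inter> F -` N') \<subseteq> N'" "v \<in> N \<inter> F -` N'" using N'(2) assms(2) by auto
  have F: "Ck_on 2 (N \<inter> F -` N') F" using Ck_on_subset[OF assms(3)] by blast
  show "C2_at v (\<lambda>v. \<psi> (F v))"
    unfolding C2_at_def using Ck_on_compose[OF o i(1) F N'(3)] o i(2) by blast
  show "D (\<lambda>v. \<psi> (F v)) v u = D \<psi> (F v) (D F v u)"
    by (rule D_compose(2)[OF C2_at_differentiable(1)[OF assms(4)] Ck_on_differentiable[OF assms(3) _ assms(2)]]) simp
  show "D2 (\<lambda>v. \<psi> (F v)) v u w = D2 \<psi> (F v) (D F v u) (D F v w) + D \<psi> (F v) (D2 F v u w)"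
    by (rule D2_compose[OF o N'(1) i(1) F N'(3) i(2)])
qed

lemma eventually_in_open:
  "P \<longlonglongrightarrow> p \<Longrightarrow> open N \<Longrightarrow> p \<in> N \<Longrightarrow> \<forall>\<^sub>F n in sequentially. P n \<in> N"
  by (rule topological_tendstoD)

lemma C2_tendsto:
  assumes "open N" "Ck_on 2 N F" "v \<in> N" "V \<longlonglongrightarrow> v"
  shows "(\<lambda>n. F (V n)) \<longlonglongrightarrow> F v" "(\<lambda>n. D F (V n) u) \<longlonglongrightarrow> D F v u"
    "(\<lambda>n. D2 F (V n) u w) \<longlonglongrightarrow> D2 F v u w"
proof -
  have ev: "\<forall>\<^sub>F n in sequentially. V n \<in> N" using eventually_in_open assms by blast
  have "continuous_on N F" "continuous_on N (\<lambda>q. D F q u)" "continuous_on N (\<lambda>q. D2 F q u w)"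
    using assms(2) Ck_on_continuous[OF assms(2)] Ck_on_continuous[of 1 N "\<lambda>q. D F q u"]
    by (auto simp: numeral_2_eq_2)
  from this[THEN continuous_on_tendsto_compose, OF assms(4,3) ev]
  show "(\<lambda>n. F (V n)) \<longlonglongrightarrow> F v" "(\<lambda>n. D F (V n) u) \<longlonglongrightarrow> D F v u"
    "(\<lambda>n. D2 F (V n) u w) \<longlonglongrightarrow> D2 F v u w" .
qed

text \<open>
  The points \<open>P n\<close> are pulled back by the continuous section \<open>G\<close> and the test functions by \<open>F\<close>; the chain
  rules of first and second order compute the jets of the pulled back test functions, and the
  derivatives of \<open>F\<close> at the moving points converge because \<open>F\<close> is \<open>C\<^sup>2\<close>.
\<close>

lemma coordinate_limiting_jet_compose:
  fixes F :: "'a::euclidean_space \<Rightarrow> 'b::euclidean_space"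
  assumes N: "open N" "Ck_on 2 N F" and T: "open T" "p \<in> T" and G: "continuous_on T G"
    and FG: "\<And>q. q \<in> T \<Longrightarrow> G q \<in> N \<and> F (G q) = q"
    and jet: "coordinate_limiting_jet h p \<zeta> Q"
  shows "coordinate_limiting_jet (\<lambda>v. h (F v)) (G p) (\<lambda>u. \<zeta> (D F (G p) u))
    (\<lambda>u. Q (D F (G p) u) + \<zeta> (D2 F (G p) u u))"
proof -
  obtain P0 \<Psi>0 where P0: "P0 \<longlonglongrightarrow> p" "(\<lambda>n. h (P0 n)) \<longlonglongrightarrow> h p"
    "\<And>n. C2_at (P0 n) (\<Psi>0 n) \<and> touches_at h (\<Psi>0 n) (P0 n)"
    "\<And>u. (\<lambda>n. D (\<Psi>0 n) (P0 n) u) \<longlonglongrightarrow> \<zeta> u" "\<And>u. (\<lambda>n. D2 (\<Psi>0 n) (P0 n) u u) \<longlonglongrightarrow> Q u"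
    using jet unfolding coordinate_limiting_jet_def by blast
  obtain k where k: "\<And>n. n \<ge> k \<Longrightarrow> P0 n \<in> T"
    using eventually_in_open[OF P0(1) T] unfolding eventually_sequentially by blast
  note sh = LIMSEQ_ignore_initial_segment[where k = k]
  define P where "P n = P0 (n + k)" for n
  define \<Psi> where "\<Psi> n = \<Psi>0 (n + k)" for n
  have P: "P \<longlonglongrightarrow> p" "(\<lambda>n. h (P n)) \<longlonglongrightarrow> h p"
    "\<And>n. C2_at (P n) (\<Psi> n)" "\<And>n. touches_at h (\<Psi> n) (P n)" "\<And>n. P n \<in> T"
    "\<And>u. (\<lambda>n. D (\<Psi> n) (P n) u) \<longlonglongrightarrow> \<zeta> u" "\<And>u. (\<lambda>n. D2 (\<Psi> n) (P n) u u) \<longlonglongrightarrow> Q u"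
    using P0(3) k P0(1,2,4,5)[THEN sh] by (auto simp: P_def[abs_def] \<Psi>_def)
  define V where "V n = G (P n)" for n
  have V: "V n \<in> N" "F (V n) = P n" for n using FG[OF P(5)[of n]] by (auto simp: V_def)
  have Gp: "G p \<in> N" "F (G p) = p" using FG[OF T(2)] by auto
  have Vlim: "V \<longlonglongrightarrow> G p"
    unfolding V_def by (rule continuous_on_tendsto_compose[OF G P(1) T(2)]) (simp add: P(5))
  note F = C2_tendsto[OF N Gp(1) Vlim]
  have C2: "C2_at (F (V n)) (\<Psi> n)" for n using P(3)[of n] V(2)[of n] by simp
  note comp = C2_at_compose[OF N(1) V(1) N(2) C2]
  show ?thesis
  proof (rule coordinate_limiting_jetI_eventually)
    show "V \<longlonglongrightarrow> G p" by fact
    show "(\<lambda>n. h (F (V n))) \<longlonglongrightarrow> h (F (G p))" using P(2) by (simp add: V(2) Gp(2))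
    show "\<forall>\<^sub>F n in sequentially. C2_at (V n) (\<lambda>v. \<Psi> n (F v)) \<and>
        touches_at (\<lambda>v. h (F v)) (\<lambda>v. \<Psi> n (F v)) (V n)"
      using comp(1) touches_at_compose[OF N(1) V(1) Ck_on_continuous[OF N(2)]] P(4) V(2)
      by (intro always_eventually allI conjI) auto
    have lin: "linear (D (\<Psi> n) (P n))" for n by (rule linear_D[OF C2_at_differentiable(1)[OF P(3)]])
    fix u
    show "(\<lambda>n. D (\<lambda>v. \<Psi> n (F v)) (V n) u) \<longlonglongrightarrow> \<zeta> (D F (G p) u)"
      unfolding comp(2) V(2) by (rule linear_tendsto[OF lin P(6) F(2)])
    show "(\<lambda>n. D2 (\<lambda>v. \<Psi> n (F v)) (V n) u u) \<longlonglongrightarrow> Q (D F (G p) u) + \<zeta> (D2 F (G p) u u)"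
      unfolding comp(3) V(2)
      by (intro tendsto_add linear_tendsto[OF lin P(6) F(3)]
          quadratic_tendsto[OF C2_at_bilinear[OF P(3)] P(7) F(2)])
  qed
qed

lemma coordinate_limiting_jet_cong:
  assumes "open N" "p \<in> N" "\<And>q. q \<in> N \<Longrightarrow> h q = h' q"
    and jet: "coordinate_limiting_jet h p \<zeta> Q"
  shows "coordinate_limiting_jet h' p \<zeta> Q"
proof -
  obtain P \<Psi> where P: "P \<longlonglongrightarrow> p" "(\<lambda>n. h (P n)) \<longlonglongrightarrow> h p"
    "\<And>n. C2_at (P n) (\<Psi> n) \<and> touches_at h (\<Psi> n) (P n)"
    "\<And>u. (\<lambda>n. D (\<Psi> n) (P n) u) \<longlonglongrightarrow> \<zeta> u" "\<And>u. (\<lambda>n. D2 (\<Psi> n) (P n) u u) \<longlonglongrightarrow> Q u"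
    using jet unfolding coordinate_limiting_jet_def by blast
  have ev: "\<forall>\<^sub>F n in sequentially. P n \<in> N" by (rule eventually_in_open[OF P(1) assms(1,2)])
  show ?thesis
  proof (rule coordinate_limiting_jetI_eventually[OF P(1)])
    show "(\<lambda>n. h' (P n)) \<longlonglongrightarrow> h' p"
      using P(2) assms(2,3) by (auto intro: Lim_transform_eventually eventually_mono[OF ev])
    show "\<forall>\<^sub>F n in sequentially. C2_at (P n) (\<Psi> n) \<and> touches_at h' (\<Psi> n) (P n)"
      using ev
    proof (rule eventually_mono)
      fix n assume "P n \<in> N"
      then have "touches_at h' (\<Psi> n) (P n)"
        by (rule touches_at_cong[OF assms(1) _ assms(3)]) (simp_all add: P(3))
      then show "C2_at (P n) (\<Psi> n) \<and> touches_at h' (\<Psi> n) (P n)" using P(3) by blast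
    qed
  qed (fact P)+
qed

section \<open>Subjets of a manifold in a chart\<close>

text \<open>
  The predicate \<open>riemannian_manifold\<close> as a locale, for use with several manifolds at once.
\<close>

locale riemannian =
  fixes M :: "('m::t2_space, 'e::euclidean_space) riem_structure"
  assumes riemannian_manifold: "riemannian_manifold M"
begin

abbreviation transition :: "('m, 'e) chart \<Rightarrow> ('m, 'e) chart \<Rightarrow> 'e \<Rightarrow> 'e" where
  "transition c d \<equiv> \<lambda>p. chart_map d (chart_inv c p)"

abbreviation chart_img :: "('m, 'e) chart \<Rightarrow> 'e set" where
  "chart_img c \<equiv> chart_map c ` chart_dom c"

lemma chart:
  assumes "c \<in> atlas M"
  shows "open (chart_dom c)" "open (chart_img c)"
    "homeomorphism (chart_dom c) (chart_img c) (chart_map c) (chart_inv c)"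
  using riemannian_manifold assms by (auto simp: riemannian_manifold_def)

lemma chart_inv_map [simp]: "c \<in> atlas M \<Longrightarrow> y \<in> chart_dom c \<Longrightarrow> chart_inv c (chart_map c y) = y"
  and chart_map_inv [simp]: "c \<in> atlas M \<Longrightarrow> p \<in> chart_img c \<Longrightarrow> chart_map c (chart_inv c p) = p"
  and chart_inv_dom: "c \<in> atlas M \<Longrightarrow> p \<in> chart_img c \<Longrightarrow> chart_inv c p \<in> chart_dom c"
  and continuous_chart_map: "c \<in> atlas M \<Longrightarrow> continuous_on (chart_dom c) (chart_map c)"
  and continuous_chart_inv: "c \<in> atlas M \<Longrightarrow> continuous_on (chart_img c) (chart_inv c)"
  using chart(3)[of c] by (auto simp: homeomorphism_def)

lemma chart_dom_points: "c \<in> atlas M \<Longrightarrow> chart_dom c \<subseteq> points M"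
  by (auto simp: points_def)

lemma open_points: "open (points M)"
  unfolding points_def using chart(1) by auto

lemma open_chart_image:
  assumes "c \<in> atlas M" "open W" shows "open (chart_map c ` (W \<inter> chart_dom c))"
proof -
  have "chart_map c ` (W \<inter> chart_dom c) = chart_img c \<inter> chart_inv c -` W"
    using assms(1) by (auto intro!: image_eqI chart_map_inv[symmetric] chart_inv_dom)
  then show ?thesis
    using continuous_open_preimage[OF continuous_chart_inv chart(2) assms(2)] assms(1) by simp
qed

lemma pref: "y \<in> points M \<Longrightarrow> pref_chart M y \<in> atlas M" "y \<in> points M \<Longrightarrow> y \<in> chart_dom (pref_chart M y)"
  using riemannian_manifold by (auto simp: riemannian_manifold_def)

lemma overlap:
  assumes "c \<in> atlas M" "d \<in> atlas M"
  shows "open (chart_map c ` (chart_dom c \<inter> chart_dom d))"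
    "Ck_on k (chart_map c ` (chart_dom c \<inter> chart_dom d)) (transition c d)"
    "chart_map c ` (chart_dom c \<inter> chart_dom d) \<subseteq> chart_img c"
proof -
  show "open (chart_map c ` (chart_dom c \<inter> chart_dom d))"
    using open_chart_image[OF assms(1) chart(1)[OF assms(2)]] by (simp add: Int_commute)
  show "Ck_on k (chart_map c ` (chart_dom c \<inter> chart_dom d)) (transition c d)"
    using riemannian_manifold assms by (auto simp: riemannian_manifold_def smooth_on_def)
qed (use assms in auto)

lemma transition_deriv_linear:
  assumes "c \<in> atlas M" "d \<in> atlas M" "y \<in> chart_dom c" "y \<in> chart_dom d"
  shows "linear (transition_deriv c d y)"
  unfolding transition_deriv_def
  by (rule linear_D[OF Ck_on_differentiable[OF overlap(2)[OF assms(1,2), of 1]]]) (use assms in auto)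

lemma transition_deriv_chain:
  assumes at: "c \<in> atlas M" "d \<in> atlas M" "e \<in> atlas M"
    and y: "y \<in> chart_dom c" "y \<in> chart_dom d" "y \<in> chart_dom e"
  shows "transition_deriv d e y (transition_deriv c d y u) = transition_deriv c e y u"
proof -
  have cy: "chart_map c y \<in> chart_map c ` (chart_dom c \<inter> chart_dom d)" using y by blast
  have "D (\<lambda>q. transition d e (transition c d q)) (chart_map c y) u
      = D (transition d e) (transition c d (chart_map c y)) (D (transition c d) (chart_map c y) u)"
    by (rule D_compose(2)[OF Ck_on_differentiable[OF overlap(2)[OF at(2,3), of 1]]
          Ck_on_differentiable[OF overlap(2)[OF at(1,2), of 1]]])
      (use at y in auto)
  moreover have "D (\<lambda>q. transition d e (transition c d q)) (chart_map c y) = D (transition c e) (chart_map c y)"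
    by (rule D_cong_open[OF overlap(1)[OF at(1,2)] cy]) (use at in auto)
  ultimately show ?thesis using at y by (simp add: transition_deriv_def)
qed

lemma transition_deriv_self:
  assumes "c \<in> atlas M" "y \<in> chart_dom c"
  shows "transition_deriv c c y u = u"
proof -
  have "D (transition c c) (chart_map c y) = D (\<lambda>q. q) (chart_map c y)"
    by (rule D_cong_open[OF chart(2)[OF assms(1)]]) (use assms in auto)
  then show ?thesis by (simp add: transition_deriv_def)
qed

lemma transition_deriv_inverse:
  assumes "c \<in> atlas M" "d \<in> atlas M" "y \<in> chart_dom c" "y \<in> chart_dom d"
  shows "transition_deriv d c y (transition_deriv c d y u) = u"
  using transition_deriv_chain[of c d c y u] transition_deriv_self[of c y u] assms by simp

lemma christoffel_eq: "christoffel M c = levi_civita (coord_metric M c)"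
  by (intro ext) (simp add: christoffel_def levi_civita_def)

lemma coord_metric_at:
  assumes "c \<in> atlas M" "y \<in> chart_dom c"
  shows "coord_metric M c (chart_map c y) u w = metric M y
    (transition_deriv c (pref_chart M y) y u) (transition_deriv c (pref_chart M y) y w)"
  using assms by (simp add: coord_metric_def Let_def)

text \<open>
  Positivity needs that the transition derivative into the preferred chart is injective, which
  follows from its inverse, the derivative of the reverse transition.
\<close>

lemma coordinate_metric:
  assumes c: "c \<in> atlas M"
  shows "coordinate_metric (chart_img c) (coord_metric M c)"
proof
  show "open (chart_img c)" by (rule chart(2)[OF c])
  show "Ck_on 2 (chart_img c) (\<lambda>q. coord_metric M c q u w)" for u w
    using riemannian_manifold c by (simp add: riemannian_manifold_def smooth_on_def)
  fix q assume "q \<in> chart_img c"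
  then obtain y where y: "y \<in> chart_dom c" "q = chart_map c y" by blast
  have yp: "y \<in> points M" using chart_dom_points[OF c] y by blast
  let ?T = "transition_deriv c (pref_chart M y) y"
  have T: "linear ?T" by (rule transition_deriv_linear[OF c pref(1)[OF yp] y(1) pref(2)[OF yp]])
  have g: "bilinear (metric M y)" "\<And>u w. metric M y u w = metric M y w u" "\<And>u. u \<noteq> 0 \<Longrightarrow> metric M y u u > 0"
    using riemannian_manifold yp by (auto simp: riemannian_manifold_def inner_product_form_def)
  have "?T u \<noteq> 0" if "u \<noteq> 0" for u
  proof
    assume "?T u = 0"
    then have "transition_deriv (pref_chart M y) c y 0 = u"
      using transition_deriv_inverse[OF c pref(1)[OF yp] y(1) pref(2)[OF yp], of u] by simp
    then show False
      using that linear_0[OF transition_deriv_linear[OF pref(1)[OF yp] c pref(2)[OF yp] y(1)]] by simp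
  qed
  moreover have "bilinear (\<lambda>u w. metric M y (?T u) (?T w))"
    unfolding bilinear_def
    using linear_compose[OF T, of "\<lambda>a. metric M y a _"] linear_compose[OF T, of "metric M y _"] g(1)
    by (auto simp: o_def bilinear_def)
  ultimately show "inner_product_form (coord_metric M c q)"
    using g unfolding inner_product_form_def y(2) coord_metric_at[OF c y(1), abs_def] by auto
qed

text \<open>
  Both sides are computed by way of the preferred chart at the point, so the chain rule for transition
  derivatives applies.
\<close>

lemma coord_metric_change:
  assumes at: "c \<in> atlas M" "d \<in> atlas M" and q: "q \<in> chart_map c ` (chart_dom c \<inter> chart_dom d)"
  shows "coord_metric M c q u w =
    coord_metric M d (transition c d q) (D (transition c d) q u) (D (transition c d) q w)"
proof -
  obtain y where y: "y \<in> chart_dom c" "y \<in> chart_dom d" "q = chart_map c y" using q by blast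
  have yp: "y \<in> points M" using chart_dom_points[OF at(1)] y by blast
  note ch = transition_deriv_chain[OF at pref(1)[OF yp] y(1,2) pref(2)[OF yp]]
  show ?thesis
    unfolding y(3) chart_inv_map[OF at(1) y(1)] coord_metric_at[OF at(1) y(1)] coord_metric_at[OF at(2) y(2)]
    by (simp add: ch flip: transition_deriv_def)
qed

lemma christoffel_change:
  assumes at: "c \<in> atlas M" "d \<in> atlas M" and y: "y \<in> chart_dom c" "y \<in> chart_dom d"
  shows "transition_deriv c d y (christoffel M c (chart_map c y) u u) =
    D2 (transition c d) (chart_map c y) u u +
    christoffel M d (chart_map d y) (transition_deriv c d y u) (transition_deriv c d y u)"
proof -
  have cy: "chart_map c y \<in> chart_map c ` (chart_dom c \<inter> chart_dom d)" using y by blast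
  have "surj (transition_deriv c d y)"
    by (rule surjI[of _ "transition_deriv d c y"]) (rule transition_deriv_inverse[OF at(2,1) y(2,1)])
  then have s: "surj (D (transition c d) (chart_map c y))" by (simp add: transition_deriv_def)
  have i: "transition c d ` chart_map c ` (chart_dom c \<inter> chart_dom d) \<subseteq> chart_img d"
    using at by auto
  from levi_civita_transform[OF coordinate_metric[OF at(1)] coordinate_metric[OF at(2)]
      overlap(1)[OF at] cy overlap(3)[OF at] i overlap(2)[OF at] coord_metric_change[OF at] s]
  show ?thesis using at y by (simp add: christoffel_eq transition_deriv_def)
qed

lemma C2_near_chart:
  assumes "C2_near M y \<phi>" "c \<in> atlas M" "y \<in> chart_dom c"
  shows "C2_at (chart_map c y) (\<lambda>p. \<phi> (chart_inv c p))"
proof -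
  obtain W where W: "open W" "y \<in> W" "Ck_on 2 (chart_map c ` (W \<inter> chart_dom c)) (\<lambda>p. \<phi> (chart_inv c p))"
    using assms unfolding C2_near_def by blast
  then show ?thesis
    unfolding C2_at_def using open_chart_image[OF assms(2) W(1)] assms(3) by blast
qed

lemma C2_near_of_chart:
  assumes c: "c \<in> atlas M" "y \<in> chart_dom c" and "C2_at (chart_map c y) \<psi>"
  shows "C2_near M y (\<lambda>z. \<psi> (chart_map c z))"
proof -
  obtain N where N: "open N" "chart_map c y \<in> N" "Ck_on 2 N \<psi>"
    using assms(3) unfolding C2_at_def by blast
  let ?W = "chart_dom c \<inter> chart_map c -` N"
  have o: "open ?W" by (rule continuous_open_preimage[OF continuous_chart_map chart(1) N(1)]) (rule c)+
  have "Ck_on 2 (chart_map d ` (?W \<inter> chart_dom d)) (\<lambda>p. \<psi> (chart_map c (chart_inv d p)))"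
    if d: "d \<in> atlas M" for d
  proof (rule Ck_on_compose[OF open_chart_image[OF d o] _ _ N(3)])
    show "Ck_on 2 (chart_map d ` (?W \<inter> chart_dom d)) (transition d c)"
      by (rule Ck_on_subset[OF overlap(2)[OF d c(1)]]) auto
    show "transition d c ` chart_map d ` (?W \<inter> chart_dom d) \<subseteq> N" using d by auto
  qed
  then show ?thesis
    unfolding C2_near_def using o c N(2) chart_dom_points[OF c(1)] by (intro exI[of _ ?W]) auto
qed

text \<open>
  The differential and the Hessian, which are defined by the preferred chart at \<open>y\<close>, may be
  computed in any chart: the term \<open>D\<psi>(D\<^sup>2\<tau>(u, u))\<close> from the second order chain rule is exactly the
  defect in the transformation law of the Christoffel symbols.
\<close>

lemma differential_chart:
  assumes c: "c \<in> atlas M" "y \<in> chart_dom c" and \<phi>: "C2_near M y \<phi>"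
  shows "differential M \<phi> y (transition_deriv c (pref_chart M y) y u) =
      D (\<lambda>p. \<phi> (chart_inv c p)) (chart_map c y) u" (is ?diff)
    and "hessian M \<phi> y (transition_deriv c (pref_chart M y) y u) (transition_deriv c (pref_chart M y) y u) =
      D2 (\<lambda>p. \<phi> (chart_inv c p)) (chart_map c y) u u -
      D (\<lambda>p. \<phi> (chart_inv c p)) (chart_map c y) (christoffel M c (chart_map c y) u u)" (is ?hess)
proof -
  define d where "d = pref_chart M y"
  have yp: "y \<in> points M" using chart_dom_points[OF c(1)] c(2) by blast
  have d: "d \<in> atlas M" "y \<in> chart_dom d" using pref[OF yp] by (auto simp: d_def)
  let ?N = "chart_map c ` (chart_dom c \<inter> chart_dom d)" and ?t = "transition c d"
  let ?\<psi>d = "\<lambda>p. \<phi> (chart_inv d p)" and ?\<psi>c = "\<lambda>p. \<phi> (chart_inv c p)"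
  let ?T = "transition_deriv c d y"
  have y: "chart_map c y \<in> ?N" using c d by blast
  have ty: "?t (chart_map c y) = chart_map d y" using c by simp
  have C2: "C2_at (?t (chart_map c y)) ?\<psi>d" unfolding ty by (rule C2_near_chart[OF \<phi> d])
  have eq: "?\<psi>d (?t q) = ?\<psi>c q" if "q \<in> ?N" for q using that c d by auto
  note comp = C2_at_compose[OF overlap(1)[OF c(1) d(1)] y overlap(2)[OF c(1) d(1)] C2]
  have 1: "D ?\<psi>c (chart_map c y) u = D ?\<psi>d (chart_map d y) (?T u)" for u
  proof -
    have "D ?\<psi>c (chart_map c y) u = D (\<lambda>q. ?\<psi>d (?t q)) (chart_map c y) u"
      by (rule fun_cong[OF D_cong_open[OF overlap(1)[OF c(1) d(1)] y]]) (rule eq[symmetric])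
    also have "\<dots> = D ?\<psi>d (?t (chart_map c y)) (D ?t (chart_map c y) u)"
      by (rule comp(2))
    finally show ?thesis by (simp only: ty transition_deriv_def)
  qed
  have 2: "D2 ?\<psi>c (chart_map c y) u u =
      D2 ?\<psi>d (chart_map d y) (?T u) (?T u) + D ?\<psi>d (chart_map d y) (D2 ?t (chart_map c y) u u)"
    for u
  proof -
    have "D2 ?\<psi>c (chart_map c y) u u = D2 (\<lambda>q. ?\<psi>d (?t q)) (chart_map c y) u u"
      by (rule D2_cong_open[OF overlap(1)[OF c(1) d(1)] y]) (rule eq[symmetric])
    also have "\<dots> = D2 ?\<psi>d (?t (chart_map c y)) (D ?t (chart_map c y) u) (D ?t (chart_map c y) u)
        + D ?\<psi>d (?t (chart_map c y)) (D2 ?t (chart_map c y) u u)"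
      by (rule comp(3))
    finally show ?thesis by (simp only: ty transition_deriv_def)
  qed
  show ?diff using 1 by (simp add: differential_def d_def Let_def)
  have "linear (D ?\<psi>d (chart_map d y))"
    using linear_D[OF C2_at_differentiable(1)[OF C2]] ty by simp
  then show ?hess
    unfolding 1 2 christoffel_change[OF c(1) d(1) c(2) d(2)]
    by (simp add: hessian_def d_def[symmetric] Let_def linear_add)
qed

lemma subjet_touches:
  assumes "y \<in> points M"
  shows "subjet M f y = {(differential M \<phi> y, hessian M \<phi> y) | \<phi>. C2_near M y \<phi> \<and> touches_at f \<phi> y}"
proof -
  have "(\<forall>\<^sub>F z in at y within points M. f y - ereal (\<phi> y) \<le> f z - ereal (\<phi> z)) \<longleftrightarrow> touches_at f \<phi> y" for \<phi>
  proof
    assume "\<forall>\<^sub>F z in at y within points M. f y - ereal (\<phi> y) \<le> f z - ereal (\<phi> z)"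
    then obtain N where "open N" "y \<in> N"
      "\<forall>z\<in>N. z \<noteq> y \<longrightarrow> z \<in> points M \<longrightarrow> f y - ereal (\<phi> y) \<le> f z - ereal (\<phi> z)"
      unfolding eventually_at_topological by blast
    then show "touches_at f \<phi> y"
      unfolding touches_at_def using open_points assms
      by (intro exI[of _ "N \<inter> points M"]) auto
  next
    assume "touches_at f \<phi> y"
    then show "\<forall>\<^sub>F z in at y within points M. f y - ereal (\<phi> y) \<le> f z - ereal (\<phi> z)"
      unfolding touches_at_def eventually_at_topological by blast
  qed
  then show ?thesis by (simp add: subjet_def)
qed

text \<open>
  The field with constant coordinates \<open>u\<close> in the chart \<open>c\<close>. Testing jets on these fields yields the
  convergence of their coordinate expressions.
\<close>

lemma constant_field_smooth:
  assumes c: "c \<in> atlas M"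
  shows "smooth_vector_field M (chart_dom c) (\<lambda>y. transition_deriv c (pref_chart M y) y u)"
proof -
  have "Ck_on k (chart_map d ` (chart_dom c \<inter> chart_dom d)) (\<lambda>p. let y = chart_inv d p in
      transition_deriv (pref_chart M y) d y (transition_deriv c (pref_chart M y) y u))"
    if d: "d \<in> atlas M" for d k
  proof -
    have o: "open (chart_map d ` (chart_dom c \<inter> chart_dom d))"
      by (rule open_chart_image[OF d chart(1)[OF c]])
    show ?thesis
    proof (rule Ck_on_cong[OF o])
      show "Ck_on k (chart_map d ` (chart_dom c \<inter> chart_dom d)) (\<lambda>p. D (transition c d) (transition d c p) u)"
      proof (rule Ck_on_compose[OF o _ _ Ck_on_D[OF overlap(2)[OF c d]]])
        show "Ck_on k (chart_map d ` (chart_dom c \<inter> chart_dom d)) (transition d c)"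
          using overlap(2)[OF d c] by (simp add: Int_commute)
        show "transition d c ` chart_map d ` (chart_dom c \<inter> chart_dom d)
            \<subseteq> chart_map c ` (chart_dom c \<inter> chart_dom d)" using d by auto
      qed
      fix p assume "p \<in> chart_map d ` (chart_dom c \<inter> chart_dom d)"
      then obtain y where y: "y \<in> chart_dom c" "y \<in> chart_dom d" "p = chart_map d y" by blast
      have yp: "y \<in> points M" using chart_dom_points[OF c] y by blast
      show "D (transition c d) (transition d c p) u = (let y = chart_inv d p in
         transition_deriv (pref_chart M y) d y (transition_deriv c (pref_chart M y) y u))"
        using transition_deriv_chain[OF c pref(1)[OF yp] d y(1) pref(2)[OF yp] y(2), of u] y d
        by (simp add: transition_deriv_def)
    qed
  qed
  then show ?thesis
    using chart(1)[OF c] chart_dom_points[OF c] by (simp add: smooth_vector_field_def smooth_on_def)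
qed

text \<open>
  The left-hand side tests jets on all smooth vector fields. Fields with constant coordinates in the
  chart \<open>c\<close> already give convergence of the coordinate jets. Conversely, the coordinates of any smooth field at
  the moving points converge, so pointwise convergence of the coordinate jets suffices. The
  Christoffel term converges by continuity of \<open>\<Gamma>\<close> and convergence of the first derivatives.
\<close>

lemma limiting_subjet_chart:
  assumes x: "x \<in> points M" and c_def: "c = pref_chart M x"
  shows "(\<zeta>, A) \<in> limiting_subjet M f x \<longleftrightarrow> linear \<zeta> \<and> symmetric_bilinear A \<and>
    coordinate_limiting_jet (\<lambda>p. f (chart_inv c p)) (chart_map c x) \<zeta>
      (\<lambda>u. A u u + \<zeta> (christoffel M c (chart_map c x) u u))"
    (is "?lhs \<longleftrightarrow> ?rhs")
proof -
  have c: "c \<in> atlas M" "x \<in> chart_dom c" using pref[OF x] by (auto simp: c_def)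
  define p where "p = chart_map c x"
  have p: "p \<in> chart_img c" "chart_inv c p = x" using c by (auto simp: p_def)
  interpret g: coordinate_metric "chart_img c" "coord_metric M c" by (rule coordinate_metric[OF c(1)])
  define \<Gamma> where "\<Gamma> = christoffel M c"
  have \<Gamma>: "\<Gamma> = g.\<Gamma>" by (simp add: \<Gamma>_def christoffel_eq)
  have pref_x: "transition_deriv c (pref_chart M x) x u = u" "transition_deriv (pref_chart M x) c x u = u" for u
    using transition_deriv_self[OF c] by (simp_all add: c_def)
  show ?thesis unfolding p_def[symmetric] \<Gamma>_def[symmetric]
  proof
    assume ?lhs
    then obtain X Z B where zA: "linear \<zeta>" "symmetric_bilinear A"
      and X: "\<And>n. X n \<in> points M" "\<And>n. (Z n, B n) \<in> subjet M f (X n)" "(\<lambda>n. f (X n)) \<longlonglongrightarrow> f x"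
      and jt: "jet_tendsto M X Z B x \<zeta> A"
      unfolding limiting_subjet_def by blast
    have "\<exists>\<phi>. Z n = differential M \<phi> (X n) \<and> B n = hessian M \<phi> (X n) \<and>
        C2_near M (X n) \<phi> \<and> touches_at f \<phi> (X n)" for n
      using X(2)[of n] unfolding subjet_touches[OF X(1)] by blast
    then obtain \<Phi> where \<Phi>: "\<And>n. Z n = differential M (\<Phi> n) (X n)" "\<And>n. B n = hessian M (\<Phi> n) (X n)"
      "\<And>n. C2_near M (X n) (\<Phi> n)" "\<And>n. touches_at f (\<Phi> n) (X n)"
      by metis
    have Xlim: "X \<longlonglongrightarrow> x" using jt by (simp add: jet_tendsto_def)
    have ev: "\<forall>\<^sub>F n in sequentially. X n \<in> chart_dom c"
      by (rule topological_tendstoD[OF Xlim chart(1)[OF c(1)] c(2)])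
    obtain k where k: "\<And>n. n \<ge> k \<Longrightarrow> X n \<in> chart_dom c" using ev unfolding eventually_sequentially by blast
    define Y where "Y n = X (n + k)" for n
    define \<phi> where "\<phi> n = \<Phi> (n + k)" for n
    define P where "P n = chart_map c (Y n)" for n
    define \<Psi> where "\<Psi> n = (\<lambda>q. \<phi> n (chart_inv c q))" for n
    have Y: "Y n \<in> chart_dom c" for n by (simp add: Y_def k)
    have invP: "chart_inv c (P n) = Y n" "P n \<in> chart_img c" for n using c Y by (auto simp: P_def)
    have Ylim: "Y \<longlonglongrightarrow> x" unfolding Y_def by (rule LIMSEQ_ignore_initial_segment[OF Xlim])
    have Plim: "P \<longlonglongrightarrow> p"
      unfolding P_def p_def
      by (rule continuous_on_tendsto_compose[OF continuous_chart_map[OF c(1)] Ylim c(2)]) (simp add: Y)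
    let ?V = "\<lambda>u y. transition_deriv c (pref_chart M y) y u"
    have jets: "(\<lambda>n. Z n (?V u (X n))) \<longlonglongrightarrow> \<zeta> u" "(\<lambda>n. B n (?V u (X n)) (?V u (X n))) \<longlonglongrightarrow> A u u" for u
      using jt[unfolded jet_tendsto_def, THEN conjunct2, THEN spec, THEN spec, THEN mp,
          OF conjI[OF c(2) constant_field_smooth[OF c(1), of u]]]
      by (simp_all only: pref_x(1))
    have C2Y: "C2_near M (Y n) (\<phi> n)" for n by (simp add: \<phi>_def Y_def \<Phi>)
    have 1: "(\<lambda>n. D (\<Psi> n) (P n) u) \<longlonglongrightarrow> \<zeta> u" for u
      using LIMSEQ_ignore_initial_segment[OF jets(1)[of u], of k]
      unfolding \<Phi>(1) Y_def[symmetric] \<phi>_def[symmetric] differential_chart(1)[OF c(1) Y C2Y]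
        P_def[symmetric] \<Psi>_def[symmetric] .
    have 2: "(\<lambda>n. D2 (\<Psi> n) (P n) u u - D (\<Psi> n) (P n) (\<Gamma> (P n) u u)) \<longlonglongrightarrow> A u u" for u
      using LIMSEQ_ignore_initial_segment[OF jets(2)[of u], of k]
      unfolding \<Phi>(2) Y_def[symmetric] \<phi>_def[symmetric] differential_chart(2)[OF c(1) Y C2Y]
        P_def[symmetric] \<Psi>_def[symmetric] \<Gamma>_def[symmetric] .
    have C2: "C2_at (P n) (\<Psi> n)" for n
      unfolding P_def \<Psi>_def by (rule C2_near_chart[OF C2Y c(1) Y])
    have 3: "(\<lambda>n. D (\<Psi> n) (P n) (\<Gamma> (P n) u u)) \<longlonglongrightarrow> \<zeta> (\<Gamma> p u u)" for u
      by (rule linear_tendsto[OF linear_D[OF C2_at_differentiable(1)[OF C2]] 1])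
        (unfold \<Gamma>, rule g.\<Gamma>_tendsto[OF p(1) Plim])
    have "coordinate_limiting_jet (\<lambda>p. f (chart_inv c p)) p \<zeta> (\<lambda>u. A u u + \<zeta> (\<Gamma> p u u))"
    proof (rule coordinate_limiting_jetI_eventually[OF Plim _ _ 1])
      show "(\<lambda>n. f (chart_inv c (P n))) \<longlonglongrightarrow> f (chart_inv c p)"
        using LIMSEQ_ignore_initial_segment[OF X(3), of k] by (simp add: invP p Y_def)
      have "touches_at (\<lambda>p. f (chart_inv c p)) (\<Psi> n) (P n)" for n
        unfolding \<Psi>_def
        by (rule touches_at_compose[OF chart(2)[OF c(1)] invP(2) continuous_chart_inv[OF c(1)]])
          (simp add: invP(1) \<Phi>(4) \<phi>_def Y_def)
      then show "\<forall>\<^sub>F n in sequentially. C2_at (P n) (\<Psi> n) \<and> touches_at (\<lambda>p. f (chart_inv c p)) (\<Psi> n) (P n)"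
        by (simp add: C2)
      show "(\<lambda>n. D2 (\<Psi> n) (P n) u u) \<longlonglongrightarrow> A u u + \<zeta> (\<Gamma> p u u)" for u
        using tendsto_add[OF 2[of u] 3[of u]] by simp
    qed
    then show "linear \<zeta> \<and> symmetric_bilinear A \<and>
      coordinate_limiting_jet (\<lambda>p. f (chart_inv c p)) p \<zeta> (\<lambda>u. A u u + \<zeta> (\<Gamma> p u u))" using zA by blast
  next
    assume r: "linear \<zeta> \<and> symmetric_bilinear A \<and>
      coordinate_limiting_jet (\<lambda>p. f (chart_inv c p)) p \<zeta> (\<lambda>u. A u u + \<zeta> (\<Gamma> p u u))"
    then obtain P0 \<Psi>0 where P0: "P0 \<longlonglongrightarrow> p" "(\<lambda>n. f (chart_inv c (P0 n))) \<longlonglongrightarrow> f (chart_inv c p)"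
      "\<And>n. C2_at (P0 n) (\<Psi>0 n) \<and> touches_at (\<lambda>p. f (chart_inv c p)) (\<Psi>0 n) (P0 n)"
      "\<And>u. (\<lambda>n. D (\<Psi>0 n) (P0 n) u) \<longlonglongrightarrow> \<zeta> u"
      "\<And>u. (\<lambda>n. D2 (\<Psi>0 n) (P0 n) u u) \<longlonglongrightarrow> A u u + \<zeta> (\<Gamma> p u u)"
      unfolding coordinate_limiting_jet_def by blast
    obtain k where k: "\<And>n. n \<ge> k \<Longrightarrow> P0 n \<in> chart_img c"
      using eventually_in_open[OF P0(1) chart(2)[OF c(1)] p(1)] unfolding eventually_sequentially by blast
    note sh = LIMSEQ_ignore_initial_segment[where k = k]
    define P where "P n = P0 (n + k)" for n
    define \<Psi> where "\<Psi> n = \<Psi>0 (n + k)" for n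
    have P: "P \<longlonglongrightarrow> p" "(\<lambda>n. f (chart_inv c (P n))) \<longlonglongrightarrow> f (chart_inv c p)"
      "\<And>n. C2_at (P n) (\<Psi> n)" "\<And>n. touches_at (\<lambda>p. f (chart_inv c p)) (\<Psi> n) (P n)" "\<And>n. P n \<in> chart_img c"
      "\<And>u. (\<lambda>n. D (\<Psi> n) (P n) u) \<longlonglongrightarrow> \<zeta> u"
      "\<And>u. (\<lambda>n. D2 (\<Psi> n) (P n) u u) \<longlonglongrightarrow> A u u + \<zeta> (\<Gamma> p u u)"
      using P0(3) k P0(1,2,4,5)[THEN sh] by (auto simp: P_def[abs_def] \<Psi>_def)
    define X where "X n = chart_inv c (P n)" for n
    define \<phi> where "\<phi> n = (\<lambda>z. \<Psi> n (chart_map c z))" for n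
    have X: "X n \<in> chart_dom c" "chart_map c (X n) = P n" "X n \<in> points M" for n
      using P(5)[of n] c(1) chart_inv_dom[OF c(1)] chart_dom_points[OF c(1)] by (auto simp: X_def)
    have Xlim: "X \<longlonglongrightarrow> x"
      unfolding X_def p(2)[symmetric]
      by (rule continuous_on_tendsto_compose[OF continuous_chart_inv[OF c(1)] P(1) p(1)]) (simp add: P(5))
    have C2X: "C2_near M (X n) (\<phi> n)" for n
      unfolding \<phi>_def by (rule C2_near_of_chart[OF c(1) X(1)]) (simp add: X(2) P(3))
    have "touches_at (\<lambda>z. f (chart_inv c (chart_map c z))) (\<phi> n) (X n)" for n
      unfolding \<phi>_def
      by (rule touches_at_compose[OF chart(1)[OF c(1)] X(1) continuous_chart_map[OF c(1)]])
        (simp add: X(2) P(4))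
    then have touch: "touches_at f (\<phi> n) (X n)" for n
      by (rule touches_at_cong[OF chart(1)[OF c(1)] X(1), rotated]) (simp add: c)
    have eq: "\<phi> n (chart_inv c q) = \<Psi> n q" if "q \<in> chart_img c" for n q
      using that c by (simp add: \<phi>_def)
    have same_D: "D (\<lambda>q. \<phi> n (chart_inv c q)) (P n) u = D (\<Psi> n) (P n) u" for n u
      by (rule fun_cong[OF D_cong_open[OF chart(2)[OF c(1)] P(5) eq]])
    have same_D2: "D2 (\<lambda>q. \<phi> n (chart_inv c q)) (P n) u u = D2 (\<Psi> n) (P n) u u" for n u
      by (rule D2_cong_open[OF chart(2)[OF c(1)] P(5) eq])
    note dc = differential_chart[OF c(1) X(1) C2X, unfolded X(2) same_D same_D2]
    have "jet_tendsto M X (\<lambda>n. differential M (\<phi> n) (X n)) (\<lambda>n. hessian M (\<phi> n) (X n)) x \<zeta> A"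
      unfolding jet_tendsto_def
    proof (intro conjI allI impI)
      show "X \<longlonglongrightarrow> x" by fact
      fix W V assume WV: "x \<in> W \<and> smooth_vector_field M W V"
      then have W: "open W" and V: "smooth_on (chart_map c ` (W \<inter> chart_dom c))
          (\<lambda>p. let y = chart_inv c p in transition_deriv (pref_chart M y) c y (V y))"
        using c(1) by (auto simp: smooth_vector_field_def)
      let ?v = "\<lambda>p. let y = chart_inv c p in transition_deriv (pref_chart M y) c y (V y)"
      \<comment> \<open>the coordinates of the field in the fixed chart converge, although its values, which refer
        to the preferred charts at \<open>X n\<close>, need not\<close>
      define v where "v n = transition_deriv (pref_chart M (X n)) c (X n) (V (X n))" for n
      have pW: "p \<in> chart_map c ` (W \<inter> chart_dom c)" using WV c(2) by (auto simp: p_def)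
      have "continuous_on (chart_map c ` (W \<inter> chart_dom c)) ?v"
        using V Ck_on_continuous[of 0] unfolding smooth_on_def by blast
      then have "(\<lambda>n. ?v (P n)) \<longlonglongrightarrow> ?v p"
        by (rule continuous_on_tendsto_compose[OF _ P(1) pW])
          (rule eventually_in_open[OF P(1) open_chart_image[OF c(1) W] pW])
      then have v: "v \<longlonglongrightarrow> V x" by (simp add: v_def[abs_def] X_def p(2) pref_x(2) Let_def)
      have Vv: "V (X n) = transition_deriv c (pref_chart M (X n)) (X n) (v n)" for n
        unfolding v_def
        by (rule transition_deriv_inverse[OF pref(1)[OF X(3)] c(1) pref(2)[OF X(3)] X(1), symmetric])
      have lin: "linear (D (\<Psi> n) (P n))" for n by (rule linear_D[OF C2_at_differentiable(1)[OF P(3)]])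
      show "(\<lambda>n. differential M (\<phi> n) (X n) (V (X n))) \<longlonglongrightarrow> \<zeta> (V x)"
        unfolding Vv dc(1) by (rule linear_tendsto[OF lin P(6) v])
      have "(\<lambda>n. \<Gamma> (P n) (v n) (v n)) \<longlonglongrightarrow> \<Gamma> p (V x) (V x)"
        unfolding \<Gamma>
        by (rule quadratic_tendsto[OF g.\<Gamma>_bilinear[OF P(5)] g.\<Gamma>_tendsto[OF p(1) P(1)] v])
      from linear_tendsto[OF lin P(6) this]
      have "(\<lambda>n. D2 (\<Psi> n) (P n) (v n) (v n) - D (\<Psi> n) (P n) (\<Gamma> (P n) (v n) (v n)))
          \<longlonglongrightarrow> (A (V x) (V x) + \<zeta> (\<Gamma> p (V x) (V x))) - \<zeta> (\<Gamma> p (V x) (V x))"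
        by (intro tendsto_diff quadratic_tendsto[OF C2_at_bilinear[OF P(3)] P(7) v])
      then show "(\<lambda>n. hessian M (\<phi> n) (X n) (V (X n)) (V (X n))) \<longlonglongrightarrow> A (V x) (V x)"
        unfolding Vv dc(2) \<Gamma>_def[symmetric] by simp
    qed
    moreover have "(differential M (\<phi> n) (X n), hessian M (\<phi> n) (X n)) \<in> subjet M f (X n)" for n
      unfolding subjet_touches[OF X(3)] using C2X touch by blast
    moreover have "(\<lambda>n. f (X n)) \<longlonglongrightarrow> f x" using P(2) by (simp add: X_def p(2))
    ultimately show ?lhs
      unfolding limiting_subjet_def using r X(3)
      by (intro CollectI case_prodI conjI exI[of _ X]
          exI[of _ "\<lambda>n. differential M (\<phi> n) (X n)"] exI[of _ "\<lambda>n. hessian M (\<phi> n) (X n)"]) auto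
  qed
qed

end

section \<open>Uniqueness of geodesics\<close>

text \<open>
  Gronwall's argument for the energy \<open>E = |a1 - a2|\<^sup>2 + |d1 - d2|\<^sup>2\<close>: the Lipschitz bound gives
  \<open>E' \<le> (1 + 3 L) E\<close>, so \<open>E\<close> times \<open>exp (- (1 + 3 L) s)\<close> does not increase. It is zero at the start.
\<close>

lemma second_order_ode_unique:
  fixes a1 a2 d1 d2 :: "real \<Rightarrow> 'e::euclidean_space"
  assumes L: "L \<ge> 0" "\<And>q q' u w. (q, u) \<in> K \<Longrightarrow> (q', w) \<in> K \<Longrightarrow>
      norm (F q u - F q' w) \<le> L * (norm (q - q') + norm (u - w))"
    and cont: "continuous_on {a..b} a1" "continuous_on {a..b} a2"
      "continuous_on {a..b} d1" "continuous_on {a..b} d2"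
    and der: "\<And>t. a < t \<Longrightarrow> t < b \<Longrightarrow> (a1 has_vector_derivative d1 t) (at t)"
      "\<And>t. a < t \<Longrightarrow> t < b \<Longrightarrow> (a2 has_vector_derivative d2 t) (at t)"
      "\<And>t. a < t \<Longrightarrow> t < b \<Longrightarrow> (d1 has_vector_derivative F (a1 t) (d1 t)) (at t)"
      "\<And>t. a < t \<Longrightarrow> t < b \<Longrightarrow> (d2 has_vector_derivative F (a2 t) (d2 t)) (at t)"
    and K: "\<And>t. a < t \<Longrightarrow> t < b \<Longrightarrow> (a1 t, d1 t) \<in> K \<and> (a2 t, d2 t) \<in> K"
    and init: "a1 a = a2 a" "d1 a = d2 a"
    and t: "a \<le> t" "t \<le> b"
  shows "a1 t = a2 t"
proof -
  define C where "C = 1 + 3 * L"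
  define \<alpha> where "\<alpha> s = a1 s - a2 s" for s
  define \<delta> where "\<delta> s = d1 s - d2 s" for s
  define E where "E s = \<alpha> s \<bullet> \<alpha> s + \<delta> s \<bullet> \<delta> s" for s
  define H where "H s = E s * exp (- C * s)" for s
  have "H a \<ge> H t"
  proof (rule DERIV_nonpos_imp_decreasing_open[OF t(1)])
    fix s assume "a < s" "s < t"
    then have s: "a < s" "s < b" using t by auto
    define \<phi> where "\<phi> = F (a1 s) (d1 s) - F (a2 s) (d2 s)"
    have 1: "(\<alpha> has_vector_derivative \<delta> s) (at s)" "(\<delta> has_vector_derivative \<phi>) (at s)"
      unfolding \<alpha>_def \<delta>_def \<phi>_def by (intro has_vector_derivative_diff der s)+
    have E: "(E has_real_derivative 2 * (\<alpha> s \<bullet> \<delta> s) + 2 * (\<delta> s \<bullet> \<phi>)) (at s)"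
      unfolding E_def has_field_derivative_def
      by (rule has_derivative_eq_rhs[OF has_derivative_add[OF
            has_derivative_inner[OF 1(1)[unfolded has_vector_derivative_def] 1(1)[unfolded has_vector_derivative_def]]
            has_derivative_inner[OF 1(2)[unfolded has_vector_derivative_def] 1(2)[unfolded has_vector_derivative_def]]]])
        (auto simp: fun_eq_iff inner_commute algebra_simps)
    have H: "(H has_real_derivative (2 * (\<alpha> s \<bullet> \<delta> s) + 2 * (\<delta> s \<bullet> \<phi>) - C * E s) * exp (- C * s)) (at s)"
      unfolding H_def by (rule derivative_eq_intros E refl | simp add: algebra_simps)+
    have "norm \<phi> \<le> L * (norm (\<alpha> s) + norm (\<delta> s))"
      unfolding \<phi>_def \<alpha>_def \<delta>_def using L(2) K[OF s] by blast
    then have "norm (\<delta> s) * norm \<phi> \<le> norm (\<delta> s) * (L * (norm (\<alpha> s) + norm (\<delta> s)))"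
      by (rule mult_left_mono) simp
    then have "\<delta> s \<bullet> \<phi> \<le> L * (norm (\<delta> s) * norm (\<alpha> s)) + L * (norm (\<delta> s))\<^sup>2"
      using norm_cauchy_schwarz[of "\<delta> s" \<phi>] by (simp add: algebra_simps power2_eq_square)
    moreover have am: "2 * (norm (\<alpha> s) * norm (\<delta> s)) \<le> E s"
      using sum_squares_bound[of "norm (\<alpha> s)" "norm (\<delta> s)"]
      by (simp add: E_def power2_norm_eq_inner mult.assoc)
    moreover have "(norm (\<delta> s))\<^sup>2 \<le> E s" by (simp add: E_def power2_norm_eq_inner)
    moreover have "\<alpha> s \<bullet> \<delta> s \<le> norm (\<alpha> s) * norm (\<delta> s)" by (rule norm_cauchy_schwarz)
    moreover have "L * (2 * (norm (\<alpha> s) * norm (\<delta> s))) \<le> L * E s" "L * (norm (\<delta> s))\<^sup>2 \<le> L * E s"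
      using calculation L(1) by (intro mult_left_mono; simp)+
    ultimately have "2 * (\<alpha> s \<bullet> \<delta> s) + 2 * (\<delta> s \<bullet> \<phi>) - C * E s \<le> 0"
      by (simp add: C_def algebra_simps)
    then have "(2 * (\<alpha> s \<bullet> \<delta> s) + 2 * (\<delta> s \<bullet> \<phi>) - C * E s) * exp (- C * s) \<le> 0"
      by (rule mult_nonpos_nonneg) simp
    with H show "\<exists>y. (H has_real_derivative y) (at s) \<and> y \<le> 0" by blast
  next
    show "continuous_on {a..t} H"
      unfolding H_def E_def \<alpha>_def \<delta>_def
      using t by (intro continuous_intros continuous_on_subset[OF cont(1)] continuous_on_subset[OF cont(2)]
          continuous_on_subset[OF cont(3)] continuous_on_subset[OF cont(4)]) auto
  qed
  moreover have "H a = 0" by (simp add: H_def E_def \<alpha>_def \<delta>_def init)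
  ultimately have "E t * exp (- C * t) \<le> 0" by (simp add: H_def)
  then have "E t \<le> 0" by (simp add: mult_le_0_iff not_le)
  then have "\<alpha> t \<bullet> \<alpha> t \<le> 0" using inner_ge_zero[of "\<delta> t"] unfolding E_def by linarith
  then have "\<alpha> t = 0" using inner_gt_zero_iff[of "\<alpha> t"] by linarith
  then show ?thesis by (simp add: \<alpha>_def)
qed

text \<open>
  The right-hand side of the geodesic equation is quadratic in the velocity, so it is Lipschitz only for
  bounded velocities.
\<close>

lemma (in coordinate_metric) \<Gamma>_quadratic_Lipschitz:
  assumes p: "p \<in> S" and R: "R \<ge> 0"
  shows "\<exists>r>0. \<exists>L\<ge>0. cball p r \<subseteq> S \<and> (\<forall>q\<in>cball p r. \<forall>q'\<in>cball p r. \<forall>u w.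
    norm u \<le> R \<longrightarrow> norm w \<le> R \<longrightarrow> norm (\<Gamma> q u u - \<Gamma> q' w w) \<le> L * (norm (q - q') + norm (u - w)))"
proof -
  obtain r L0 where r: "r > 0" "L0 \<ge> 0" "cball p r \<subseteq> S"
    "\<And>q q' u w. q \<in> cball p r \<Longrightarrow> q' \<in> cball p r \<Longrightarrow>
      norm (\<Gamma> q u w - \<Gamma> q' u w) \<le> L0 * norm (q - q') * norm u * norm w"
    using \<Gamma>_locally_Lipschitz[OF p] by blast
  define B where "B = L0 * r + (\<Sum>i\<in>Basis. \<Sum>j\<in>Basis. norm (\<Gamma> p i j))"
  have B0: "B \<ge> 0" using r by (simp add: B_def sum_nonneg)
  have bound: "norm (\<Gamma> q a b) \<le> B * norm a * norm b" if q: "q \<in> cball p r" for q a b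
  proof -
    have "norm (\<Gamma> q a b) \<le> norm (\<Gamma> q a b - \<Gamma> p a b) + norm (\<Gamma> p a b)"
      by (metis diff_add_cancel norm_triangle_ineq)
    also have "\<dots> \<le> L0 * r * norm a * norm b + norm a * norm b * (\<Sum>i\<in>Basis. \<Sum>j\<in>Basis. norm (\<Gamma> p i j))"
    proof (rule add_mono)
      have "norm (\<Gamma> q a b - \<Gamma> p a b) \<le> L0 * norm (q - p) * norm a * norm b"
        by (rule r(4)[OF q]) (use r(1) in simp)
      also have "\<dots> \<le> L0 * r * norm a * norm b"
        using q r(2) by (intro mult_right_mono mult_left_mono) (auto simp: dist_norm norm_minus_commute)
      finally show "norm (\<Gamma> q a b - \<Gamma> p a b) \<le> L0 * r * norm a * norm b" .
    qed (rule bilinear_norm_bound[OF \<Gamma>_bilinear[OF p]])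
    also have "\<dots> = B * norm a * norm b" by (simp add: B_def algebra_simps)
    finally show ?thesis .
  qed
  have "norm (\<Gamma> q u u - \<Gamma> q' w w) \<le> (L0 * R * R + 2 * B * R) * (norm (q - q') + norm (u - w))"
    if q: "q \<in> cball p r" "q' \<in> cball p r" and uw: "norm u \<le> R" "norm w \<le> R" for q q' u w
  proof -
    have q'S: "q' \<in> S" using q r(3) by blast
    have lin: "linear (\<lambda>a. \<Gamma> q' a b)" "linear (\<Gamma> q' b)" for b
      using \<Gamma>_bilinear[OF q'S] by (auto simp: bilinear_def)
    have split: "\<Gamma> q u u - \<Gamma> q' w w = (\<Gamma> q u u - \<Gamma> q' u u) + \<Gamma> q' (u - w) u + \<Gamma> q' w (u - w)"
      by (simp add: linear_diff[OF lin(1)] linear_diff[OF lin(2)])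
    have "norm (\<Gamma> q u u - \<Gamma> q' w w) \<le>
        norm (\<Gamma> q u u - \<Gamma> q' u u) + norm (\<Gamma> q' (u - w) u) + norm (\<Gamma> q' w (u - w))"
      unfolding split by (rule order_trans[OF norm_triangle_ineq add_right_mono[OF norm_triangle_ineq]])
    also have "\<dots> \<le> L0 * norm (q - q') * norm u * norm u + B * norm (u - w) * norm u + B * norm w * norm (u - w)"
      by (intro add_mono r(4) bound q)
    also have "\<dots> \<le> L0 * norm (q - q') * R * R + B * norm (u - w) * R + B * R * norm (u - w)"
      using uw r(2) B0 R by (intro add_mono mult_mono) auto
    also have "\<dots> \<le> (L0 * R * R + 2 * B * R) * (norm (q - q') + norm (u - w))"
      using R r(2) B0 by (simp add: algebra_simps)
    finally show ?thesis .
  qed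
  moreover have "L0 * R * R + 2 * B * R \<ge> 0" using R r(2) B0 by simp
  ultimately show ?thesis using r(1,3) by blast
qed

text \<open>
  The interval may lie on one side of \<open>t\<close>: this is how velocities at time 0 and at the end of the interval
  of known agreement are compared.
\<close>

lemma vector_derivative_eq_on_interval:
  fixes f g :: "real \<Rightarrow> 'a::real_normed_vector"
  assumes "a < b" "t \<in> {a..b}" "{a..b} \<subseteq> I"
    and "(f has_vector_derivative f') (at t within I)" "(g has_vector_derivative g') (at t within I)"
    and "\<And>s. s \<in> {a..b} \<Longrightarrow> f s = g s"
  shows "f' = g'"
proof -
  have f: "(f has_vector_derivative f') (at t within {a..b})"
    using has_vector_derivative_within_subset[OF assms(4,3)] .
  have "(g has_vector_derivative g') (at t within {a..b})"
    using has_vector_derivative_within_subset[OF assms(5,3)] .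
  then have g: "(f has_vector_derivative g') (at t within {a..b})"
    by (rule has_vector_derivative_transform[OF assms(2), rotated]) (simp add: assms(6))
  show ?thesis
    using vector_derivative_unique_within_closed_interval[of a b t f f' g'] f g assms(1,2) by simp
qed

context riemannian
begin

lemma geodesic_velocity:
  assumes "geodesic M I \<gamma>" "c \<in> atlas M"
  obtains d where "\<And>t. t \<in> I \<Longrightarrow> \<gamma> t \<in> chart_dom c \<Longrightarrow>
      ((\<lambda>s. chart_map c (\<gamma> s)) has_vector_derivative d t) (at t within I)"
    "\<And>t. t \<in> I \<Longrightarrow> \<gamma> t \<in> chart_dom c \<Longrightarrow>
      (d has_vector_derivative - christoffel M c (chart_map c (\<gamma> t)) (d t) (d t)) (at t within I)"
proof -
  have "\<forall>c\<in>atlas M. \<exists>d. \<forall>t\<in>I. \<gamma> t \<in> chart_dom c \<longrightarrow>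
        ((\<lambda>s. chart_map c (\<gamma> s)) has_vector_derivative d t) (at t within I) \<and>
        (d has_vector_derivative - christoffel M c (chart_map c (\<gamma> t)) (d t) (d t)) (at t within I)"
    using assms(1) unfolding geodesic_def by (elim conjE)
  from bspec[OF this assms(2)] obtain d where d: "\<forall>t\<in>I. \<gamma> t \<in> chart_dom c \<longrightarrow>
        ((\<lambda>s. chart_map c (\<gamma> s)) has_vector_derivative d t) (at t within I) \<and>
        (d has_vector_derivative - christoffel M c (chart_map c (\<gamma> t)) (d t) (d t)) (at t within I)" ..
  show ?thesis
    by (rule that[of d]) (use d in auto)
qed

text \<open>
  For a short time both curves stay in one chart, close to \<open>p\<close> and with bounded velocities, where the
  uniqueness theorem for the geodesic equation applies.
\<close>

lemma geodesics_agree_locally: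
  assumes g1: "geodesic M {0..1} \<gamma>1" and g2: "geodesic M {0..1} \<gamma>2"
    and t: "0 \<le> t" "t < 1" and c: "c \<in> atlas M" "\<gamma>1 t \<in> chart_dom c" and eq: "\<gamma>1 t = \<gamma>2 t"
    and vel: "((\<lambda>s. chart_map c (\<gamma>1 s)) has_vector_derivative v) (at t within {0..1})"
      "((\<lambda>s. chart_map c (\<gamma>2 s)) has_vector_derivative v) (at t within {0..1})"
  shows "\<exists>e>0. t + e \<le> 1 \<and> (\<forall>s\<in>{t..t + e}. \<gamma>1 s = \<gamma>2 s)"
proof -
  interpret g: coordinate_metric "chart_img c" "coord_metric M c" by (rule coordinate_metric[OF c(1)])
  define p where "p = chart_map c (\<gamma>1 t)"
  have p: "p \<in> chart_img c" "p = chart_map c (\<gamma>2 t)" "\<gamma>2 t \<in> chart_dom c" using c eq by (auto simp: p_def)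
  have tI: "t \<in> {0..1}" using t by simp
  obtain d1 where d1: "\<And>s. s \<in> {0..1} \<Longrightarrow> \<gamma>1 s \<in> chart_dom c \<Longrightarrow>
      ((\<lambda>s. chart_map c (\<gamma>1 s)) has_vector_derivative d1 s) (at s within {0..1})"
    "\<And>s. s \<in> {0..1} \<Longrightarrow> \<gamma>1 s \<in> chart_dom c \<Longrightarrow>
      (d1 has_vector_derivative - christoffel M c (chart_map c (\<gamma>1 s)) (d1 s) (d1 s)) (at s within {0..1})"
    using geodesic_velocity[OF g1 c(1)] by blast
  obtain d2 where d2: "\<And>s. s \<in> {0..1} \<Longrightarrow> \<gamma>2 s \<in> chart_dom c \<Longrightarrow>
      ((\<lambda>s. chart_map c (\<gamma>2 s)) has_vector_derivative d2 s) (at s within {0..1})"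
    "\<And>s. s \<in> {0..1} \<Longrightarrow> \<gamma>2 s \<in> chart_dom c \<Longrightarrow>
      (d2 has_vector_derivative - christoffel M c (chart_map c (\<gamma>2 s)) (d2 s) (d2 s)) (at s within {0..1})"
    using geodesic_velocity[OF g2 c(1)] by blast
  have dt: "d1 t = v" "d2 t = v"
    using vector_derivative_unique_within_closed_interval[of 0 1 t _ _ v] tI d1(1)[OF tI c(2)] d2(1)[OF tI p(3)] vel
    by auto
  define R where "R = norm v + 1"
  have "R \<ge> 0" by (simp add: R_def)
  from g.\<Gamma>_quadratic_Lipschitz[OF p(1) this] obtain r L where r: "r > 0" "L \<ge> 0"
    "\<And>q q' u w. q \<in> cball p r \<Longrightarrow> q' \<in> cball p r \<Longrightarrow> norm u \<le> R \<Longrightarrow> norm w \<le> R \<Longrightarrow>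
      norm (g.\<Gamma> q u u - g.\<Gamma> q' w w) \<le> L * (norm (q - q') + norm (u - w))"
    by blast
  let ?good = "\<lambda>\<gamma> d s. \<gamma> s \<in> chart_dom c \<and> chart_map c (\<gamma> s) \<in> ball p r \<and> d s \<in> ball v 1"
  have near: "\<forall>\<^sub>F s in at t within {0..1}. ?good \<gamma> d s"
    if "geodesic M {0..1} \<gamma>" "\<gamma> t \<in> chart_dom c" "p = chart_map c (\<gamma> t)" "d t = v"
      "((\<lambda>s. chart_map c (\<gamma> s)) has_vector_derivative d t) (at t within {0..1})"
      "(d has_vector_derivative d') (at t within {0..1})" for \<gamma> d d'
  proof (intro eventually_conj)
    have "continuous_on {0..1} \<gamma>" using that(1) by (simp add: geodesic_def)
    then have "(\<gamma> \<longlongrightarrow> \<gamma> t) (at t within {0..1})" using tI by (simp add: continuous_on_def)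
    then show "\<forall>\<^sub>F s in at t within {0..1}. \<gamma> s \<in> chart_dom c"
      by (rule topological_tendstoD[OF _ chart(1)[OF c(1)] that(2)])
    show "\<forall>\<^sub>F s in at t within {0..1}. chart_map c (\<gamma> s) \<in> ball p r"
      using has_vector_derivative_continuous[OF that(5)] r(1) that(3)
      by (intro topological_tendstoD[of _ "chart_map c (\<gamma> t)"]) (auto simp: continuous_within)
    show "\<forall>\<^sub>F s in at t within {0..1}. d s \<in> ball v 1"
      using has_vector_derivative_continuous[OF that(6)] that(4)
      by (intro topological_tendstoD[of _ "d t"]) (auto simp: continuous_within)
  qed
  have n1: "\<forall>\<^sub>F s in at t within {0..1}. ?good \<gamma>1 d1 s"
    by (rule near[OF g1 c(2) p_def dt(1) d1(1)[OF tI c(2)] d1(2)[OF tI c(2)]])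
  have n2: "\<forall>\<^sub>F s in at t within {0..1}. ?good \<gamma>2 d2 s"
    by (rule near[OF g2 p(3) p(2) dt(2) d2(1)[OF tI p(3)] d2(2)[OF tI p(3)]])
  from eventually_conj[OF n1 n2] obtain e0 where e0: "e0 > 0"
    "\<And>s. s \<in> {0..1} \<Longrightarrow> s \<noteq> t \<Longrightarrow> dist s t < e0 \<Longrightarrow> ?good \<gamma>1 d1 s \<and> ?good \<gamma>2 d2 s"
    unfolding eventually_at by blast
  define e where "e = min (e0 / 2) (1 - t)"
  have e: "e > 0" "t + e \<le> 1" "e < e0" using e0(1) t by (auto simp: e_def)
  have in01: "s \<in> {0..1}" if "s \<in> {t..t + e}" for s using that e t by auto
  have good: "?good \<gamma>1 d1 s" "?good \<gamma>2 d2 s" if "s \<in> {t..t + e}" for s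
  proof -
    have "?good \<gamma>1 d1 s \<and> ?good \<gamma>2 d2 s"
    proof (cases "s = t")
      case True
      then show ?thesis using c p dt r(1) by (simp add: p_def[symmetric])
    next
      case False
      show ?thesis by (rule e0(2)[OF in01[OF that] False]) (use that e in \<open>simp add: dist_real_def\<close>)
    qed
    then show "?good \<gamma>1 d1 s" "?good \<gamma>2 d2 s" by auto
  qed
  have cont: "continuous_on {t..t + e} h" if "\<And>s. s \<in> {t..t + e} \<Longrightarrow> (h has_vector_derivative h' s) (at s within {0..1})"
    for h h' :: "real \<Rightarrow> 'e"
    using that e t
    by (intro continuous_on_vector_derivative[of _ _ h'])
      (auto intro: has_vector_derivative_within_subset[of _ _ _ "{0..1}"])
  have inner: "(h has_vector_derivative h') (at s)"
    if "(h has_vector_derivative h') (at s within {0..1})" "t < s" "s < t + e" for h :: "real \<Rightarrow> 'e" and h' s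
    using that t e by (simp add: at_within_Icc_at)
  have same: "chart_map c (\<gamma>1 s) = chart_map c (\<gamma>2 s)" if s: "s \<in> {t..t + e}" for s
  proof (rule second_order_ode_unique[where F = "\<lambda>q u. - christoffel M c q u u" and
        K = "cball p r \<times> cball 0 R" and a = t and b = "t + e" and ?d1.0 = d1 and ?d2.0 = d2, OF r(2)])
    fix q q' u w :: 'e assume "(q, u) \<in> cball p r \<times> cball 0 R" "(q', w) \<in> cball p r \<times> cball 0 R"
    then have "norm (g.\<Gamma> q u u - g.\<Gamma> q' w w) \<le> L * (norm (q - q') + norm (u - w))"
      by (intro r(3)) auto
    then show "norm (- christoffel M c q u u - - christoffel M c q' w w) \<le> L * (norm (q - q') + norm (u - w))"
      by (simp add: christoffel_eq norm_minus_commute)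
  next
    fix s assume s: "t < s" "s < t + e"
    then have sI: "s \<in> {t..t + e}" by simp
    have "norm z \<le> R" if "z \<in> ball v 1" for z
    proof -
      have "norm z \<le> norm v + norm (z - v)" by (metis add_diff_cancel_left' diff_add_cancel norm_triangle_ineq add.commute)
      then show ?thesis using that by (simp add: R_def dist_norm norm_minus_commute)
    qed
    then show "(chart_map c (\<gamma>1 s), d1 s) \<in> cball p r \<times> cball 0 R \<and> (chart_map c (\<gamma>2 s), d2 s) \<in> cball p r \<times> cball 0 R"
      using good[OF sI] by (auto simp: less_imp_le)
    show "((\<lambda>s. chart_map c (\<gamma>1 s)) has_vector_derivative d1 s) (at s)"
      "((\<lambda>s. chart_map c (\<gamma>2 s)) has_vector_derivative d2 s) (at s)"
      "(d1 has_vector_derivative - christoffel M c (chart_map c (\<gamma>1 s)) (d1 s) (d1 s)) (at s)"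
      "(d2 has_vector_derivative - christoffel M c (chart_map c (\<gamma>2 s)) (d2 s) (d2 s)) (at s)"
      using good[OF sI] in01[OF sI] s by (auto intro!: inner d1 d2)
  next
    show "continuous_on {t..t + e} (\<lambda>s. chart_map c (\<gamma>1 s))"
      by (rule cont[OF d1(1)]) (use good in01 in auto)
    show "continuous_on {t..t + e} (\<lambda>s. chart_map c (\<gamma>2 s))"
      by (rule cont[OF d2(1)]) (use good in01 in auto)
    show "continuous_on {t..t + e} d1" by (rule cont[OF d1(2)]) (use good in01 in auto)
    show "continuous_on {t..t + e} d2" by (rule cont[OF d2(2)]) (use good in01 in auto)
  qed (use eq dt s in auto)
  have "\<gamma>1 s = \<gamma>2 s" if "s \<in> {t..t + e}" for s
    using same[OF that] good[OF that] c(1) by (metis chart_inv_map)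
  then show ?thesis using e by blast
qed

text \<open>
  The supremum \<open>T\<close> of the times up to which both geodesics agree is such a time, since limits in a
  Hausdorff space are unique. There the velocities agree as well: for \<open>T > 0\<close> because they are
  derivatives from the left of equal curves, for \<open>T = 0\<close> by the initial condition. If \<open>T\<close> were less
  than 1, the geodesics would agree for some longer time.
\<close>

lemma geodesic_unique:
  assumes "geodesic_from M x v \<gamma>1" "geodesic_from M x v \<gamma>2" and t01: "t \<in> {0..1}"
  shows "\<gamma>1 t = \<gamma>2 t"
proof -
  have g: "geodesic M {0..1} \<gamma>1" "geodesic M {0..1} \<gamma>2" and init: "\<gamma>1 0 = x" "\<gamma>2 0 = x"
    and vel: "((\<lambda>t. chart_map (pref_chart M x) (\<gamma>1 t)) has_vector_derivative v) (at 0 within {0..1})"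
      "((\<lambda>t. chart_map (pref_chart M x) (\<gamma>2 t)) has_vector_derivative v) (at 0 within {0..1})"
    using assms(1,2) by (auto simp: geodesic_from_def)
  have cont: "continuous_on {0..1} \<gamma>1" "continuous_on {0..1} \<gamma>2"
    using g by (auto simp: geodesic_def)
  have pts: "\<gamma>1 s \<in> points M" if "s \<in> {0..1}" for s
    using g(1) that unfolding geodesic_def by blast
  define E where "E = {t \<in> {0..1}. \<forall>s\<in>{0..t}. \<gamma>1 s = \<gamma>2 s}"
  have E0: "0 \<in> E" using init by (simp add: E_def)
  have bdd: "bdd_above E" by (rule bdd_aboveI[of _ 1]) (simp add: E_def)
  define T where "T = Sup E"
  have T: "0 \<le> T" "T \<le> 1"
  proof -
    show "0 \<le> T" unfolding T_def by (rule cSup_upper[OF E0 bdd])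
    show "T \<le> 1" unfolding T_def by (rule cSup_least) (use E0 in blast, simp add: E_def)
  qed
  have below: "\<gamma>1 s = \<gamma>2 s" if "0 \<le> s" "s < T" for s
  proof -
    have "E \<noteq> {}" using E0 by blast
    from less_cSup_iff[OF this bdd, of s] obtain a where "a \<in> E" "s < a"
      using \<open>s < T\<close> by (auto simp only: T_def)
    then show ?thesis using that by (simp add: E_def)
  qed
  have atT: "\<gamma>1 T = \<gamma>2 T"
  proof (cases "T = 0")
    case False
    \<comment> \<open>a sequence from the left, where the curves are known to agree\<close>
    define s where "s n = T - T / real (Suc n)" for n
    have sl: "s \<longlonglongrightarrow> T"
    proof -
      have "(\<lambda>n. T - T * inverse (real (Suc n))) \<longlonglongrightarrow> T - T * 0"
        by (intro tendsto_intros LIMSEQ_inverse_real_of_nat)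
      then show ?thesis by (simp add: s_def[abs_def] divide_inverse)
    qed
    have sb: "0 \<le> s n" "s n < T" for n
      using T False by (auto simp: s_def divide_simps mult_left_mono algebra_simps)
    have "(\<lambda>n. \<gamma>1 (s n)) \<longlonglongrightarrow> \<gamma>1 T" "(\<lambda>n. \<gamma>2 (s n)) \<longlonglongrightarrow> \<gamma>2 T"
      using sb T less_imp_le[OF sb(2)] order_trans[OF less_imp_le[OF sb(2)] T(2)]
      by (auto intro!: continuous_on_tendsto_compose[OF cont(1) sl] continuous_on_tendsto_compose[OF cont(2) sl])
    then show ?thesis using below[OF sb] LIMSEQ_unique by simp
  qed (use init in simp)
  have upto: "\<gamma>1 s = \<gamma>2 s" if "s \<in> {0..T}" for s
    using that below[of s] atT by (cases "s = T") auto
  have "T = 1"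
  proof (rule ccontr)
    assume "T \<noteq> 1"
    then have T1: "T < 1" using T by simp
    have TI: "T \<in> {0..1}" using T by simp
    define c where "c = pref_chart M (\<gamma>1 T)"
    have c: "c \<in> atlas M" "\<gamma>1 T \<in> chart_dom c" "\<gamma>2 T \<in> chart_dom c"
      using pref[OF pts[OF TI]] atT by (auto simp: c_def)
    obtain w where w: "((\<lambda>s. chart_map c (\<gamma>1 s)) has_vector_derivative w) (at T within {0..1})"
      using geodesic_velocity[OF g(1) c(1)] TI c(2) by metis
    obtain w' where w': "((\<lambda>s. chart_map c (\<gamma>2 s)) has_vector_derivative w') (at T within {0..1})"
      using geodesic_velocity[OF g(2) c(1)] TI c(3) by metis
    have "w = w'"
    proof (cases "T = 0")
      case True
      then have "c = pref_chart M x" using init by (simp add: c_def)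
      then have "w = v" "w' = v"
        using vector_derivative_eq_on_interval[of 0 1 0 "{0..1}"] w w' vel True by auto
      then show ?thesis by simp
    next
      case False
      show ?thesis
        by (rule vector_derivative_eq_on_interval[of 0 T T "{0..1}", OF _ _ _ w w'])
          (use False T upto in auto)
    qed
    with w' have w': "((\<lambda>s. chart_map c (\<gamma>2 s)) has_vector_derivative w) (at T within {0..1})" by simp
    obtain e where e: "e > 0" "T + e \<le> 1" "\<And>s. s \<in> {T..T + e} \<Longrightarrow> \<gamma>1 s = \<gamma>2 s"
      using geodesics_agree_locally[OF g T(1) T1 c(1,2) atT w w'] by blast
    have "\<gamma>1 s = \<gamma>2 s" if "s \<in> {0..T + e}" for s
      using that upto[of s] e(3)[of s] by (cases "s \<le> T") auto
    then have "T + e \<in> E" using T e by (simp add: E_def)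
    then show False using cSup_upper[OF _ bdd, of "T + e"] e(1) by (simp add: T_def)
  qed
  then show ?thesis using upto t01 by simp
qed

lemma geodesic_scale:
  assumes gf: "geodesic_from M x v \<gamma>" and t: "t \<in> {0..1}"
  shows "geodesic_from M x (t *\<^sub>R v) (\<lambda>s. \<gamma> (t * s))"
proof -
  have g: "geodesic M {0..1} \<gamma>" and init: "\<gamma> 0 = x"
    and vel: "((\<lambda>t. chart_map (pref_chart M x) (\<gamma> t)) has_vector_derivative v) (at 0 within {0..1})"
    using gf by (auto simp: geodesic_from_def)
  have sub: "(\<lambda>s. t * s) ` {0..1} \<subseteq> {0..1}" using t by (auto intro: mult_le_one)
  have in01: "t * s \<in> {0..1}" if "s \<in> {0..1}" for s using sub that by blast
  have scale: "((\<lambda>s. t * s) has_vector_derivative t) (at s within {0..1})" for s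
    by (auto intro!: derivative_eq_intros)
  have chain: "((\<lambda>s. h (t * s)) has_vector_derivative t *\<^sub>R h') (at s within {0..1})"
    if "(h has_vector_derivative h') (at (t * s) within {0..1})" for h :: "real \<Rightarrow> 'e" and h' s
    using vector_diff_chain_within[OF scale has_vector_derivative_within_subset[OF that sub]]
    by (simp add: o_def)
  have "\<exists>d. \<forall>s\<in>{0..1}. \<gamma> (t * s) \<in> chart_dom c \<longrightarrow>
        ((\<lambda>s. chart_map c (\<gamma> (t * s))) has_vector_derivative d s) (at s within {0..1}) \<and>
        (d has_vector_derivative - christoffel M c (chart_map c (\<gamma> (t * s))) (d s) (d s)) (at s within {0..1})"
    if c: "c \<in> atlas M" for c
  proof -
    obtain d where d: "\<And>s. s \<in> {0..1} \<Longrightarrow> \<gamma> s \<in> chart_dom c \<Longrightarrow>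
        ((\<lambda>s. chart_map c (\<gamma> s)) has_vector_derivative d s) (at s within {0..1})"
      "\<And>s. s \<in> {0..1} \<Longrightarrow> \<gamma> s \<in> chart_dom c \<Longrightarrow>
        (d has_vector_derivative - christoffel M c (chart_map c (\<gamma> s)) (d s) (d s)) (at s within {0..1})"
      using geodesic_velocity[OF g c] by blast
    interpret g: coordinate_metric "chart_img c" "coord_metric M c" by (rule coordinate_metric[OF c])
    show ?thesis
    proof (intro exI[of _ "\<lambda>s. t *\<^sub>R d (t * s)"] ballI impI conjI)
      fix s :: real assume s: "s \<in> {0..1}" "\<gamma> (t * s) \<in> chart_dom c"
      show "((\<lambda>s. chart_map c (\<gamma> (t * s))) has_vector_derivative t *\<^sub>R d (t * s)) (at s within {0..1})"
        by (rule chain[OF d(1)[OF in01[OF s(1)] s(2)]])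
      let ?G = "christoffel M c (chart_map c (\<gamma> (t * s)))"
      have "bilinear ?G" unfolding christoffel_eq by (rule g.\<Gamma>_bilinear) (use s(2) in blast)
      then have "?G (t *\<^sub>R d (t * s)) (t *\<^sub>R d (t * s)) = t *\<^sub>R t *\<^sub>R ?G (d (t * s)) (d (t * s))"
        by (simp add: bilinear_lmul bilinear_rmul)
      then show "((\<lambda>s. t *\<^sub>R d (t * s)) has_vector_derivative
          - ?G (t *\<^sub>R d (t * s)) (t *\<^sub>R d (t * s))) (at s within {0..1})"
        using bounded_linear.has_vector_derivative[OF bounded_linear_scaleR_right chain[OF d(2)[OF in01[OF s(1)] s(2)]], of t]
        by simp
    qed
  qed
  moreover have "continuous_on {0..1} (\<lambda>s. \<gamma> (t * s))"
  proof (rule continuous_on_compose2[of "{0..1}" \<gamma> "{0..1}" "\<lambda>s. t * s"])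
    show "continuous_on {0..1} \<gamma>" using g unfolding geodesic_def by blast
    show "continuous_on {0..1} (\<lambda>s. t * s)" by (intro continuous_intros)
  qed (rule sub)
  moreover have "(\<lambda>s. \<gamma> (t * s)) ` {0..1} \<subseteq> points M"
    using g sub unfolding geodesic_def by blast
  ultimately have "geodesic M {0..1} (\<lambda>s. \<gamma> (t * s))" by (simp add: geodesic_def)
  moreover have "((\<lambda>s. chart_map (pref_chart M x) (\<gamma> (t * s))) has_vector_derivative t *\<^sub>R v) (at 0 within {0..1})"
    by (rule chain) (use vel in simp)
  ultimately show ?thesis using init by (simp add: geodesic_from_def)
qed

lemma exp_ray:
  assumes gf: "geodesic_from M x v \<gamma>" and t: "t \<in> {0..1}"
  shows "riem_exp M x (t *\<^sub>R v) = \<gamma> t"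
  unfolding riem_exp_def
proof (rule the_equality)
  show "\<exists>\<gamma>'. geodesic_from M x (t *\<^sub>R v) \<gamma>' \<and> \<gamma>' 1 = \<gamma> t"
    using geodesic_scale[OF gf t] by (intro exI[of _ "\<lambda>s. \<gamma> (t * s)"]) simp
  fix y assume "\<exists>\<gamma>'. geodesic_from M x (t *\<^sub>R v) \<gamma>' \<and> \<gamma>' 1 = y"
  then obtain \<gamma>' where "geodesic_from M x (t *\<^sub>R v) \<gamma>'" "\<gamma>' 1 = y" by blast
  then show "y = \<gamma> t" using geodesic_unique[OF _ geodesic_scale[OF gf t], of \<gamma>' 1] by simp
qed

end

section \<open>The second order Taylor expansion of the exponential map\<close>

context riemannian
begin

abbreviation exp_coord :: "'m \<Rightarrow> 'e \<Rightarrow> 'e" where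
  "exp_coord x \<equiv> \<lambda>v. chart_map (pref_chart M x) (riem_exp M x v)"

text \<open>
  With \<open>F\<close> the exponential map in coordinates, \<open>F(t v)\<close> is the geodesic with initial velocity \<open>v\<close>.
  Its velocity is \<open>DF(t v) v\<close>; differentiating once more at \<open>t = 0\<close> and
  comparing with the geodesic equation gives the second derivative of \<open>F\<close>.
\<close>

lemma exp_second_order_ray:
  assumes x: "x \<in> points M" and N: "open N" "0 \<in> N" "Ck_on 2 N (exp_coord x)"
    and inchart: "\<And>w. w \<in> N \<Longrightarrow> riem_exp M x w \<in> chart_dom (pref_chart M x)"
    and v: "v \<in> exp_dom M x"
  shows "riem_exp M x 0 = x" "D (exp_coord x) 0 v = v"
    "D2 (exp_coord x) 0 v v = - christoffel M (pref_chart M x) (chart_map (pref_chart M x) x) v v"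
proof -
  define c where "c = pref_chart M x"
  let ?F = "exp_coord x"
  have c: "c \<in> atlas M" "x \<in> chart_dom c" using pref[OF x] by (auto simp: c_def)
  obtain \<gamma> where gf: "geodesic_from M x v \<gamma>" using v by (auto simp: exp_dom_def)
  have g: "geodesic M {0..1} \<gamma>" and init: "\<gamma> 0 = x"
    and vel: "((\<lambda>t. chart_map c (\<gamma> t)) has_vector_derivative v) (at 0 within {0..1})"
    using gf by (auto simp: geodesic_from_def c_def)
  have ray: "riem_exp M x (t *\<^sub>R v) = \<gamma> t" if "t \<in> {0..1}" for t by (rule exp_ray[OF gf that])
  show "riem_exp M x 0 = x" using ray[of 0] init by simp
  obtain d where d: "\<And>s. s \<in> {0..1} \<Longrightarrow> \<gamma> s \<in> chart_dom c \<Longrightarrow>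
      ((\<lambda>s. chart_map c (\<gamma> s)) has_vector_derivative d s) (at s within {0..1})"
    "\<And>s. s \<in> {0..1} \<Longrightarrow> \<gamma> s \<in> chart_dom c \<Longrightarrow>
      (d has_vector_derivative - christoffel M c (chart_map c (\<gamma> s)) (d s) (d s)) (at s within {0..1})"
    using geodesic_velocity[OF g c(1)] by blast
  have d0: "d 0 = v"
    using vector_derivative_eq_on_interval[of 0 1 0 "{0..1}"] d(1)[of 0] vel init c(2) by auto
  have "((\<lambda>t. t *\<^sub>R v) \<longlongrightarrow> 0 *\<^sub>R v) (at (0::real) within {0..1})" by (intro tendsto_intros)
  then have "\<forall>\<^sub>F t in at (0::real) within {0..1}. t *\<^sub>R v \<in> N"
    by (rule topological_tendstoD[OF _ N(1)]) (simp add: N(2))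
  then obtain e0 where e0: "e0 > 0" "\<And>t. t \<in> {0..1} \<Longrightarrow> t \<noteq> 0 \<Longrightarrow> dist t 0 < e0 \<Longrightarrow> t *\<^sub>R v \<in> N"
    unfolding eventually_at by blast
  define e where "e = min (e0 / 2) 1"
  have e: "0 < e" "e \<le> 1" "e < e0" using e0(1) by (auto simp: e_def)
  have inN: "t *\<^sub>R v \<in> N" "t \<in> {0..1}" if "t \<in> {0..e}" for t
  proof -
    show "t \<in> {0..1}" using that e by auto
    then show "t *\<^sub>R v \<in> N" using e0(2)[of t] that e N(2) by (cases "t = 0") auto
  qed
  have F: "?F differentiable (at w)" "(\<lambda>w. D ?F w u) differentiable (at w)" if "w \<in> N" for w u
    using N(3) that by (auto simp: numeral_2_eq_2)
  have rayd: "((\<lambda>t. h (t *\<^sub>R v)) has_vector_derivative D h (t *\<^sub>R v) v) (at t within I)"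
    if "h differentiable (at (t *\<^sub>R v))" for h :: "'e \<Rightarrow> 'e" and t I
  proof -
    have "((\<lambda>t. t *\<^sub>R v) has_derivative (\<lambda>s. s *\<^sub>R v)) (at t)" by (auto intro!: derivative_eq_intros)
    from has_derivative_compose[OF this D_works[OF that]]
    have "((\<lambda>t. h (t *\<^sub>R v)) has_derivative (\<lambda>s. s *\<^sub>R D h (t *\<^sub>R v) v)) (at t)"
      by (simp add: linear_scale[OF linear_D[OF that]])
    then show ?thesis unfolding has_vector_derivative_def by (rule has_derivative_at_withinI)
  qed
  have vel_eq: "D ?F (t *\<^sub>R v) v = d t" if t: "t \<in> {0..e}" for t
  proof (rule vector_derivative_eq_on_interval[of 0 e t "{0..1}"])
    show "((\<lambda>t. ?F (t *\<^sub>R v)) has_vector_derivative D ?F (t *\<^sub>R v) v) (at t within {0..1})"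
      by (rule rayd[OF F(1)[OF inN(1)[OF t]]])
    show "((\<lambda>t. chart_map c (\<gamma> t)) has_vector_derivative d t) (at t within {0..1})"
      using d(1)[OF inN(2)[OF t]] inchart[OF inN(1)[OF t]] ray[OF inN(2)[OF t]] by (simp add: c_def)
    show "?F (s *\<^sub>R v) = chart_map c (\<gamma> s)" if "s \<in> {0..e}" for s
      using ray[OF inN(2)[OF that]] by (simp add: c_def)
  qed (use e t in auto)
  from vel_eq[of 0] show "D ?F 0 v = v" using d0 e by simp
  have "D2 ?F 0 v v = - christoffel M c (chart_map c (\<gamma> 0)) (d 0) (d 0)"
  proof (rule vector_derivative_eq_on_interval[of 0 e 0 "{0..1}"])
    show "((\<lambda>t. D ?F (t *\<^sub>R v) v) has_vector_derivative D2 ?F 0 v v) (at 0 within {0..1})"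
      using rayd[OF F(2)[OF inN(1)[of 0]], of v] e by simp
    show "(d has_vector_derivative - christoffel M c (chart_map c (\<gamma> 0)) (d 0) (d 0)) (at 0 within {0..1})"
      by (rule d(2)) (simp_all add: init c)
  qed (use e vel_eq in auto)
  then show "D2 ?F 0 v v = - christoffel M (pref_chart M x) (chart_map (pref_chart M x) x) v v"
    using d0 init by (simp add: c_def)
qed

text \<open>
  Short multiples of \<open>u\<close> lie in the domain of the exponential map, and both sides are homogeneous
  in \<open>u\<close>.
\<close>

lemma exp_second_order:
  assumes x: "x \<in> points M" and N: "open N" "0 \<in> N" "Ck_on 2 N (exp_coord x)"
    and inchart: "\<And>w. w \<in> N \<Longrightarrow> riem_exp M x w \<in> chart_dom (pref_chart M x)"
    and dom: "N \<subseteq> exp_dom M x"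
  shows "D (exp_coord x) 0 u = u"
    "D2 (exp_coord x) 0 u u = - christoffel M (pref_chart M x) (chart_map (pref_chart M x) x) u u"
proof -
  let ?F = "exp_coord x" and ?G = "christoffel M (pref_chart M x) (chart_map (pref_chart M x) x)"
  have "((\<lambda>s. s *\<^sub>R u) \<longlongrightarrow> 0 *\<^sub>R u) (at_right (0::real))" by (intro tendsto_intros)
  then have "\<forall>\<^sub>F s in at_right (0::real). s *\<^sub>R u \<in> N"
    by (rule topological_tendstoD[OF _ N(1)]) (simp add: N(2))
  then have "\<forall>\<^sub>F s in at_right (0::real). 0 < s \<and> s *\<^sub>R u \<in> N"
    by (intro eventually_conj eventually_at_right_less)
  then obtain s :: real where s: "0 < s" "s *\<^sub>R u \<in> N"
    using eventually_happens'[OF trivial_limit_at_right_real] by blast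
  note ray = exp_second_order_ray[OF x N inchart, of "s *\<^sub>R u"]
  have sd: "s *\<^sub>R u \<in> exp_dom M x" using s dom by blast
  have C2: "C2_at 0 ?F" unfolding C2_at_def using N by blast
  have lin: "linear (D ?F 0)" by (rule linear_D[OF C2_at_differentiable(1)[OF C2]])
  have "s *\<^sub>R D ?F 0 u = s *\<^sub>R u" using ray(2) sd by (simp add: linear_scale[OF lin])
  then show "D ?F 0 u = u" using s by simp
  interpret g: coordinate_metric "chart_img (pref_chart M x)" "coord_metric M (pref_chart M x)"
    by (rule coordinate_metric[OF pref(1)[OF x]])
  have G: "bilinear ?G" unfolding christoffel_eq by (rule g.\<Gamma>_bilinear) (use pref[OF x] in blast)
  have eq: "s *\<^sub>R s *\<^sub>R D2 ?F 0 u u = s *\<^sub>R s *\<^sub>R (- ?G u u)"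
    using ray(3)[OF _ sd] bilinear_lmul[OF C2_at_bilinear[OF C2]] bilinear_rmul[OF C2_at_bilinear[OF C2]]
    by (simp add: bilinear_lmul[OF G] bilinear_rmul[OF G])
  have s0: "s \<noteq> 0" using s by simp
  show "D2 ?F 0 u u = - ?G u u"
    by (rule scaleR_left_imp_eq[OF s0 scaleR_left_imp_eq[OF s0 eq]])
qed

end

text \<open>
  A constant metric has vanishing Christoffel symbols.
\<close>

lemma tangent_manifold_riemannian:
  fixes M :: "('m::t2_space, 'e::euclidean_space) riem_structure"
  assumes M: "riemannian_manifold M" and x: "x \<in> points M" and U: "open U"
  shows "riemannian (tangent_manifold M x U)"
    and "v \<in> U \<Longrightarrow> christoffel (tangent_manifold M x U) (U, \<lambda>v. v) v u w = 0"
proof -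
  let ?T = "tangent_manifold M x U" and ?c = "(U, \<lambda>v. v) :: ('e, 'e) chart"
  have inv: "chart_inv ?c v = v" if "v \<in> U" for v
    using that inv_into_f_f[of "\<lambda>v. v" U v] by (simp add: chart_inv_def inj_on_def)
  have T: "atlas ?T = {?c}" "pref_chart ?T y = ?c" "metric ?T y = metric M x" for y
    by (simp_all add: tangent_manifold_def)
  have g: "inner_product_form (metric M x)"
    using M x by (auto simp: riemannian_manifold_def)
  have Did: "D (\<lambda>p. chart_inv ?c p) q = (\<lambda>h. h)" if "q \<in> U" for q
  proof -
    have "D (\<lambda>p. chart_inv ?c p) q = D (\<lambda>p. p) q" by (rule D_cong_open[OF U that inv])
    then show ?thesis by simp
  qed
  have met: "coord_metric ?T ?c q u w = metric M x u w" if "q \<in> U" for q u w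
    using that by (simp add: coord_metric_def Let_def T transition_deriv_def inv Did)
  have smooth_id: "Ck_on k U (\<lambda>p. chart_inv ?c p)" for k
    by (rule Ck_on_cong[OF U _ Ck_on_bounded_linear[OF U bounded_linear_ident]]) (simp add: inv)
  have smooth_met: "Ck_on k U (\<lambda>q. coord_metric ?T ?c q u w)" for k u w
    by (rule Ck_on_cong[OF U _ Ck_on_const[of k U "metric M x u w"]]) (simp add: met)
  have "homeomorphism U U (\<lambda>v. v) (chart_inv ?c)"
    unfolding homeomorphism_def using inv Ck_on_continuous[OF smooth_id]
    by (auto simp: image_iff)
  then show R: "riemannian ?T"
    using g U smooth_id smooth_met inv
    by (auto simp: riemannian_def riemannian_manifold_def T smooth_on_def points_def image_def)
  interpret T: riemannian ?T by fact
  assume v: "v \<in> U"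
  interpret g: coordinate_metric U "coord_metric ?T ?c"
    using T.coordinate_metric[of ?c] by (simp add: T)
  have D0: "D (\<lambda>q. coord_metric ?T ?c q a b) v = (\<lambda>_. 0)" for a b
  proof -
    have "D (\<lambda>q. coord_metric ?T ?c q a b) v = D (\<lambda>q. metric M x a b) v"
      by (rule D_cong_open[OF U v met])
    then show ?thesis by simp
  qed
  show "christoffel ?T ?c v u w = 0"
    unfolding T.christoffel_eq
    by (rule g.\<Gamma>_unique[OF v]) (simp add: g.koszul_def D0 linear_0[OF g.metric_linear(1)[OF v]])
qed

theorem proposition2p8:
  fixes M :: "('m::t2_space, 'e::euclidean_space) riem_structure"
    and f :: "'m \<Rightarrow> ereal"
    and x :: 'm
    and \<zeta> :: "'e \<Rightarrow> real"
    and A :: "'e \<Rightarrow> 'e \<Rightarrow> real"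
    and U :: "'e set"
  assumes "riemannian_manifold M"
    and "\<forall>y\<in>points M. f y \<noteq> - \<infinity>"
    and "lower_semicontinuous_on (points M) f"
    and "x \<in> points M"
    and "linear \<zeta>"
    and "symmetric_bilinear A"
    and "normal_domain M x U"
  shows "(\<zeta>, A) \<in> limiting_subjet M f x \<longleftrightarrow>
         (\<zeta>, A) \<in> limiting_subjet (tangent_manifold M x U) (\<lambda>v. f (riem_exp M x v)) 0"
proof -
  interpret riemannian M by (rule riemannian.intro) fact
  have x: "x \<in> points M" by fact
  define c where "c = pref_chart M x"
  have c: "c \<in> atlas M" "x \<in> chart_dom c" using pref[OF x] by (auto simp: c_def)
  let ?T = "tangent_manifold M x U" and ?ct = "(U, \<lambda>v. v) :: ('e, 'e) chart"
  let ?E = "riem_exp M x"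
  define F where "F = (\<lambda>v. chart_map c (?E v))"
  define G where "G = (\<lambda>q. inv_into U ?E (chart_inv c q))"
  define p where "p = chart_map c x"
  define \<Gamma> where "\<Gamma> = christoffel M c p"
  have U: "open U" "0 \<in> U" "U \<subseteq> exp_dom M x" "open (?E ` U)" "inj_on ?E U"
    and sm: "smooth_map ?T M U ?E" "smooth_map M ?T (?E ` U) (inv_into U ?E)"
    using assms(7) by (auto simp: normal_domain_def diffeo_onto_image_def)
  have inv: "chart_inv ?ct v = v" if "v \<in> U" for v
    using that inv_into_f_f[of "\<lambda>v. v" U v] by (simp add: chart_inv_def inj_on_def)
  have T: "atlas ?T = {?ct}" "pref_chart ?T y = ?ct" "points ?T = U" for y
    by (simp_all add: tangent_manifold_def points_def)
  interpret T: riemannian ?T by (rule tangent_manifold_riemannian(1)[OF assms(1) x U(1)])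
  define N where "N = U \<inter> ?E -` chart_dom c"
  define S where "S = chart_map c ` (?E ` U \<inter> chart_dom c)"
  have No: "open N"
    unfolding N_def
    by (rule continuous_open_preimage[OF _ U(1) chart(1)[OF c(1)]]) (use sm(1) in \<open>simp add: smooth_map_def\<close>)
  have So: "open S" unfolding S_def by (rule open_chart_image[OF c(1) U(4)])
  have F2: "Ck_on 2 N F"
  proof (rule Ck_on_cong[OF No])
    show "Ck_on 2 N (\<lambda>v. chart_map c (?E (chart_inv ?ct v)))"
      using sm(1) c(1) unfolding smooth_map_def T(1) smooth_on_def by (auto simp: N_def)
  qed (auto simp: F_def N_def inv)
  have G2: "Ck_on 2 S G"
  proof -
    have "Ck_on 2 (chart_map c ` (?E ` U \<inter> chart_dom c \<inter> inv_into U ?E -` U)) G"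
      using sm(2) c(1) unfolding smooth_map_def T(1) smooth_on_def by (auto simp: G_def)
    moreover have "?E ` U \<inter> chart_dom c \<inter> inv_into U ?E -` U = ?E ` U \<inter> chart_dom c"
      by (auto intro: inv_into_into)
    ultimately show ?thesis by (simp add: S_def)
  qed
  have FG: "G q \<in> N" "F (G q) = q" if "q \<in> S" for q
  proof -
    obtain y where y: "y \<in> ?E ` U" "y \<in> chart_dom c" "q = chart_map c y" using \<open>q \<in> S\<close> by (auto simp: S_def)
    have "?E (inv_into U ?E y) = y" "inv_into U ?E y \<in> U"
      using y(1) by (auto simp: f_inv_into_f inv_into_into)
    then show "G q \<in> N" "F (G q) = q" using y c(1) by (auto simp: G_def F_def N_def)
  qed
  have GF: "F v \<in> S" "G (F v) = v" if "v \<in> N" for v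
    using that c(1) U(5) by (auto simp: F_def G_def N_def S_def)
  have E0: "?E 0 = x"
  proof -
    obtain \<gamma> where "geodesic_from M x 0 \<gamma>" using U(2,3) by (auto simp: exp_dom_def)
    from exp_ray[OF this, of 0] show ?thesis using \<open>geodesic_from M x 0 \<gamma>\<close> by (simp add: geodesic_from_def)
  qed
  have N0: "0 \<in> N" using U(2) E0 c(2) by (simp add: N_def)
  have F0: "F 0 = p" by (simp add: F_def E0 p_def)
  have pS: "p \<in> S" and Gp: "G p = 0" using GF[OF N0] by (simp_all add: F0)
  have DF: "D F 0 u = u" "D2 F 0 u u = - \<Gamma> u u" for u
    using exp_second_order[OF x No N0, of u] F2 U(3)
    by (auto simp: F_def c_def N_def \<Gamma>_def p_def)
  have C2F: "C2_at (G p) F" unfolding C2_at_def Gp using No N0 F2 by blast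
  note comp = C2_at_compose[OF So pS G2 C2F]
  \<comment> \<open>the derivatives of the inverse at \<open>p\<close>, by differentiating \<open>F (G q) = q\<close> once and twice\<close>
  have DG: "D G p u = u" for u
  proof -
    have "D (\<lambda>q. F (G q)) p u = D (\<lambda>q. q) p u"
      by (rule fun_cong[OF D_cong_open[OF So pS FG(2)]])
    then show ?thesis using comp(2)[of u] by (simp add: Gp DF)
  qed
  have D2G: "D2 G p u u = \<Gamma> u u" for u
  proof -
    have "D2 (\<lambda>q. F (G q)) p u u = D2 (\<lambda>q. q) p u u"
      by (rule D2_cong_open[OF So pS FG(2)])
    moreover have "D2 (\<lambda>q. F (G q)) p u u = D2 F 0 u u + D F 0 (D2 G p u u)"
      unfolding comp(3) by (simp add: Gp DG)
    ultimately show ?thesis by (simp add: DF)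
  qed
  let ?h = "\<lambda>q. f (chart_inv c q)" and ?k = "\<lambda>v. f (?E v)"
  have M_side: "(\<zeta>, A) \<in> limiting_subjet M f x \<longleftrightarrow>
      coordinate_limiting_jet ?h p \<zeta> (\<lambda>u. A u u + \<zeta> (\<Gamma> u u))"
    using limiting_subjet_chart[OF x c_def] assms(5,6) by (simp add: p_def \<Gamma>_def)
  have T_side: "(\<zeta>, A) \<in> limiting_subjet ?T ?k 0 \<longleftrightarrow> coordinate_limiting_jet ?k 0 \<zeta> (\<lambda>u. A u u)"
  proof -
    have "(\<zeta>, A) \<in> limiting_subjet ?T ?k 0 \<longleftrightarrow>
        coordinate_limiting_jet (\<lambda>v. ?k (chart_inv ?ct v)) 0 \<zeta> (\<lambda>u. A u u)"
      using T.limiting_subjet_chart[of 0 ?ct \<zeta> A ?k] assms(5,6) U(2)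
        tangent_manifold_riemannian(2)[OF assms(1) x U(1,2)]
      by (simp add: T linear_0)
    also have "\<dots> \<longleftrightarrow> coordinate_limiting_jet ?k 0 \<zeta> (\<lambda>u. A u u)"
      using coordinate_limiting_jet_cong[OF U(1,2), of "\<lambda>v. ?k (chart_inv ?ct v)" ?k]
        coordinate_limiting_jet_cong[OF U(1,2), of ?k "\<lambda>v. ?k (chart_inv ?ct v)"] inv by auto
    finally show ?thesis .
  qed
  have hF: "?h (F v) = ?k v" if "v \<in> N" for v using that c(1) by (simp add: F_def N_def)
  have kG: "?k (G q) = ?h q" if "q \<in> S" for q
    using hF[OF FG(1)[OF that]] FG(2)[OF that] by simp
  show ?thesis unfolding M_side T_side
  proof
    assume jet: "coordinate_limiting_jet ?h p \<zeta> (\<lambda>u. A u u + \<zeta> (\<Gamma> u u))"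
    have "coordinate_limiting_jet (\<lambda>v. ?h (F v)) (G p) (\<lambda>u. \<zeta> (D F (G p) u))
        (\<lambda>u. (A (D F (G p) u) (D F (G p) u) + \<zeta> (\<Gamma> (D F (G p) u) (D F (G p) u))) + \<zeta> (D2 F (G p) u u))"
      by (rule coordinate_limiting_jet_compose[OF No F2 So pS Ck_on_continuous[OF G2] _ jet]) (simp add: FG)
    then have "coordinate_limiting_jet (\<lambda>v. ?h (F v)) 0 \<zeta> (\<lambda>u. A u u)"
      by (simp add: Gp DF linear_neg[OF assms(5)])
    then show "coordinate_limiting_jet ?k 0 \<zeta> (\<lambda>u. A u u)"
      by (rule coordinate_limiting_jet_cong[OF No N0 hF, rotated])
  next
    assume jet: "coordinate_limiting_jet ?k 0 \<zeta> (\<lambda>u. A u u)"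
    have "coordinate_limiting_jet (\<lambda>q. ?k (G q)) (F 0) (\<lambda>u. \<zeta> (D G (F 0) u))
        (\<lambda>u. A (D G (F 0) u) (D G (F 0) u) + \<zeta> (D2 G (F 0) u u))"
      by (rule coordinate_limiting_jet_compose[OF So G2 No N0 Ck_on_continuous[OF F2] _ jet]) (simp add: GF)
    then have "coordinate_limiting_jet (\<lambda>q. ?k (G q)) p \<zeta> (\<lambda>u. A u u + \<zeta> (\<Gamma> u u))"
      by (simp add: F0 DG D2G)
    then show "coordinate_limiting_jet ?h p \<zeta> (\<lambda>u. A u u + \<zeta> (\<Gamma> u u))"
      by (rule coordinate_limiting_jet_cong[OF So pS kG, rotated])
  qed
qed

end
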